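(* Let $\Lambda$ be an artin algebra and let $\mathscr{A}=\mathrm{mod}\text{-}\Lambda$ be the category of finitely generated $\Lambda$-modules. Then a triple $(\mathscr{C},\mathscr{T},\mathscr{F})$ of full subcategories of $\mathscr{A}$ is a $\tau$-cotorsion torsion triple if and only if it is a left weak cotorsion torsion triple.
   Context: Subcategories are full and additive, i.e. closed under isomorphisms, finite direct sums and direct summands. ${}^{\perp_1}\mathscr{D}=\{A\mid\mathrm{Ext}^1(A,\mathscr{D})=0\}$. A left $\mathscr{X}$-approximation of $A$ is a morphism $f:A\to X$ with $X\in\mathscr{X}$ such that every morphism $A\to X'$ with $X'\in\mathscr{X}$ factors through $f$; right approximations are dual; $\mathscr{X}$ is contravariantly finite if every object has a right $\mathscr{X}$-approximation. Torsion pair $(\mathscr{T},\mathscr{F})$: $\mathrm{Hom}(\mathscr{T},\mathscr{F})=0$ and every $A\in\mathscr{A}$ has a short exact sequence $0\to tA\to A\to fA\to0$ with $tA\in\mathscr{T}$, $fA\in\mathscr{F}$. $\tau$-cotorsion pair $(\mathscr{C},\mathscr{D})$: (1) $\mathscr{C}={}^{\perp_1}\mathscr{D}$; (2) for every projective $P$ there is an exact sequence $P\xrightarrow{f}D\to C\to0$ with $D\in\mathscr{C}\cap\mathscr{D}$, $C\in\mathscr{C}$ and $f$ a left $\mathscr{D}$-approximation; (3) $\mathscr{C}\cap\mathscr{D}$ is contravariantly finite. A $\tau$-cotorsion torsion triple is a triple $(\mathscr{C},\mathscr{T},\mathscr{F})$ such that $(\mathscr{C},\mathscr{T})$ is a $\tau$-cotorsion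 pair and $(\mathscr{T},\mathscr{F})$ is a torsion pair. Left weak cotorsion pair $(\mathscr{C},\mathscr{D})$ in $\mathrm{mod}\text{-}\Lambda$: (1) $\mathrm{Ext}^1_\Lambda(\mathscr{C},\mathscr{D})=0$; (2) for every $M\in\mathrm{mod}\text{-}\Lambda$ there are exact sequences $M\xrightarrow{f}D\to C\to0$ and $0\to D'\to C'\xrightarrow{g}M\to0$ with $C,C'\in\mathscr{C}$, $D,D'\in\mathscr{D}$, $f$ a left $\mathscr{D}$-approximation of $M$ and $g$ a right $\mathscr{C}$-approximation of $M$. A left weak cotorsion torsion triple is a triple $(\mathscr{C},\mathscr{T},\mathscr{F})$ such that $(\mathscr{C},\mathscr{T})$ is a left weak cotorsion pair and $(\mathscr{T},\mathscr{F})$ is a torsion pair. *)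

theory Defs
  imports "HOL-Algebra.Module" "HOL-Algebra.RingHom" "HOL-Library.Equipollence"
begin

text \<open>
  Artin algebras. The structure of a \<open>k\<close>-algebra on \<open>\<Lambda>\<close> is a unital ring homomorphism
  \<open>\<phi>\<close> from \<open>k\<close> to the centre of \<open>\<Lambda>\<close>.
\<close>

locale artinian_cring = cring k for k (structure) +
  assumes descending_chain:
    "\<And>I :: nat \<Rightarrow> _ set. \<lbrakk>\<And>n. ideal (I n) k; \<And>n. I (Suc n) \<subseteq> I n\<rbrakk>
      \<Longrightarrow> \<exists>n. \<forall>m\<ge>n. I m = I n"

locale artin_algebra = k?: artinian_cring k + \<Lambda>?: ring \<Lambda>
  for k (structure) and \<phi> and \<Lambda> (structure) +
  assumes structure_hom: "\<phi> \<in> ring_hom k \<Lambda>"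
    and structure_central:
      "\<lbrakk>c \<in> carrier k; x \<in> carrier \<Lambda>\<rbrakk> \<Longrightarrow> \<phi> c \<otimes>\<^bsub>\<Lambda>\<^esub> x = x \<otimes>\<^bsub>\<Lambda>\<^esub> \<phi> c"
    and finite_over_base:
      "\<exists>X. finite X \<and> X \<subseteq> carrier \<Lambda> \<and>
        (\<forall>y\<in>carrier \<Lambda>. \<exists>c\<in>X \<rightarrow> carrier k. y = (\<Oplus>\<^bsub>\<Lambda>\<^esub>x\<in>X. \<phi> (c x) \<otimes>\<^bsub>\<Lambda>\<^esub> x))"

text \<open>
  Right modules over a not necessarily commutative ring. We reuse the record type of
  \<^theory>\<open>HOL-Algebra.Module\<close>, whose scalar operation has the scalar as its first argument:
  \<open>a \<odot>\<^bsub>M\<^esub> x\<close> stands for the right action \<open>x \<cdot> a\<close>, whence the order of the factors in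
  \<open>act_assoc\<close>. As in that theory, the fields \<open>mult\<close> and \<open>one\<close> of \<open>M\<close> are irrelevant.
\<close>

locale right_module = R?: ring R + M?: abelian_group M
  for R (structure) and M (structure) +
  assumes act_closed:
      "\<lbrakk>a \<in> carrier R; x \<in> carrier M\<rbrakk> \<Longrightarrow> a \<odot>\<^bsub>M\<^esub> x \<in> carrier M"
    and act_scalar_distr:
      "\<lbrakk>a \<in> carrier R; b \<in> carrier R; x \<in> carrier M\<rbrakk>
        \<Longrightarrow> (a \<oplus>\<^bsub>R\<^esub> b) \<odot>\<^bsub>M\<^esub> x = a \<odot>\<^bsub>M\<^esub> x \<oplus>\<^bsub>M\<^esub> b \<odot>\<^bsub>M\<^esub> x"
    and act_vector_distr:
      "\<lbrakk>a \<in> carrier R; x \<in> carrier M; y \<in> carrier M\<rbrakk>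
        \<Longrightarrow> a \<odot>\<^bsub>M\<^esub> (x \<oplus>\<^bsub>M\<^esub> y) = a \<odot>\<^bsub>M\<^esub> x \<oplus>\<^bsub>M\<^esub> a \<odot>\<^bsub>M\<^esub> y"
    and act_assoc:
      "\<lbrakk>a \<in> carrier R; b \<in> carrier R; x \<in> carrier M\<rbrakk>
        \<Longrightarrow> (a \<otimes>\<^bsub>R\<^esub> b) \<odot>\<^bsub>M\<^esub> x = b \<odot>\<^bsub>M\<^esub> (a \<odot>\<^bsub>M\<^esub> x)"
    and act_one: "x \<in> carrier M \<Longrightarrow> \<one>\<^bsub>R\<^esub> \<odot>\<^bsub>M\<^esub> x = x"

definition finitely_generated :: "('a, 'r) ring_scheme \<Rightarrow> ('a, 'm) module \<Rightarrow> bool" where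
  "finitely_generated R M \<longleftrightarrow>
    (\<exists>X. finite X \<and> X \<subseteq> carrier M \<and>
      (\<forall>y\<in>carrier M. \<exists>c\<in>X \<rightarrow> carrier R. y = (\<Oplus>\<^bsub>M\<^esub>x\<in>X. c x \<odot>\<^bsub>M\<^esub> x)))"

text \<open>
  The objects of mod-\<open>R\<close> whose elements are taken from the type \<open>'m\<close>. If \<open>'m\<close> is
  infinite and has at least the cardinality of \<open>R\<close>, then every finitely generated module,
  over whatever type, is isomorphic to one of these; see \<open>fg_mod_universal\<close> below.
\<close>

definition fg_mod :: "('a, 'r) ring_scheme \<Rightarrow> ('a, 'm) module set" where
  "fg_mod R = {M. right_module R M \<and> finitely_generated R M}"

text \<open>
  Values of a morphism outside the carrier of its source are arbitrary, so morphisms are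
  always compared on carriers.
\<close>

definition mod_hom ::
  "('a, 'r) ring_scheme \<Rightarrow> ('a, 'm) module \<Rightarrow> ('a, 'n) module \<Rightarrow> ('m \<Rightarrow> 'n) set" where
  "mod_hom R M N =
    {f \<in> carrier M \<rightarrow> carrier N.
      (\<forall>x\<in>carrier M. \<forall>y\<in>carrier M. f (x \<oplus>\<^bsub>M\<^esub> y) = f x \<oplus>\<^bsub>N\<^esub> f y) \<and>
      (\<forall>a\<in>carrier R. \<forall>x\<in>carrier M. f (a \<odot>\<^bsub>M\<^esub> x) = a \<odot>\<^bsub>N\<^esub> f x)}"

definition mod_iso ::
  "('a, 'r) ring_scheme \<Rightarrow> ('a, 'm) module \<Rightarrow> ('a, 'n) module \<Rightarrow> bool" where
  "mod_iso R M N \<longleftrightarrow> (\<exists>f\<in>mod_hom R M N. bij_betw f (carrier M) (carrier N))"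

definition exact_at ::
  "('a, 'm) module \<Rightarrow> ('m \<Rightarrow> 'm) \<Rightarrow> ('a, 'm) module \<Rightarrow> ('m \<Rightarrow> 'm) \<Rightarrow> ('a, 'm) module \<Rightarrow> bool" where
  "exact_at K f L g M \<longleftrightarrow> f ` carrier K = {x \<in> carrier L. g x = \<zero>\<^bsub>M\<^esub>}"

text \<open>\<open>K \<rightarrow> L \<rightarrow> M \<rightarrow> 0\<close> and \<open>0 \<rightarrow> K \<rightarrow> L \<rightarrow> M \<rightarrow> 0\<close>, respectively.\<close>

definition right_exact_seq ::
  "('a, 'r) ring_scheme \<Rightarrow> ('a, 'm) module \<Rightarrow> ('m \<Rightarrow> 'm) \<Rightarrow> ('a, 'm) module \<Rightarrow> ('m \<Rightarrow> 'm)
    \<Rightarrow> ('a, 'm) module \<Rightarrow> bool" where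
  "right_exact_seq R K f L g M \<longleftrightarrow>
    f \<in> mod_hom R K L \<and> g \<in> mod_hom R L M \<and> exact_at K f L g M \<and>
    g ` carrier L = carrier M"

definition short_exact_seq ::
  "('a, 'r) ring_scheme \<Rightarrow> ('a, 'm) module \<Rightarrow> ('m \<Rightarrow> 'm) \<Rightarrow> ('a, 'm) module \<Rightarrow> ('m \<Rightarrow> 'm)
    \<Rightarrow> ('a, 'm) module \<Rightarrow> bool" where
  "short_exact_seq R K f L g M \<longleftrightarrow> right_exact_seq R K f L g M \<and> inj_on f (carrier K)"

definition projective :: "('a, 'r) ring_scheme \<Rightarrow> ('a, 'm) module \<Rightarrow> bool" where
  "projective R P \<longleftrightarrow> P \<in> fg_mod R \<and>
    (\<forall>M\<in>(fg_mod R :: ('a, 'm) module set). \<forall>N\<in>(fg_mod R :: ('a, 'm) module set).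
      \<forall>g\<in>mod_hom R M N. \<forall>f\<in>mod_hom R P N. g ` carrier M = carrier N \<longrightarrow>
      (\<exists>h\<in>mod_hom R P M. \<forall>x\<in>carrier P. g (h x) = f x))"

text \<open>
  \<open>Ext1 R A D\<close> is the (Yoneda) set of equivalence classes of extensions
  \<open>0 \<rightarrow> D \<rightarrow> E \<rightarrow> A \<rightarrow> 0\<close> in mod-\<open>R\<close>. The zero element of this group is
  the class consisting of the split extensions.
\<close>

type_synonym ('a, 'm) extension = "('a, 'm) module \<times> ('m \<Rightarrow> 'm) \<times> ('m \<Rightarrow> 'm)"

definition extensions ::
  "('a, 'r) ring_scheme \<Rightarrow> ('a, 'm) module \<Rightarrow> ('a, 'm) module \<Rightarrow> ('a, 'm) extension set" where
  "extensions R A D = {(E, i, p). E \<in> fg_mod R \<and> short_exact_seq R D i E p A}"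

definition ext_rel ::
  "('a, 'r) ring_scheme \<Rightarrow> ('a, 'm) module \<Rightarrow> ('a, 'm) module
    \<Rightarrow> (('a, 'm) extension \<times> ('a, 'm) extension) set" where
  "ext_rel R A D =
    {((E, i, p), (E', i', p')).
      (E, i, p) \<in> extensions R A D \<and> (E', i', p') \<in> extensions R A D \<and>
      (\<exists>h\<in>mod_hom R E E'. bij_betw h (carrier E) (carrier E') \<and>
        (\<forall>x\<in>carrier D. h (i x) = i' x) \<and> (\<forall>y\<in>carrier E. p' (h y) = p y))}"

definition Ext1 ::
  "('a, 'r) ring_scheme \<Rightarrow> ('a, 'm) module \<Rightarrow> ('a, 'm) module \<Rightarrow> ('a, 'm) extension set set" where
  "Ext1 R A D = extensions R A D // ext_rel R A D"

definition Ext1_zero ::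
  "('a, 'r) ring_scheme \<Rightarrow> ('a, 'm) module \<Rightarrow> ('a, 'm) module \<Rightarrow> ('a, 'm) extension set" where
  "Ext1_zero R A D =
    {(E, i, p). (E, i, p) \<in> extensions R A D \<and>
      (\<exists>s\<in>mod_hom R A E. \<forall>x\<in>carrier A. p (s x) = x)}"

definition Ext1_vanishes :: "('a, 'r) ring_scheme \<Rightarrow> ('a, 'm) module \<Rightarrow> ('a, 'm) module \<Rightarrow> bool" where
  "Ext1_vanishes R A D \<longleftrightarrow> Ext1 R A D = {Ext1_zero R A D}"

text \<open>Full subcategories are given by their classes of objects.\<close>

definition biproduct ::
  "('a, 'r) ring_scheme \<Rightarrow> ('a, 'm) module \<Rightarrow> ('a, 'm) module \<Rightarrow> ('a, 'm) module \<Rightarrow> bool" where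
  "biproduct R A B X \<longleftrightarrow>
    (\<exists>i\<in>mod_hom R A X. \<exists>j\<in>mod_hom R B X. \<exists>p\<in>mod_hom R X A. \<exists>q\<in>mod_hom R X B.
      (\<forall>a\<in>carrier A. p (i a) = a \<and> q (i a) = \<zero>\<^bsub>B\<^esub>) \<and>
      (\<forall>b\<in>carrier B. q (j b) = b \<and> p (j b) = \<zero>\<^bsub>A\<^esub>) \<and>
      (\<forall>x\<in>carrier X. i (p x) \<oplus>\<^bsub>X\<^esub> j (q x) = x))"

definition subcategory :: "('a, 'r) ring_scheme \<Rightarrow> ('a, 'm) module set \<Rightarrow> bool" where
  "subcategory R \<X> \<longleftrightarrow> \<X> \<subseteq> fg_mod R \<and>
    (\<forall>M\<in>\<X>. \<forall>N\<in>fg_mod R. mod_iso R M N \<longrightarrow> N \<in> \<X>) \<and>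
    (\<forall>Z\<in>fg_mod R. carrier Z = {\<zero>\<^bsub>Z\<^esub>} \<longrightarrow> Z \<in> \<X>) \<and>
    (\<forall>A\<in>\<X>. \<forall>B\<in>\<X>. \<forall>X\<in>fg_mod R. biproduct R A B X \<longrightarrow> X \<in> \<X>) \<and>
    (\<forall>X\<in>\<X>. \<forall>A\<in>fg_mod R. \<forall>B\<in>fg_mod R. biproduct R A B X \<longrightarrow> A \<in> \<X>)"

definition left_Ext1_perp ::
  "('a, 'r) ring_scheme \<Rightarrow> ('a, 'm) module set \<Rightarrow> ('a, 'm) module set" where
  "left_Ext1_perp R \<D> = {A \<in> fg_mod R. \<forall>D\<in>\<D>. Ext1_vanishes R A D}"

definition left_approx ::
  "('a, 'r) ring_scheme \<Rightarrow> ('a, 'm) module set \<Rightarrow> ('a, 'm) module \<Rightarrow> ('m \<Rightarrow> 'm)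
    \<Rightarrow> ('a, 'm) module \<Rightarrow> bool" where
  "left_approx R \<X> A f X \<longleftrightarrow> X \<in> \<X> \<and> f \<in> mod_hom R A X \<and>
    (\<forall>X'\<in>\<X>. \<forall>g\<in>mod_hom R A X'. \<exists>h\<in>mod_hom R X X'. \<forall>x\<in>carrier A. g x = h (f x))"

definition right_approx ::
  "('a, 'r) ring_scheme \<Rightarrow> ('a, 'm) module set \<Rightarrow> ('a, 'm) module \<Rightarrow> ('m \<Rightarrow> 'm)
    \<Rightarrow> ('a, 'm) module \<Rightarrow> bool" where
  "right_approx R \<X> X f A \<longleftrightarrow> X \<in> \<X> \<and> f \<in> mod_hom R X A \<and>
    (\<forall>X'\<in>\<X>. \<forall>g\<in>mod_hom R X' A. \<exists>h\<in>mod_hom R X' X. \<forall>x\<in>carrier X'. g x = f (h x))"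

definition contravariantly_finite ::
  "('a, 'r) ring_scheme \<Rightarrow> ('a, 'm) module set \<Rightarrow> bool" where
  "contravariantly_finite R \<X> \<longleftrightarrow> (\<forall>A\<in>fg_mod R. \<exists>X f. right_approx R \<X> X f A)"

definition torsion_pair ::
  "('a, 'r) ring_scheme \<Rightarrow> ('a, 'm) module set \<Rightarrow> ('a, 'm) module set \<Rightarrow> bool" where
  "torsion_pair R \<T> \<F> \<longleftrightarrow>
    (\<forall>T\<in>\<T>. \<forall>F\<in>\<F>. \<forall>f\<in>mod_hom R T F. \<forall>x\<in>carrier T. f x = \<zero>\<^bsub>F\<^esub>) \<and>
    (\<forall>A\<in>fg_mod R. \<exists>tA\<in>\<T>. \<exists>fA\<in>\<F>. \<exists>i p. short_exact_seq R tA i A p fA)"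

definition tau_cotorsion_pair ::
  "('a, 'r) ring_scheme \<Rightarrow> ('a, 'm) module set \<Rightarrow> ('a, 'm) module set \<Rightarrow> bool" where
  "tau_cotorsion_pair R \<C> \<D> \<longleftrightarrow>
    \<C> = left_Ext1_perp R \<D> \<and>
    (\<forall>P. projective R P \<longrightarrow>
      (\<exists>D\<in>\<C> \<inter> \<D>. \<exists>C\<in>\<C>. \<exists>f g. right_exact_seq R P f D g C \<and> left_approx R \<D> P f D)) \<and>
    contravariantly_finite R (\<C> \<inter> \<D>)"

definition tau_cotorsion_torsion_triple ::
  "('a, 'r) ring_scheme \<Rightarrow> ('a, 'm) module set \<Rightarrow> ('a, 'm) module set \<Rightarrow> ('a, 'm) module set
    \<Rightarrow> bool" where
  "tau_cotorsion_torsion_triple R \<C> \<T> \<F> \<longleftrightarrow>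
    tau_cotorsion_pair R \<C> \<T> \<and> torsion_pair R \<T> \<F>"

definition left_weak_cotorsion_pair ::
  "('a, 'r) ring_scheme \<Rightarrow> ('a, 'm) module set \<Rightarrow> ('a, 'm) module set \<Rightarrow> bool" where
  "left_weak_cotorsion_pair R \<C> \<D> \<longleftrightarrow>
    (\<forall>C\<in>\<C>. \<forall>D\<in>\<D>. Ext1_vanishes R C D) \<and>
    (\<forall>M\<in>fg_mod R.
      (\<exists>D\<in>\<D>. \<exists>C\<in>\<C>. \<exists>f g. right_exact_seq R M f D g C \<and> left_approx R \<D> M f D) \<and>
      (\<exists>D'\<in>\<D>. \<exists>C'\<in>\<C>. \<exists>i g. short_exact_seq R D' i C' g M \<and> right_approx R \<C> C' g M))"

definition left_weak_cotorsion_torsion_triple ::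
  "('a, 'r) ring_scheme \<Rightarrow> ('a, 'm) module set \<Rightarrow> ('a, 'm) module set \<Rightarrow> ('a, 'm) module set
    \<Rightarrow> bool" where
  "left_weak_cotorsion_torsion_triple R \<C> \<T> \<F> \<longleftrightarrow>
    left_weak_cotorsion_pair R \<C> \<T> \<and> torsion_pair R \<T> \<F>"

text \<open>
  The following shows that a sufficiently large type \<open>'m\<close> hosts all of mod-\<open>R\<close> up to
  isomorphism.
\<close>

lemma fg_mod_lepoll:
  fixes R :: "('a, 'r) ring_scheme" and M :: "('a, 'n) module"
  assumes inf: "infinite (UNIV :: 'm set)" and le: "carrier R \<lesssim> (UNIV :: 'm set)"
    and M: "M \<in> fg_mod R"
  shows "carrier M \<lesssim> (UNIV :: 'm set)"
proof -
  have sq: "(UNIV :: 'm set) \<times> (UNIV :: 'm set) \<lesssim> (UNIV :: 'm set)"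
    using card_of_Times_same_infinite[OF inf]
    by (metis card_of_ordIso eqpoll_def eqpoll_imp_lepoll)
  obtain X where X: "finite X" "X \<subseteq> carrier M"
    and gen: "\<forall>y\<in>carrier M. \<exists>c\<in>X \<rightarrow> carrier R. y = (\<Oplus>\<^bsub>M\<^esub>x\<in>X. c x \<odot>\<^bsub>M\<^esub> x)"
    using M by (auto simp: fg_mod_def finitely_generated_def)
  interpret right_module R M using M by (simp add: fg_mod_def)
  have "(X \<rightarrow>\<^sub>E carrier R) \<lesssim> (UNIV :: 'm set)"
    using X(1)
  proof (induction X rule: finite_induct)
    case empty
    then show ?case by (simp add: PiE_empty_domain finite_lepoll_infinite inf)
  next
    case (insert x S)
    have "(insert x S \<rightarrow>\<^sub>E carrier R) = (\<lambda>(y, g). g(x := y)) ` (carrier R \<times> (S \<rightarrow>\<^sub>E carrier R))"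
      by (rule PiE_insert_eq)
    then have "(insert x S \<rightarrow>\<^sub>E carrier R) \<lesssim> carrier R \<times> (S \<rightarrow>\<^sub>E carrier R)"
      by (metis image_lepoll)
    also have "\<dots> \<lesssim> (UNIV :: 'm set) \<times> (UNIV :: 'm set)"
      using times_lepoll_mono[OF le insert.IH] .
    also note sq
    finally show ?case .
  qed
  moreover have "carrier M \<subseteq> (\<lambda>c. \<Oplus>\<^bsub>M\<^esub>x\<in>X. c x \<odot>\<^bsub>M\<^esub> x) ` (X \<rightarrow>\<^sub>E carrier R)"
  proof
    fix y assume "y \<in> carrier M"
    then obtain c where c: "c \<in> X \<rightarrow> carrier R" "y = (\<Oplus>\<^bsub>M\<^esub>x\<in>X. c x \<odot>\<^bsub>M\<^esub> x)"
      using gen by blast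
    have "(\<Oplus>\<^bsub>M\<^esub>x\<in>X. restrict c X x \<odot>\<^bsub>M\<^esub> x) = (\<Oplus>\<^bsub>M\<^esub>x\<in>X. c x \<odot>\<^bsub>M\<^esub> x)"
      using c(1) X(2) by (intro M.finsum_cong') (auto intro!: act_closed)
    then have "y = (\<lambda>c. \<Oplus>\<^bsub>M\<^esub>x\<in>X. c x \<odot>\<^bsub>M\<^esub> x) (restrict c X)"
      using c(2) by simp
    moreover have "restrict c X \<in> X \<rightarrow>\<^sub>E carrier R" using c(1) by auto
    ultimately show "y \<in> (\<lambda>c. \<Oplus>\<^bsub>M\<^esub>x\<in>X. c x \<odot>\<^bsub>M\<^esub> x) ` (X \<rightarrow>\<^sub>E carrier R)" by blast
  qed
  ultimately show ?thesis
    by (meson image_lepoll lepoll_trans subset_imp_lepoll)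
qed

lemma fg_mod_universal:
  fixes R :: "('a, 'r) ring_scheme" and M :: "('a, 'n) module"
  assumes inf: "infinite (UNIV :: 'm set)" and le: "carrier R \<lesssim> (UNIV :: 'm set)"
    and M: "M \<in> fg_mod R"
  obtains N :: "('a, 'm) module" where "N \<in> fg_mod R" "mod_iso R M N"
proof -
  obtain j :: "'n \<Rightarrow> 'm" where j: "inj_on j (carrier M)"
    using fg_mod_lepoll[OF inf le M] by (auto simp: lepoll_def)
  define v where "v = inv_into (carrier M) j"
  interpret right_module R M using M by (simp add: fg_mod_def)
  have v [simp]: "v (j x) = x" if "x \<in> carrier M" for x
    using j that by (simp add: v_def)
  define N :: "('a, 'm) module" where
    "N = \<lparr>carrier = j ` carrier M, mult = (\<lambda>x y. x), one = j \<zero>\<^bsub>M\<^esub>, zero = j \<zero>\<^bsub>M\<^esub>,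
          add = (\<lambda>x y. j (v x \<oplus>\<^bsub>M\<^esub> v y)), smult = (\<lambda>a x. j (a \<odot>\<^bsub>M\<^esub> v x))\<rparr>"
  have ag: "abelian_group N"
  proof (rule abelian_groupI)
    fix x assume "x \<in> carrier N"
    then obtain x' where "x' \<in> carrier M" "x = j x'" by (auto simp: N_def)
    then show "\<exists>y\<in>carrier N. y \<oplus>\<^bsub>N\<^esub> x = \<zero>\<^bsub>N\<^esub>"
      by (intro bexI[of _ "j (\<ominus>\<^bsub>M\<^esub> x')"]) (auto simp: N_def M.l_neg)
  qed (auto simp: N_def M.a_ac)
  have rm: "right_module R N"
    by (intro right_module.intro right_module_axioms.intro ag R.ring_axioms)
      (auto simp: N_def act_closed act_scalar_distr act_vector_distr act_assoc act_one)
  interpret N: abelian_group N by (rule ag)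
  have jc: "j x \<in> carrier N" if "x \<in> carrier M" for x using that by (simp add: N_def)
  have sum: "j (finsum M g S) = finsum N (\<lambda>x. j (g x)) S"
    if "finite S" "g \<in> S \<rightarrow> carrier M" for S :: "'n set" and g
    using that
  proof (induction S rule: finite_induct)
    case empty
    then show ?case by simp (simp add: N_def)
  next
    case (insert x S)
    have "j (finsum M g (insert x S)) = j (g x \<oplus>\<^bsub>M\<^esub> finsum M g S)"
      using insert by simp
    also have "\<dots> = j (g x) \<oplus>\<^bsub>N\<^esub> j (finsum M g S)"
      using insert.prems by (simp add: N_def Pi_iff)
    also have "\<dots> = finsum N (\<lambda>x. j (g x)) (insert x S)"
      using insert jc by (subst N.finsum_insert) (auto simp: Pi_iff)
    finally show ?case .
  qed
  obtain X where X: "finite X" "X \<subseteq> carrier M"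
    and gen: "\<forall>y\<in>carrier M. \<exists>c\<in>X \<rightarrow> carrier R. y = (\<Oplus>\<^bsub>M\<^esub>x\<in>X. c x \<odot>\<^bsub>M\<^esub> x)"
    using M by (auto simp: fg_mod_def finitely_generated_def)
  have "finitely_generated R N"
    unfolding finitely_generated_def
  proof (intro exI[of _ "j ` X"] conjI ballI)
    show "finite (j ` X)" "j ` X \<subseteq> carrier N" using X by (auto simp: N_def)
    fix y assume "y \<in> carrier N"
    then obtain y' where y': "y' \<in> carrier M" "y = j y'" by (auto simp: N_def)
    then obtain c where c: "c \<in> X \<rightarrow> carrier R" "y' = (\<Oplus>\<^bsub>M\<^esub>x\<in>X. c x \<odot>\<^bsub>M\<^esub> x)"
      using gen by blast
    have cl: "c x \<odot>\<^bsub>M\<^esub> x \<in> carrier M" if "x \<in> X" for x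
      using that c(1) X(2) by (auto intro!: act_closed)
    have act: "c (v (j x)) \<odot>\<^bsub>N\<^esub> j x = j (c x \<odot>\<^bsub>M\<^esub> x)" if "x \<in> X" for x
      using that X(2) by (simp add: N_def subset_iff)
    have inj: "inj_on j X" using j X(2) by (rule inj_on_subset)
    have "(\<Oplus>\<^bsub>N\<^esub>z\<in>j ` X. c (v z) \<odot>\<^bsub>N\<^esub> z) = (\<Oplus>\<^bsub>N\<^esub>x\<in>X. c (v (j x)) \<odot>\<^bsub>N\<^esub> j x)"
      using inj act cl jc by (intro N.finsum_reindex) auto
    also have "\<dots> = (\<Oplus>\<^bsub>N\<^esub>x\<in>X. j (c x \<odot>\<^bsub>M\<^esub> x))"
      using act cl jc by (intro N.finsum_cong') auto
    also have "\<dots> = y"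
      using sum[OF X(1), of "\<lambda>x. c x \<odot>\<^bsub>M\<^esub> x"] cl c(2) y'(2) by auto
    finally have "y = (\<Oplus>\<^bsub>N\<^esub>z\<in>j ` X. c (v z) \<odot>\<^bsub>N\<^esub> z)" by simp
    moreover have "(\<lambda>z. c (v z)) \<in> j ` X \<rightarrow> carrier R"
      using c(1) X(2) by (auto simp: Pi_iff subset_iff)
    ultimately show "\<exists>c\<in>j ` X \<rightarrow> carrier R. y = (\<Oplus>\<^bsub>N\<^esub>z\<in>j ` X. c z \<odot>\<^bsub>N\<^esub> z)"
      by (intro bexI[of _ "\<lambda>z. c (v z)"])
  qed
  then have "N \<in> fg_mod R" using rm by (simp add: fg_mod_def)
  moreover have "mod_iso R M N"
    unfolding mod_iso_def
  proof (rule bexI[of _ j])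
    show "bij_betw j (carrier M) (carrier N)" using j by (simp add: bij_betw_def N_def)
    show "j \<in> mod_hom R M N" by (auto simp: mod_hom_def N_def)
  qed
  ultimately show thesis by (rule that)
qed

end

theory Submission
  imports Defs
begin

text \<open>
  The torsion pair is common to both kinds of triples, so the point is that for a torsion class
  \<open>\<T>\<close> the two notions of cotorsion pair \<open>(\<C>, \<T>)\<close> agree. A left weak cotorsion pair has
  left \<open>\<T>\<close>- and right \<open>\<C>\<close>-approximations of all modules, a \<open>\<tau>\<close>-cotorsion pair left
  \<open>\<T>\<close>-approximations of the projective ones.

  In one direction, approximations of all modules are built from a presentation
  \<open>Q \<rightarrow> P \<rightarrow> M \<rightarrow> 0\<close> by finitely generated projectives. Pushing the left approximation of \<open>P\<close>
  out along \<open>P \<rightarrow> M\<close> gives the one of \<open>M\<close> (\<open>left_approx_of_projective_descends\<close>), because \<open>\<T>\<close> is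
  closed under quotients. Pushing \<open>Q \<rightarrow> P\<close> out along the left approximation \<open>Q \<rightarrow> D\<close>, where
  \<open>D\<close> lies in \<open>\<C> \<inter> \<T>\<close>, gives a module \<open>E\<close> that maps onto \<open>M\<close> with torsion kernel; that \<open>E\<close> lies in
  \<open>\<C>\<close> follows from the projectivity of \<open>P\<close>, from \<open>Ext\<^sup>1(D, \<T>) = 0\<close> and from the approximation property
  (\<open>right_approx_from_projectives\<close>). The presentation exists because finitely generated modules over
  an artin algebra are noetherian. This is derived from the descending chain condition on the base
  ring in \<open>artinian_imp_noetherian\<close>.

  In the other direction, a module in the left orthogonal of \<open>\<T>\<close> is a summand of its right
  \<open>\<C>\<close>-approximation, so \<open>\<C>\<close> is the whole left orthogonal (\<open>left_perp_of_weak_cotorsion\<close>).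
  The left approximation \<open>P \<rightarrow> D\<close> of a projective module has \<open>D\<close> in \<open>\<C>\<close>
  (\<open>projective_approx_in_left_perp\<close>), and the right \<open>\<C>\<close>-approximation of the torsion part of a module
  is a right approximation of the module by \<open>\<C> \<inter> \<T>\<close>
  (\<open>weak_cotorsion_torsion_contravariantly_finite\<close>).

  The group \<open>Ext\<^sup>1\<close> vanishes when all extensions split (\<open>Ext1_vanishes_iff\<close>), and by pulling back
  this allows maps to be lifted along extensions (\<open>Ext1_vanishes_lift\<close>). Pullbacks, sums and free modules
  are formed on product and function types and then copied to the given type of elements.
\<close>

section \<open>Homomorphisms\<close>

lemma mod_homI:
  assumes "\<And>x. x \<in> carrier M \<Longrightarrow> f x \<in> carrier N"
    and "\<And>x y. \<lbrakk>x \<in> carrier M; y \<in> carrier M\<rbrakk> \<Longrightarrow> f (x \<oplus>\<^bsub>M\<^esub> y) = f x \<oplus>\<^bsub>N\<^esub> f y"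
    and "\<And>a x. \<lbrakk>a \<in> carrier R; x \<in> carrier M\<rbrakk> \<Longrightarrow> f (a \<odot>\<^bsub>M\<^esub> x) = a \<odot>\<^bsub>N\<^esub> f x"
  shows "f \<in> mod_hom R M N"
  using assms by (auto simp: mod_hom_def)

lemma
  assumes "f \<in> mod_hom R M N"
  shows hom_closed: "x \<in> carrier M \<Longrightarrow> f x \<in> carrier N"
    and hom_add: "\<lbrakk>x \<in> carrier M; y \<in> carrier M\<rbrakk> \<Longrightarrow> f (x \<oplus>\<^bsub>M\<^esub> y) = f x \<oplus>\<^bsub>N\<^esub> f y"
    and hom_act: "\<lbrakk>a \<in> carrier R; x \<in> carrier M\<rbrakk> \<Longrightarrow> f (a \<odot>\<^bsub>M\<^esub> x) = a \<odot>\<^bsub>N\<^esub> f x"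
  using assms by (auto simp: mod_hom_def)

lemma fg_modD: "M \<in> fg_mod R \<Longrightarrow> right_module R M"
  by (simp add: fg_mod_def)

lemma right_module_group: "right_module R M \<Longrightarrow> abelian_group M"
  by (simp add: right_module_def)

context right_module
begin

lemma zero_act: assumes "x \<in> carrier M" shows "\<zero>\<^bsub>R\<^esub> \<odot>\<^bsub>M\<^esub> x = \<zero>\<^bsub>M\<^esub>"
proof -
  have "\<zero>\<^bsub>R\<^esub> \<odot>\<^bsub>M\<^esub> x \<oplus>\<^bsub>M\<^esub> \<zero>\<^bsub>R\<^esub> \<odot>\<^bsub>M\<^esub> x = \<zero>\<^bsub>R\<^esub> \<odot>\<^bsub>M\<^esub> x"
    using act_scalar_distr[of "\<zero>\<^bsub>R\<^esub>" "\<zero>\<^bsub>R\<^esub>" x] assms by simp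
  then show ?thesis using assms by (simp add: act_closed)
qed

lemma act_zero: assumes "a \<in> carrier R" shows "a \<odot>\<^bsub>M\<^esub> \<zero>\<^bsub>M\<^esub> = \<zero>\<^bsub>M\<^esub>"
proof -
  have "a \<odot>\<^bsub>M\<^esub> \<zero>\<^bsub>M\<^esub> \<oplus>\<^bsub>M\<^esub> a \<odot>\<^bsub>M\<^esub> \<zero>\<^bsub>M\<^esub> = a \<odot>\<^bsub>M\<^esub> \<zero>\<^bsub>M\<^esub>"
    using act_vector_distr[of a "\<zero>\<^bsub>M\<^esub>" "\<zero>\<^bsub>M\<^esub>"] assms by simp
  then show ?thesis using assms by (simp add: act_closed)
qed

lemma act_minus:
  assumes "a \<in> carrier R" "x \<in> carrier M"
  shows "a \<odot>\<^bsub>M\<^esub> (\<ominus>\<^bsub>M\<^esub> x) = \<ominus>\<^bsub>M\<^esub> (a \<odot>\<^bsub>M\<^esub> x)"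
proof -
  have "a \<odot>\<^bsub>M\<^esub> (\<ominus>\<^bsub>M\<^esub> x) \<oplus>\<^bsub>M\<^esub> a \<odot>\<^bsub>M\<^esub> x = \<zero>\<^bsub>M\<^esub>"
    using act_vector_distr[of a "\<ominus>\<^bsub>M\<^esub> x" x] assms by (simp add: M.l_neg act_zero)
  then show ?thesis using assms by (simp add: M.minus_equality act_closed)
qed

lemma minus_one_act:
  assumes "x \<in> carrier M"
  shows "(\<ominus>\<^bsub>R\<^esub> \<one>\<^bsub>R\<^esub>) \<odot>\<^bsub>M\<^esub> x = \<ominus>\<^bsub>M\<^esub> x"
proof -
  have "(\<ominus>\<^bsub>R\<^esub> \<one>\<^bsub>R\<^esub>) \<odot>\<^bsub>M\<^esub> x \<oplus>\<^bsub>M\<^esub> x = \<zero>\<^bsub>M\<^esub>"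
    using act_scalar_distr[of "\<ominus>\<^bsub>R\<^esub> \<one>\<^bsub>R\<^esub>" "\<one>\<^bsub>R\<^esub>" x] assms by (simp add: R.l_neg zero_act act_one)
  then show ?thesis using assms by (simp add: M.minus_equality act_closed)
qed

lemma diff_self: "x \<in> carrier M \<Longrightarrow> x \<ominus>\<^bsub>M\<^esub> x = \<zero>\<^bsub>M\<^esub>"
  by (simp add: a_minus_def M.r_neg)

lemma diff_add_cancel:
  "\<lbrakk>x \<in> carrier M; y \<in> carrier M\<rbrakk> \<Longrightarrow> (x \<ominus>\<^bsub>M\<^esub> y) \<oplus>\<^bsub>M\<^esub> y = x"
  by (simp add: a_minus_def M.a_assoc M.l_neg)

lemma add_diff_cancel:
  "\<lbrakk>x \<in> carrier M; y \<in> carrier M\<rbrakk> \<Longrightarrow> y \<oplus>\<^bsub>M\<^esub> (x \<ominus>\<^bsub>M\<^esub> y) = x"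
  using diff_add_cancel by (simp add: M.a_comm)

lemma diff_zero_eq:
  "\<lbrakk>x \<in> carrier M; y \<in> carrier M; x \<ominus>\<^bsub>M\<^esub> y = \<zero>\<^bsub>M\<^esub>\<rbrakk> \<Longrightarrow> x = y"
  using diff_add_cancel[of x y] by simp

end

lemma hom_zero:
  assumes f: "f \<in> mod_hom R M N" and M: "right_module R M" and N: "right_module R N"
  shows "f \<zero>\<^bsub>M\<^esub> = \<zero>\<^bsub>N\<^esub>"
proof -
  interpret M: abelian_group M by (rule right_module_group[OF M])
  interpret N: abelian_group N by (rule right_module_group[OF N])
  have "f \<zero>\<^bsub>M\<^esub> \<oplus>\<^bsub>N\<^esub> f \<zero>\<^bsub>M\<^esub> = f \<zero>\<^bsub>M\<^esub>" using hom_add[OF f, of "\<zero>\<^bsub>M\<^esub>" "\<zero>\<^bsub>M\<^esub>"] by simp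
  then show ?thesis using hom_closed[OF f, of "\<zero>\<^bsub>M\<^esub>"] by simp
qed

lemma hom_minus:
  assumes f: "f \<in> mod_hom R M N" and M: "right_module R M" and N: "right_module R N"
    and x: "x \<in> carrier M"
  shows "f (\<ominus>\<^bsub>M\<^esub> x) = \<ominus>\<^bsub>N\<^esub> f x"
proof -
  interpret M: abelian_group M by (rule right_module_group[OF M])
  interpret N: abelian_group N by (rule right_module_group[OF N])
  have "f (\<ominus>\<^bsub>M\<^esub> x) \<oplus>\<^bsub>N\<^esub> f x = \<zero>\<^bsub>N\<^esub>"
    using hom_add[OF f, of "\<ominus>\<^bsub>M\<^esub> x" x] x hom_zero[OF f M N] by (simp add: M.l_neg)
  then show ?thesis using hom_closed[OF f] x by (simp add: N.minus_equality)
qed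

lemma hom_diff:
  assumes f: "f \<in> mod_hom R M N" and M: "right_module R M" and N: "right_module R N"
    and x: "x \<in> carrier M" and y: "y \<in> carrier M"
  shows "f (x \<ominus>\<^bsub>M\<^esub> y) = f x \<ominus>\<^bsub>N\<^esub> f y"
proof -
  interpret M: abelian_group M by (rule right_module_group[OF M])
  show ?thesis
    using hom_add[OF f, of x "\<ominus>\<^bsub>M\<^esub> y"] hom_minus[OF f M N y] x y by (simp add: a_minus_def)
qed

lemma hom_comp:
  assumes "f \<in> mod_hom R L M" and "g \<in> mod_hom R M N"
  shows "(\<lambda>x. g (f x)) \<in> mod_hom R L N"
  using assms by (auto simp: mod_hom_def Pi_iff)

lemma hom_id: "(\<lambda>x. x) \<in> mod_hom R M M"
  by (simp add: mod_hom_def)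

lemma hom_sum:
  assumes f: "f \<in> mod_hom R M N" and g: "g \<in> mod_hom R M N" and N: "right_module R N"
  shows "(\<lambda>x. f x \<oplus>\<^bsub>N\<^esub> g x) \<in> mod_hom R M N"
proof -
  interpret N: abelian_group N by (rule right_module_group[OF N])
  show ?thesis
  proof (rule mod_homI)
    fix x y assume xy: "x \<in> carrier M" "y \<in> carrier M"
    show "f (x \<oplus>\<^bsub>M\<^esub> y) \<oplus>\<^bsub>N\<^esub> g (x \<oplus>\<^bsub>M\<^esub> y) = f x \<oplus>\<^bsub>N\<^esub> g x \<oplus>\<^bsub>N\<^esub> (f y \<oplus>\<^bsub>N\<^esub> g y)"
      using xy hom_closed[OF f] hom_closed[OF g] by (simp add: hom_add[OF f] hom_add[OF g] N.a_ac)
  next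
    fix a x assume "a \<in> carrier R" "x \<in> carrier M"
    then show "f (a \<odot>\<^bsub>M\<^esub> x) \<oplus>\<^bsub>N\<^esub> g (a \<odot>\<^bsub>M\<^esub> x) = a \<odot>\<^bsub>N\<^esub> (f x \<oplus>\<^bsub>N\<^esub> g x)"
      using hom_closed[OF f] hom_closed[OF g]
      by (simp add: hom_act[OF f] hom_act[OF g] right_module.act_vector_distr[OF N])
  qed (simp add: hom_closed[OF f] hom_closed[OF g])
qed

lemma hom_neg:
  assumes f: "f \<in> mod_hom R M N" and N: "right_module R N"
  shows "(\<lambda>x. \<ominus>\<^bsub>N\<^esub> f x) \<in> mod_hom R M N"
proof -
  interpret N: abelian_group N by (rule right_module_group[OF N])
  show ?thesis
  proof (rule mod_homI)
    fix x y assume xy: "x \<in> carrier M" "y \<in> carrier M"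
    show "\<ominus>\<^bsub>N\<^esub> f (x \<oplus>\<^bsub>M\<^esub> y) = \<ominus>\<^bsub>N\<^esub> f x \<oplus>\<^bsub>N\<^esub> \<ominus>\<^bsub>N\<^esub> f y"
      using xy hom_closed[OF f] by (simp add: hom_add[OF f] N.minus_add)
  qed (simp_all add: hom_closed[OF f] hom_act[OF f] right_module.act_minus[OF N])
qed

lemma hom_difference:
  assumes f: "f \<in> mod_hom R M N" and g: "g \<in> mod_hom R M N" and N: "right_module R N"
  shows "(\<lambda>x. f x \<ominus>\<^bsub>N\<^esub> g x) \<in> mod_hom R M N"
  using hom_sum[OF f hom_neg[OF g N] N] by (simp add: a_minus_def)

lemma hom_eq_zeroI:
  assumes "f \<in> mod_hom R M N" and "right_module R M" and "right_module R N"
    and "x \<in> carrier M" "y \<in> carrier M" "f x = f y"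
  shows "f (x \<ominus>\<^bsub>M\<^esub> y) = \<zero>\<^bsub>N\<^esub>"
  using hom_diff[OF assms(1-5)] assms(6) right_module.diff_self[OF assms(3)]
    hom_closed[OF assms(1)] assms(5) by simp

lemma factor_through_epi:
  assumes e: "e \<in> mod_hom R M E" and surj: "e ` carrier M = carrier E"
    and g: "g \<in> mod_hom R M N"
    and M: "right_module R M" and E: "right_module R E" and N: "right_module R N"
    and ker: "\<And>x. \<lbrakk>x \<in> carrier M; e x = \<zero>\<^bsub>E\<^esub>\<rbrakk> \<Longrightarrow> g x = \<zero>\<^bsub>N\<^esub>"
  obtains h where "h \<in> mod_hom R E N" "\<And>x. x \<in> carrier M \<Longrightarrow> h (e x) = g x"
proof -
  interpret M: abelian_group M by (rule right_module_group[OF M])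
  interpret E: abelian_group E by (rule right_module_group[OF E])
  define r where "r = inv_into (carrier M) e"
  have r: "r y \<in> carrier M" "e (r y) = y" if "y \<in> carrier E" for y
    using that surj by (auto simp: r_def inv_into_into f_inv_into_f)
  have eq: "g x = g y" if "x \<in> carrier M" "y \<in> carrier M" "e x = e y" for x y
  proof -
    have "g (x \<ominus>\<^bsub>M\<^esub> y) = \<zero>\<^bsub>N\<^esub>"
      using that hom_eq_zeroI[OF e M E] by (intro ker) auto
    then show ?thesis
      using hom_diff[OF g M N] that right_module.diff_zero_eq[OF N] hom_closed[OF g] by metis
  qed
  show thesis
  proof (rule that[of "\<lambda>y. g (r y)"])
    show "(\<lambda>y. g (r y)) \<in> mod_hom R E N"
    proof (rule mod_homI)
      fix x y assume xy: "x \<in> carrier E" "y \<in> carrier E"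
      have "g (r (x \<oplus>\<^bsub>E\<^esub> y)) = g (r x \<oplus>\<^bsub>M\<^esub> r y)"
        using xy r by (intro eq) (auto simp: hom_add[OF e])
      then show "g (r (x \<oplus>\<^bsub>E\<^esub> y)) = g (r x) \<oplus>\<^bsub>N\<^esub> g (r y)"
        using xy r by (simp add: hom_add[OF g])
    next
      fix a x assume ax: "a \<in> carrier R" "x \<in> carrier E"
      have "g (r (a \<odot>\<^bsub>E\<^esub> x)) = g (a \<odot>\<^bsub>M\<^esub> r x)"
        using ax r right_module.act_closed[OF E] right_module.act_closed[OF M]
        by (intro eq) (auto simp: hom_act[OF e])
      then show "g (r (a \<odot>\<^bsub>E\<^esub> x)) = a \<odot>\<^bsub>N\<^esub> g (r x)"
        using ax r by (simp add: hom_act[OF g])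
    qed (simp add: r hom_closed[OF g])
  next
    fix x assume x: "x \<in> carrier M"
    show "g (r (e x)) = g x"
      using x r[OF hom_closed[OF e x]] by (intro eq) auto
  qed
qed

lemma factor_through_mono:
  assumes i: "i \<in> mod_hom R D E" and inj: "inj_on i (carrier D)"
    and u: "u \<in> mod_hom R M E" and D: "right_module R D" and M: "right_module R M"
    and im: "\<And>x. x \<in> carrier M \<Longrightarrow> u x \<in> i ` carrier D"
  obtains v where "v \<in> mod_hom R M D" "\<And>x. x \<in> carrier M \<Longrightarrow> i (v x) = u x"
proof -
  interpret M: abelian_group M by (rule right_module_group[OF M])
  interpret D: abelian_group D by (rule right_module_group[OF D])
  define v where "v x = inv_into (carrier D) i (u x)" for x
  have v: "v x \<in> carrier D" "i (v x) = u x" if "x \<in> carrier M" for x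
    using im[OF that] by (auto simp: v_def inv_into_into f_inv_into_f)
  show thesis
  proof (rule that[of v])
    show "v \<in> mod_hom R M D"
    proof (rule mod_homI)
      fix x y assume "x \<in> carrier M" "y \<in> carrier M"
      then show "v (x \<oplus>\<^bsub>M\<^esub> y) = v x \<oplus>\<^bsub>D\<^esub> v y"
        by (intro inj_onD[OF inj]) (simp_all add: v hom_add[OF i] hom_add[OF u])
    next
      fix a x assume "a \<in> carrier R" "x \<in> carrier M"
      then show "v (a \<odot>\<^bsub>M\<^esub> x) = a \<odot>\<^bsub>D\<^esub> v x"
        by (intro inj_onD[OF inj]) (simp_all add: v hom_act[OF i] hom_act[OF u]
            right_module.act_closed[OF M] right_module.act_closed[OF D])
    qed (simp add: v)
  qed (simp add: v)
qed

section \<open>Submodules and spans\<close>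

definition right_submodule ::
  "('a, 'r) ring_scheme \<Rightarrow> ('a, 'm, 'z) module_scheme \<Rightarrow> 'm set \<Rightarrow> bool" where
  "right_submodule R M S \<longleftrightarrow> S \<subseteq> carrier M \<and> \<zero>\<^bsub>M\<^esub> \<in> S \<and>
    (\<forall>x\<in>S. \<forall>y\<in>S. x \<oplus>\<^bsub>M\<^esub> y \<in> S) \<and> (\<forall>a\<in>carrier R. \<forall>x\<in>S. a \<odot>\<^bsub>M\<^esub> x \<in> S)"

definition lin_span :: "('a, 'r) ring_scheme \<Rightarrow> ('a, 'm, 'z) module_scheme \<Rightarrow> 'm set \<Rightarrow> 'm set" where
  "lin_span R M X = \<Inter>{S. right_submodule R M S \<and> X \<subseteq> S}"

definition fg_submodule :: "('a, 'r) ring_scheme \<Rightarrow> ('a, 'm, 'z) module_scheme \<Rightarrow> 'm set \<Rightarrow> bool" where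
  "fg_submodule R M S \<longleftrightarrow> (\<exists>X. finite X \<and> X \<subseteq> S \<and> S \<subseteq> lin_span R M X)"

lemma right_submoduleI:
  assumes "S \<subseteq> carrier M" "\<zero>\<^bsub>M\<^esub> \<in> S" "\<And>x y. \<lbrakk>x \<in> S; y \<in> S\<rbrakk> \<Longrightarrow> x \<oplus>\<^bsub>M\<^esub> y \<in> S"
    "\<And>a x. \<lbrakk>a \<in> carrier R; x \<in> S\<rbrakk> \<Longrightarrow> a \<odot>\<^bsub>M\<^esub> x \<in> S"
  shows "right_submodule R M S"
  using assms by (auto simp: right_submodule_def)

lemma
  assumes "right_submodule R M S"
  shows sub_carrier: "x \<in> S \<Longrightarrow> x \<in> carrier M"
    and sub_zero: "\<zero>\<^bsub>M\<^esub> \<in> S"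
    and sub_add: "\<lbrakk>x \<in> S; y \<in> S\<rbrakk> \<Longrightarrow> x \<oplus>\<^bsub>M\<^esub> y \<in> S"
    and sub_act: "\<lbrakk>a \<in> carrier R; x \<in> S\<rbrakk> \<Longrightarrow> a \<odot>\<^bsub>M\<^esub> x \<in> S"
  using assms by (auto simp: right_submodule_def)

lemma lin_span_least: "\<lbrakk>right_submodule R M S; X \<subseteq> S\<rbrakk> \<Longrightarrow> lin_span R M X \<subseteq> S"
  by (auto simp: lin_span_def)

lemma lin_span_superset: "X \<subseteq> lin_span R M X"
  by (auto simp: lin_span_def)

lemma lin_span_mono: "X \<subseteq> Y \<Longrightarrow> lin_span R M X \<subseteq> lin_span R M Y"
  by (auto simp: lin_span_def)

context right_module
begin

lemma carrier_submodule: "right_submodule R M (carrier M)"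
  by (rule right_submoduleI) (auto intro: act_closed)

lemma lin_span_submodule:
  assumes "X \<subseteq> carrier M"
  shows "right_submodule R M (lin_span R M X)"
  using carrier_submodule assms
  by (intro right_submoduleI) (auto simp: lin_span_def intro: sub_zero sub_add sub_act)

lemma sub_minus: "\<lbrakk>right_submodule R M S; x \<in> S\<rbrakk> \<Longrightarrow> \<ominus>\<^bsub>M\<^esub> x \<in> S"
  by (metis R.add.inv_closed R.one_closed minus_one_act sub_act sub_carrier)

lemma sub_diff: "\<lbrakk>right_submodule R M S; x \<in> S; y \<in> S\<rbrakk> \<Longrightarrow> x \<ominus>\<^bsub>M\<^esub> y \<in> S"
  by (simp add: a_minus_def sub_minus sub_add)

lemma sub_finsum:
  assumes S: "right_submodule R M S" and "finite X" and "\<And>x. x \<in> X \<Longrightarrow> g x \<in> S"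
  shows "finsum M g X \<in> S"
  using assms(2,3)
proof (induction X rule: finite_induct)
  case empty
  then show ?case by (simp add: sub_zero[OF S])
next
  case (insert x X)
  then have "g \<in> insert x X \<rightarrow> carrier M" using sub_carrier[OF S] by auto
  then show ?case using insert by (subst M.finsum_insert) (auto intro: sub_add[OF S])
qed

lemma act_finsum:
  assumes "finite X" "g \<in> X \<rightarrow> carrier M" "a \<in> carrier R"
  shows "a \<odot>\<^bsub>M\<^esub> finsum M g X = (\<Oplus>\<^bsub>M\<^esub>x\<in>X. a \<odot>\<^bsub>M\<^esub> g x)"
  using assms(1,2)
proof (induction X rule: finite_induct)
  case (insert x X)
  then show ?case using assms(3)
    by (subst (1 2) M.finsum_insert) (auto simp: act_vector_distr Pi_iff intro!: act_closed)
qed (simp add: act_zero assms(3))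

lemma sub_inter:
  "\<lbrakk>right_submodule R M S; right_submodule R M S'\<rbrakk> \<Longrightarrow> right_submodule R M (S \<inter> S')"
  by (auto simp: right_submodule_def)

lemma sub_module:
  assumes S: "right_submodule R M S"
  shows "right_module R (M\<lparr>carrier := S\<rparr>)"
proof -
  have "abelian_group (M\<lparr>carrier := S\<rparr>)"
  proof (rule abelian_groupI)
    fix x assume "x \<in> carrier (M\<lparr>carrier := S\<rparr>)"
    then show "\<exists>y\<in>carrier (M\<lparr>carrier := S\<rparr>). y \<oplus>\<^bsub>M\<lparr>carrier := S\<rparr>\<^esub> x = \<zero>\<^bsub>M\<lparr>carrier := S\<rparr>\<^esub>"
      using sub_minus[OF S] sub_carrier[OF S] by (auto intro!: bexI[of _ "\<ominus>\<^bsub>M\<^esub> x"] simp: M.l_neg)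
  qed (use sub_add[OF S] sub_zero[OF S] sub_carrier[OF S] in \<open>auto simp: M.a_ac\<close>)
  then show ?thesis
    by (intro right_module.intro right_module_axioms.intro R.ring_axioms)
      (use sub_carrier[OF S] sub_act[OF S] in
        \<open>auto simp: act_scalar_distr act_vector_distr act_assoc act_one\<close>)
qed

end

lemma sub_image:
  assumes f: "f \<in> mod_hom R M N" and M: "right_module R M" and N: "right_module R N"
    and S: "right_submodule R M S"
  shows "right_submodule R N (f ` S)"
proof (rule right_submoduleI)
  show "f ` S \<subseteq> carrier N" using sub_carrier[OF S] hom_closed[OF f] by auto
  show "\<zero>\<^bsub>N\<^esub> \<in> f ` S" using hom_zero[OF f M N] sub_zero[OF S] by (metis imageI)
  fix x y assume "x \<in> f ` S" "y \<in> f ` S"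
  then show "x \<oplus>\<^bsub>N\<^esub> y \<in> f ` S"
    using hom_add[OF f] sub_add[OF S] sub_carrier[OF S] by (smt (verit, best) imageE imageI)
next
  fix a x assume "a \<in> carrier R" "x \<in> f ` S"
  then show "a \<odot>\<^bsub>N\<^esub> x \<in> f ` S"
    using hom_act[OF f] sub_act[OF S] sub_carrier[OF S] by (smt (verit, best) imageE imageI)
qed

lemma sub_vimage:
  assumes f: "f \<in> mod_hom R M N" and M: "right_module R M" and N: "right_module R N"
    and S: "right_submodule R N S" and S': "right_submodule R M S'"
  shows "right_submodule R M {x \<in> S'. f x \<in> S}"
  using sub_carrier[OF S'] sub_zero[OF S'] sub_add[OF S'] sub_act[OF S'] hom_zero[OF f M N]
    sub_zero[OF S] sub_add[OF S] sub_act[OF S]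
  by (intro right_submoduleI) (auto simp: hom_add[OF f] hom_act[OF f])

lemma sub_kernel:
  assumes f: "f \<in> mod_hom R M N" and M: "right_module R M" and N: "right_module R N"
  shows "right_submodule R M {x \<in> carrier M. f x = \<zero>\<^bsub>N\<^esub>}"
proof -
  interpret N: abelian_group N by (rule right_module_group[OF N])
  have "right_submodule R N {\<zero>\<^bsub>N\<^esub>}"
    using right_module.act_zero[OF N] by (intro right_submoduleI) auto
  from sub_vimage[OF f M N this right_module.carrier_submodule[OF M]] show ?thesis by simp
qed

section \<open>Free modules\<close>

text \<open>The scalars multiply the coordinates from the right, so that forming linear combinations
  \<open>\<Sum> y\<^sub>x \<cdot> c\<^sub>x\<close> in a right module is linear in the coordinates \<open>c\<close>.\<close>

definition free_module :: "('a, 'r) ring_scheme \<Rightarrow> 'x set \<Rightarrow> ('a, 'x \<Rightarrow> 'a) module" where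
  "free_module R X = \<lparr>carrier = X \<rightarrow>\<^sub>E carrier R, mult = (\<lambda>c d. c), one = (\<lambda>x\<in>X. \<zero>\<^bsub>R\<^esub>),
    zero = (\<lambda>x\<in>X. \<zero>\<^bsub>R\<^esub>), add = (\<lambda>c d. \<lambda>x\<in>X. c x \<oplus>\<^bsub>R\<^esub> d x),
    smult = (\<lambda>a c. \<lambda>x\<in>X. c x \<otimes>\<^bsub>R\<^esub> a)\<rparr>"

definition unit_vector :: "('a, 'r) ring_scheme \<Rightarrow> 'x set \<Rightarrow> 'x \<Rightarrow> 'x \<Rightarrow> 'a" where
  "unit_vector R X x = (\<lambda>z\<in>X. if x = z then \<one>\<^bsub>R\<^esub> else \<zero>\<^bsub>R\<^esub>)"

definition lin_comb :: "('a, 'm) module \<Rightarrow> 'x set \<Rightarrow> ('x \<Rightarrow> 'm) \<Rightarrow> ('x \<Rightarrow> 'a) \<Rightarrow> 'm" where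
  "lin_comb M X y c = (\<Oplus>\<^bsub>M\<^esub>x\<in>X. c x \<odot>\<^bsub>M\<^esub> y x)"

lemma free_module_simps [simp]:
  "carrier (free_module R X) = X \<rightarrow>\<^sub>E carrier R"
  "zero (free_module R X) = (\<lambda>x\<in>X. \<zero>\<^bsub>R\<^esub>)"
  "add (free_module R X) c d = (\<lambda>x\<in>X. c x \<oplus>\<^bsub>R\<^esub> d x)"
  "smult (free_module R X) a c = (\<lambda>x\<in>X. c x \<otimes>\<^bsub>R\<^esub> a)"
  by (simp_all add: free_module_def)

lemma right_module_free:
  assumes "ring R"
  shows "right_module R (free_module R X)"
proof -
  interpret ring R by (rule assms)
  have "abelian_group (free_module R X)"
  proof (rule abelian_groupI)
    fix c assume c: "c \<in> carrier (free_module R X)"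
    then show "\<exists>d\<in>carrier (free_module R X). d \<oplus>\<^bsub>free_module R X\<^esub> c = \<zero>\<^bsub>free_module R X\<^esub>"
      by (intro bexI[of _ "\<lambda>x\<in>X. \<ominus>\<^bsub>R\<^esub> c x"]) (auto simp: fun_eq_iff PiE_iff l_neg)
  qed (auto simp: fun_eq_iff PiE_iff extensional_def a_ac)
  then show ?thesis
    by (intro right_module.intro right_module_axioms.intro assms)
      (auto simp: fun_eq_iff PiE_iff extensional_def r_distr l_distr m_assoc)
qed

lemma unit_vector_closed:
  assumes "ring R"
  shows "unit_vector R X x \<in> carrier (free_module R X)"
proof -
  interpret ring R by (rule assms)
  show ?thesis by (auto simp: unit_vector_def)
qed

lemma lin_comb_hom:
  assumes M: "right_module R M" and X: "finite X" and y: "y \<in> X \<rightarrow> carrier M"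
  shows "lin_comb M X y \<in> mod_hom R (free_module R X) M"
proof -
  interpret right_module R M by (rule M)
  have cl: "c x \<odot>\<^bsub>M\<^esub> y x \<in> carrier M" if "x \<in> X" "c \<in> X \<rightarrow>\<^sub>E carrier R" for c x
    using that y by (auto intro!: act_closed)
  show ?thesis
  proof (rule mod_homI)
    fix c assume "c \<in> carrier (free_module R X)"
    then show "lin_comb M X y c \<in> carrier M"
      using cl by (auto simp: lin_comb_def intro!: M.finsum_closed)
  next
    fix c d assume "c \<in> carrier (free_module R X)" "d \<in> carrier (free_module R X)"
    then have cd: "c \<in> X \<rightarrow>\<^sub>E carrier R" "d \<in> X \<rightarrow>\<^sub>E carrier R" by auto
    then have mem: "c x \<in> carrier R" "d x \<in> carrier R" if "x \<in> X" for x
      using that by auto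
    have "lin_comb M X y (c \<oplus>\<^bsub>free_module R X\<^esub> d) = (\<Oplus>\<^bsub>M\<^esub>x\<in>X. c x \<odot>\<^bsub>M\<^esub> y x \<oplus>\<^bsub>M\<^esub> d x \<odot>\<^bsub>M\<^esub> y x)"
      unfolding lin_comb_def using cd cl y
      by (intro M.finsum_cong') (auto simp: mem Pi_iff act_scalar_distr)
    also have "\<dots> = lin_comb M X y c \<oplus>\<^bsub>M\<^esub> lin_comb M X y d"
      unfolding lin_comb_def using cd cl by (intro M.finsum_addf) auto
    finally show "lin_comb M X y (c \<oplus>\<^bsub>free_module R X\<^esub> d) = \<dots>" .
  next
    fix a c assume a: "a \<in> carrier R" and "c \<in> carrier (free_module R X)"
    then have c: "c \<in> X \<rightarrow>\<^sub>E carrier R" by auto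
    then have mem: "c x \<in> carrier R" if "x \<in> X" for x
      using that by auto
    have "lin_comb M X y (a \<odot>\<^bsub>free_module R X\<^esub> c) = (\<Oplus>\<^bsub>M\<^esub>x\<in>X. a \<odot>\<^bsub>M\<^esub> (c x \<odot>\<^bsub>M\<^esub> y x))"
      unfolding lin_comb_def using c a y
      by (intro M.finsum_cong') (auto simp: mem Pi_iff act_assoc intro!: act_closed)
    also have "\<dots> = a \<odot>\<^bsub>M\<^esub> lin_comb M X y c"
      unfolding lin_comb_def using cl c a X by (intro act_finsum[symmetric]) auto
    finally show "lin_comb M X y (a \<odot>\<^bsub>free_module R X\<^esub> c) = \<dots>" .
  qed
qed

lemma lin_comb_unit_vector:
  assumes M: "right_module R M" and X: "finite X" and y: "y \<in> X \<rightarrow> carrier M" and z: "z \<in> X"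
  shows "lin_comb M X y (unit_vector R X z) = y z"
proof -
  interpret right_module R M by (rule M)
  have "lin_comb M X y (unit_vector R X z) = (\<Oplus>\<^bsub>M\<^esub>x\<in>X. if z = x then y x else \<zero>\<^bsub>M\<^esub>)"
    unfolding lin_comb_def using y
    by (intro M.finsum_cong') (auto simp: unit_vector_def act_one zero_act Pi_iff)
  also have "\<dots> = y z" using z X y by (intro M.finsum_singleton) auto
  finally show ?thesis .
qed

text \<open>A vector supported on a finite set is reached by clearing one coordinate after the other;
  in this way no finite sums in the free module have to be evaluated coordinatewise.\<close>

lemma free_module_span:
  assumes "ring R" and X: "finite X"
    and S: "right_submodule R (free_module R X) S" and e: "\<And>x. x \<in> X \<Longrightarrow> unit_vector R X x \<in> S"
  shows "carrier (free_module R X) \<subseteq> S"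
proof -
  interpret ring R by (rule assms)
  have "c \<in> S" if "finite Y" "Y \<subseteq> X" "c \<in> X \<rightarrow>\<^sub>E carrier R" "\<And>x. x \<in> X - Y \<Longrightarrow> c x = \<zero>\<^bsub>R\<^esub>" for Y c
    using that
  proof (induction Y arbitrary: c rule: finite_induct)
    case empty
    then have "c = (\<lambda>x\<in>X. \<zero>\<^bsub>R\<^esub>)" by (auto simp: fun_eq_iff PiE_iff extensional_def)
    moreover have "(\<lambda>x\<in>X. \<zero>\<^bsub>R\<^esub>) \<in> S" using sub_zero[OF S] by simp
    ultimately show ?case by metis
  next
    case (insert y Y)
    define d where "d = c(y := \<zero>\<^bsub>R\<^esub>)"
    have y: "y \<in> X" "c y \<in> carrier R" using insert.prems by auto
    have "d \<in> X \<rightarrow>\<^sub>E carrier R" using insert.prems(2) y by (auto simp: d_def PiE_iff extensional_def)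
    moreover have "d x = \<zero>\<^bsub>R\<^esub>" if "x \<in> X - Y" for x using that insert.prems(3) by (auto simp: d_def)
    ultimately have "d \<in> S" using insert.IH insert.prems(1) by auto
    moreover have "c y \<odot>\<^bsub>free_module R X\<^esub> unit_vector R X y \<in> S"
      using sub_act[OF S y(2) e[OF y(1)]] .
    moreover have "c = d \<oplus>\<^bsub>free_module R X\<^esub> (c y \<odot>\<^bsub>free_module R X\<^esub> unit_vector R X y)"
      using insert.prems(2) y
      by (auto simp: fun_eq_iff d_def unit_vector_def PiE_iff extensional_def)
    ultimately show ?case using sub_add[OF S] by metis
  qed
  from this[OF X subset_refl] show ?thesis by auto
qed

section \<open>Finite generation\<close>

text \<open>Spans are easier to handle than linear combinations: a span is determined by the
  submodules that contain the generators, and these can be moved along homomorphisms.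
  The linear combinations of \<open>X\<close> are the image of a free module, hence a submodule.\<close>

lemma finitely_generated_iff:
  assumes "right_module R M"
  shows "finitely_generated R M \<longleftrightarrow> fg_submodule R M (carrier M)"
proof -
  interpret right_module R M by (rule assms)
  show ?thesis
  proof
    assume "finitely_generated R M"
    then obtain X where X: "finite X" "X \<subseteq> carrier M"
      and gen: "\<forall>y\<in>carrier M. \<exists>c\<in>X \<rightarrow> carrier R. y = (\<Oplus>\<^bsub>M\<^esub>x\<in>X. c x \<odot>\<^bsub>M\<^esub> x)"
      by (auto simp: finitely_generated_def)
    have "y \<in> lin_span R M X" if y: "y \<in> carrier M" for y
    proof -
      obtain c where c: "c \<in> X \<rightarrow> carrier R" "y = (\<Oplus>\<^bsub>M\<^esub>x\<in>X. c x \<odot>\<^bsub>M\<^esub> x)" using gen y by blast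
      have "(\<Oplus>\<^bsub>M\<^esub>x\<in>X. c x \<odot>\<^bsub>M\<^esub> x) \<in> lin_span R M X"
      proof (rule sub_finsum[OF lin_span_submodule[OF X(2)] X(1)])
        fix x assume "x \<in> X"
        then show "c x \<odot>\<^bsub>M\<^esub> x \<in> lin_span R M X"
          using sub_act[OF lin_span_submodule[OF X(2)], of "c x" x] c(1) lin_span_superset[of X R M]
          by auto
      qed
      then show ?thesis using c(2) by simp
    qed
    then show "fg_submodule R M (carrier M)" using X by (auto simp: fg_submodule_def)
  next
    assume "fg_submodule R M (carrier M)"
    then obtain X where X: "finite X" "X \<subseteq> carrier M" "carrier M \<subseteq> lin_span R M X"
      by (auto simp: fg_submodule_def)
    let ?comb = "lin_comb M X (\<lambda>x. x)"
    have F: "right_module R (free_module R X)" by (rule right_module_free[OF R.ring_axioms])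
    have "?comb \<in> mod_hom R (free_module R X) M" using X by (intro lin_comb_hom[OF assms]) auto
    from sub_image[OF this F assms right_module.carrier_submodule[OF F]]
    have sub: "right_submodule R M (?comb ` carrier (free_module R X))" .
    have "X \<subseteq> ?comb ` carrier (free_module R X)"
    proof
      fix x assume x: "x \<in> X"
      have "?comb (unit_vector R X x) = x"
        using X(2) by (intro lin_comb_unit_vector[OF assms X(1) _ x]) auto
      moreover have "?comb (unit_vector R X x) \<in> ?comb ` carrier (free_module R X)"
        by (rule imageI[OF unit_vector_closed[OF R.ring_axioms]])
      ultimately show "x \<in> ?comb ` carrier (free_module R X)" by argo
    qed
    then have gen: "carrier M \<subseteq> ?comb ` carrier (free_module R X)"
      using X(3) lin_span_least[OF sub] by blast
    show "finitely_generated R M"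
      unfolding finitely_generated_def
    proof (intro exI[of _ X] conjI ballI)
      fix y assume "y \<in> carrier M"
      then obtain c where "c \<in> carrier (free_module R X)" "y = ?comb c" using gen by blast
      then show "\<exists>c\<in>X \<rightarrow> carrier R. y = (\<Oplus>\<^bsub>M\<^esub>x\<in>X. c x \<odot>\<^bsub>M\<^esub> x)"
        by (intro bexI[of _ c]) (auto simp: lin_comb_def)
    qed (use X in auto)
  qed
qed

lemma fg_image:
  assumes f: "f \<in> mod_hom R M N" and M: "right_module R M" and N: "right_module R N"
    and SM: "S \<subseteq> carrier M" and S: "fg_submodule R M S"
  shows "fg_submodule R N (f ` S)"
proof -
  obtain X where X: "finite X" "X \<subseteq> S" "S \<subseteq> lin_span R M X" using S by (auto simp: fg_submodule_def)
  have "f ` S \<subseteq> lin_span R N (f ` X)"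
  proof (unfold lin_span_def, intro Inter_greatest, clarify)
    fix T x assume T: "right_submodule R N T" "f ` X \<subseteq> T" and x: "x \<in> S"
    have "lin_span R M X \<subseteq> {x \<in> carrier M. f x \<in> T}"
      using T X(2) SM by (intro lin_span_least sub_vimage[OF f M N] right_module.carrier_submodule[OF M]) auto
    then show "f x \<in> T" using X(3) x by auto
  qed
  then show ?thesis using X unfolding fg_submodule_def by (intro exI[of _ "f ` X"]) auto
qed

lemma fg_extension:
  assumes f: "f \<in> mod_hom R M N" and M: "right_module R M" and N: "right_module R N"
    and S: "right_submodule R M S"
    and im: "fg_submodule R N (f ` S)" and ker: "fg_submodule R M {x \<in> S. f x = \<zero>\<^bsub>N\<^esub>}"
  shows "fg_submodule R M S"
proof -
  obtain X where X: "finite X" "X \<subseteq> {x \<in> S. f x = \<zero>\<^bsub>N\<^esub>}" "{x \<in> S. f x = \<zero>\<^bsub>N\<^esub>} \<subseteq> lin_span R M X"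
    using ker by (auto simp: fg_submodule_def)
  obtain Y where Y: "finite Y" "Y \<subseteq> f ` S" "f ` S \<subseteq> lin_span R N Y"
    using im by (auto simp: fg_submodule_def)
  obtain Y' where Y': "finite Y'" "Y' \<subseteq> S" "Y = f ` Y'"
    using finite_subset_image[OF Y(1,2)] by auto
  have "S \<subseteq> lin_span R M (X \<union> Y')"
  proof
    fix s assume s: "s \<in> S"
    let ?L = "lin_span R M (X \<union> Y')"
    have XY: "X \<union> Y' \<subseteq> carrier M" "X \<union> Y' \<subseteq> S" using X(2) Y'(2) sub_carrier[OF S] by auto
    have L: "right_submodule R M ?L" by (rule right_module.lin_span_submodule[OF M XY(1)])
    have LS: "?L \<subseteq> S" using S XY(2) by (rule lin_span_least)
    have "lin_span R N Y \<subseteq> f ` ?L"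
      using Y'(3) lin_span_superset[of "X \<union> Y'" R M]
      by (intro lin_span_least sub_image[OF f M N L]) auto
    then obtain t where t: "t \<in> ?L" "f s = f t" using Y(3) s by blast
    have tS: "t \<in> S" using t LS by auto
    have "f (s \<ominus>\<^bsub>M\<^esub> t) = \<zero>\<^bsub>N\<^esub>"
      using hom_eq_zeroI[OF f M N] sub_carrier[OF S] s tS t(2) by auto
    then have "s \<ominus>\<^bsub>M\<^esub> t \<in> lin_span R M X"
      using X(3) right_module.sub_diff[OF M S s tS] by auto
    then have "s \<ominus>\<^bsub>M\<^esub> t \<in> ?L" using lin_span_mono[of X "X \<union> Y'" R M] by auto
    then have "(s \<ominus>\<^bsub>M\<^esub> t) \<oplus>\<^bsub>M\<^esub> t \<in> ?L" using t sub_add[OF L] by auto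
    then show "s \<in> ?L"
      using right_module.diff_add_cancel[OF M, of s t] sub_carrier[OF S] s tS by auto
  qed
  then show ?thesis using X(1,2) Y'(1,2) unfolding fg_submodule_def by (intro exI[of _ "X \<union> Y'"]) auto
qed

lemma fg_restrict:
  fixes M :: "('a, 'm) module"
  assumes M: "right_module R M" and S: "right_submodule R M S"
  shows "fg_submodule R (M\<lparr>carrier := S\<rparr>) S \<longleftrightarrow> fg_submodule R M S"
proof
  have N: "right_module R (M\<lparr>carrier := S\<rparr>)" by (rule right_module.sub_module[OF M S])
  have "(\<lambda>x. x) \<in> mod_hom R (M\<lparr>carrier := S\<rparr>) M"
    using sub_carrier[OF S] by (auto intro!: mod_homI)
  from fg_image[OF this N M, of S] show "fg_submodule R M S" if "fg_submodule R (M\<lparr>carrier := S\<rparr>) S"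
    using that by simp
  show "fg_submodule R (M\<lparr>carrier := S\<rparr>) S" if fg: "fg_submodule R M S"
  proof -
    obtain X where X: "finite X" "X \<subseteq> S" "S \<subseteq> lin_span R M X" using fg by (auto simp: fg_submodule_def)
    have "S \<subseteq> lin_span R (M\<lparr>carrier := S\<rparr>) X"
      unfolding lin_span_def
    proof (intro Inter_greatest, clarify)
      fix T x assume T: "right_submodule R (M\<lparr>carrier := S\<rparr>) T" "X \<subseteq> T" and x: "x \<in> S"
      have "right_submodule R M T"
        using T(1) sub_carrier[OF S] by (auto simp: right_submodule_def)
      then show "x \<in> T" using lin_span_least[OF _ T(2)] X(3) x by auto
    qed
    then show ?thesis using X by (auto simp: fg_submodule_def)
  qed
qed

lemma fg_mod_iff: "M \<in> fg_mod R \<longleftrightarrow> right_module R M \<and> fg_submodule R M (carrier M)"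
  using finitely_generated_iff by (auto simp: fg_mod_def)

lemma free_module_fg:
  assumes "ring R" and "finite X"
  shows "free_module R X \<in> fg_mod R"
proof -
  have "carrier (free_module R X) \<subseteq> lin_span R (free_module R X) (unit_vector R X ` X)"
    unfolding lin_span_def using free_module_span[OF assms] by blast
  then have "fg_submodule R (free_module R X) (carrier (free_module R X))"
    unfolding fg_submodule_def using assms unit_vector_closed[OF assms(1), of X]
    by (intro exI[of _ "unit_vector R X ` X"]) auto
  then show ?thesis by (simp add: fg_mod_iff right_module_free[OF assms(1)])
qed

lemma free_module_hom_eq:
  assumes "ring R" and "finite X" and N: "right_module R N"
    and f: "f \<in> mod_hom R (free_module R X) N" and g: "g \<in> mod_hom R (free_module R X) N"
    and eq: "\<And>x. x \<in> X \<Longrightarrow> f (unit_vector R X x) = g (unit_vector R X x)"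
    and c: "c \<in> carrier (free_module R X)"
  shows "f c = g c"
proof -
  note F = right_module_free[OF assms(1), of X]
  note fc = hom_closed[OF f] and gc = hom_closed[OF g]
  have "carrier (free_module R X) \<subseteq> {c \<in> carrier (free_module R X). f c \<ominus>\<^bsub>N\<^esub> g c = \<zero>\<^bsub>N\<^esub>}"
    using eq gc[OF unit_vector_closed[OF assms(1)]] unit_vector_closed[OF assms(1), of X]
    by (intro free_module_span[OF assms(1,2)] sub_kernel[OF hom_difference[OF f g N] F N])
      (auto simp del: free_module_simps simp: right_module.diff_self[OF N])
  then show ?thesis
    using c right_module.diff_zero_eq[OF N fc gc] by blast
qed

section \<open>Artin algebras are right noetherian\<close>

definition noetherian_module :: "('a, 'r) ring_scheme \<Rightarrow> ('a, 'm, 'z) module_scheme \<Rightarrow> bool" where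
  "noetherian_module R M \<longleftrightarrow> (\<forall>S. right_submodule R M S \<longrightarrow> fg_submodule R M S)"

definition regular_module :: "('a, 'r) ring_scheme \<Rightarrow> ('a, 'a) module" where
  "regular_module R = \<lparr>carrier = carrier R, mult = mult R, one = one R, zero = zero R,
    add = add R, smult = (\<lambda>a x. x \<otimes>\<^bsub>R\<^esub> a)\<rparr>"

lemma regular_module_simps [simp]:
  "carrier (regular_module R) = carrier R" "zero (regular_module R) = zero R"
  "add (regular_module R) = add R" "smult (regular_module R) a x = x \<otimes>\<^bsub>R\<^esub> a"
  by (simp_all add: regular_module_def)

lemma right_module_regular: assumes "ring R" shows "right_module R (regular_module R)"
proof -
  interpret ring R by (rule assms)
  have "abelian_group (regular_module R)"
  proof (rule abelian_groupI)
    fix x assume "x \<in> carrier (regular_module R)"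
    then show "\<exists>y\<in>carrier (regular_module R). y \<oplus>\<^bsub>regular_module R\<^esub> x = \<zero>\<^bsub>regular_module R\<^esub>"
      by (auto intro!: bexI[of _ "\<ominus>\<^bsub>R\<^esub> x"] simp: l_neg)
  qed (auto simp: a_ac)
  then show ?thesis
    by (intro right_module.intro right_module_axioms.intro ring_axioms)
      (auto simp: r_distr l_distr m_assoc)
qed

lemma submodule_add_right_mem:
  assumes M: "right_module R M" and S: "right_submodule R M S"
    and x: "x \<in> carrier M" and y: "y \<in> S" and xy: "x \<oplus>\<^bsub>M\<^esub> y \<in> S"
  shows "x \<in> S"
proof -
  interpret right_module R M by (rule M)
  have "(x \<oplus>\<^bsub>M\<^esub> y) \<ominus>\<^bsub>M\<^esub> y = x" using x sub_carrier[OF S y] by (simp add: a_minus_def M.a_assoc M.r_neg)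
  then show ?thesis using sub_diff[OF S xy y] by simp
qed

text \<open>Induction on the number of generators: when a generator \<open>x\<close> is added to \<open>X\<close>, a submodule
  \<open>S\<close> of the new span is controlled by \<open>S \<inter> \<langle>X\<rangle>\<close> and by the right ideal of those \<open>c\<close> that occur
  as the coefficient of \<open>x\<close> in an element of \<open>S\<close>.\<close>

lemma noetherian_if_fg:
  fixes M :: "('a, 'm) module" and R :: "('a, 'r) ring_scheme"
  assumes noeth: "noetherian_module R (regular_module R)" and M: "right_module R M"
    and fg: "fg_submodule R M (carrier M)"
  shows "noetherian_module R M"
proof -
  interpret right_module R M by (rule M)
  have fin: "fg_submodule R M S"
    if "finite X" "X \<subseteq> carrier M" "right_submodule R M S" "S \<subseteq> lin_span R M X" for X S
    using that
  proof (induction X arbitrary: S rule: finite_induct)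
    case empty
    then show ?case unfolding fg_submodule_def by (intro exI[of _ "{}"]) auto
  next
    case (insert x X)
    have x: "x \<in> carrier M" and X: "X \<subseteq> carrier M" using insert.prems by auto
    note S = insert.prems(2)
    define L where "L = lin_span R M X"
    have L: "right_submodule R M L" unfolding L_def by (rule lin_span_submodule[OF X])
    note Lc = sub_carrier[OF L]
    have comb: "c \<odot>\<^bsub>M\<^esub> x \<in> carrier M" if "c \<in> carrier R" for c using that x by (rule act_closed)
    have comb_add: "(c \<odot>\<^bsub>M\<^esub> x \<oplus>\<^bsub>M\<^esub> y) \<oplus>\<^bsub>M\<^esub> (d \<odot>\<^bsub>M\<^esub> x \<oplus>\<^bsub>M\<^esub> z) = (c \<oplus>\<^bsub>R\<^esub> d) \<odot>\<^bsub>M\<^esub> x \<oplus>\<^bsub>M\<^esub> (y \<oplus>\<^bsub>M\<^esub> z)"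
      if "c \<in> carrier R" "d \<in> carrier R" "y \<in> L" "z \<in> L" for c d y z
      using that x Lc comb by (simp add: act_scalar_distr M.a_ac)
    have comb_act: "a \<odot>\<^bsub>M\<^esub> (c \<odot>\<^bsub>M\<^esub> x \<oplus>\<^bsub>M\<^esub> y) = (c \<otimes>\<^bsub>R\<^esub> a) \<odot>\<^bsub>M\<^esub> x \<oplus>\<^bsub>M\<^esub> a \<odot>\<^bsub>M\<^esub> y"
      if "c \<in> carrier R" "a \<in> carrier R" "y \<in> L" for c a y
      using that x Lc comb by (simp add: act_vector_distr act_assoc)
    \<comment> \<open>coefficients of \<open>x\<close> in elements of \<open>T\<close>; used for \<open>S\<close> and for the candidate span below\<close>
    define J where "J T = {c \<in> carrier R. \<exists>y\<in>L. c \<odot>\<^bsub>M\<^esub> x \<oplus>\<^bsub>M\<^esub> y \<in> T}" for T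
    have J: "right_submodule R (regular_module R) (J T)" if T: "right_submodule R M T" for T
    proof (rule right_submoduleI)
      show "J T \<subseteq> carrier (regular_module R)" by (auto simp: J_def)
      show "\<zero>\<^bsub>regular_module R\<^esub> \<in> J T"
        using sub_zero[OF L] sub_zero[OF T] x by (auto simp: J_def zero_act intro!: bexI[of _ "\<zero>\<^bsub>M\<^esub>"])
      fix c d assume "c \<in> J T" "d \<in> J T"
      then obtain y z where *: "c \<in> carrier R" "d \<in> carrier R" "y \<in> L" "z \<in> L"
        "c \<odot>\<^bsub>M\<^esub> x \<oplus>\<^bsub>M\<^esub> y \<in> T" "d \<odot>\<^bsub>M\<^esub> x \<oplus>\<^bsub>M\<^esub> z \<in> T" by (auto simp: J_def)
      have "(c \<oplus>\<^bsub>R\<^esub> d) \<odot>\<^bsub>M\<^esub> x \<oplus>\<^bsub>M\<^esub> (y \<oplus>\<^bsub>M\<^esub> z) \<in> T"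
        using sub_add[OF T *(5,6)] comb_add[OF *(1-4)] by simp
      then show "c \<oplus>\<^bsub>regular_module R\<^esub> d \<in> J T"
        using * sub_add[OF L *(3,4)] by (auto simp: J_def)
    next
      fix a c assume a: "a \<in> carrier R" and "c \<in> J T"
      then obtain y where *: "c \<in> carrier R" "y \<in> L" "c \<odot>\<^bsub>M\<^esub> x \<oplus>\<^bsub>M\<^esub> y \<in> T" by (auto simp: J_def)
      have "(c \<otimes>\<^bsub>R\<^esub> a) \<odot>\<^bsub>M\<^esub> x \<oplus>\<^bsub>M\<^esub> a \<odot>\<^bsub>M\<^esub> y \<in> T"
        using sub_act[OF T a *(3)] comb_act[OF *(1) a *(2)] by simp
      then show "a \<odot>\<^bsub>regular_module R\<^esub> c \<in> J T"
        using * a sub_act[OF L a *(2)] by (auto simp: J_def)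
    qed
    have span: "\<exists>c\<in>carrier R. \<exists>y\<in>L. s = c \<odot>\<^bsub>M\<^esub> x \<oplus>\<^bsub>M\<^esub> y" if s: "s \<in> S" for s
    proof -
      define W where "W = {c \<odot>\<^bsub>M\<^esub> x \<oplus>\<^bsub>M\<^esub> y |c y. c \<in> carrier R \<and> y \<in> L}"
      have "right_submodule R M W"
      proof (rule right_submoduleI)
        show "W \<subseteq> carrier M" using comb Lc by (auto simp: W_def)
        have "\<zero>\<^bsub>M\<^esub> = \<zero>\<^bsub>R\<^esub> \<odot>\<^bsub>M\<^esub> x \<oplus>\<^bsub>M\<^esub> \<zero>\<^bsub>M\<^esub>" using x by (simp add: zero_act)
        then show "\<zero>\<^bsub>M\<^esub> \<in> W" using sub_zero[OF L] unfolding W_def by blast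
        fix u v assume "u \<in> W" "v \<in> W"
        then obtain c y d z where *: "c \<in> carrier R" "d \<in> carrier R" "y \<in> L" "z \<in> L"
          "u = c \<odot>\<^bsub>M\<^esub> x \<oplus>\<^bsub>M\<^esub> y" "v = d \<odot>\<^bsub>M\<^esub> x \<oplus>\<^bsub>M\<^esub> z" by (auto simp: W_def)
        then have "u \<oplus>\<^bsub>M\<^esub> v = (c \<oplus>\<^bsub>R\<^esub> d) \<odot>\<^bsub>M\<^esub> x \<oplus>\<^bsub>M\<^esub> (y \<oplus>\<^bsub>M\<^esub> z)" by (simp add: comb_add)
        then show "u \<oplus>\<^bsub>M\<^esub> v \<in> W" unfolding W_def using * sub_add[OF L *(3,4)] by blast
      next
        fix a u assume a: "a \<in> carrier R" and "u \<in> W"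
        then obtain c y where *: "c \<in> carrier R" "y \<in> L" "u = c \<odot>\<^bsub>M\<^esub> x \<oplus>\<^bsub>M\<^esub> y" by (auto simp: W_def)
        then have "a \<odot>\<^bsub>M\<^esub> u = (c \<otimes>\<^bsub>R\<^esub> a) \<odot>\<^bsub>M\<^esub> x \<oplus>\<^bsub>M\<^esub> a \<odot>\<^bsub>M\<^esub> y" using a by (simp add: comb_act)
        then show "a \<odot>\<^bsub>M\<^esub> u \<in> W" unfolding W_def using * a sub_act[OF L a *(2)] by blast
      qed
      moreover have "insert x X \<subseteq> W"
      proof -
        have "x = \<one>\<^bsub>R\<^esub> \<odot>\<^bsub>M\<^esub> x \<oplus>\<^bsub>M\<^esub> \<zero>\<^bsub>M\<^esub>" using x by (simp add: act_one)
        then have "x \<in> W" unfolding W_def using sub_zero[OF L] R.one_closed by blast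
        moreover have "z \<in> W" if "z \<in> X" for z
        proof -
          have z: "z \<in> L" using that lin_span_superset[of X R M] by (auto simp: L_def)
          have "z = \<zero>\<^bsub>R\<^esub> \<odot>\<^bsub>M\<^esub> x \<oplus>\<^bsub>M\<^esub> z" using x Lc[OF z] by (simp add: zero_act)
          then show ?thesis unfolding W_def using z R.zero_closed by blast
        qed
        ultimately show ?thesis by auto
      qed
      ultimately have "s \<in> W" using lin_span_least s insert.prems(3) by blast
      then show ?thesis by (auto simp: W_def)
    qed
    obtain C where C: "finite C" "C \<subseteq> J S" "J S \<subseteq> lin_span R (regular_module R) C"
      using noeth J[OF S] by (auto simp: noetherian_module_def fg_submodule_def)
    then have "\<forall>c\<in>C. \<exists>y\<in>L. c \<odot>\<^bsub>M\<^esub> x \<oplus>\<^bsub>M\<^esub> y \<in> S" by (auto simp: J_def)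
    then obtain w where w: "\<And>c. c \<in> C \<Longrightarrow> w c \<in> L \<and> c \<odot>\<^bsub>M\<^esub> x \<oplus>\<^bsub>M\<^esub> w c \<in> S" by metis
    have "fg_submodule R M (S \<inter> L)"
      using sub_inter[OF S L] X by (intro insert.IH) (auto simp: L_def)
    then obtain Y where Y: "finite Y" "Y \<subseteq> S \<inter> L" "S \<inter> L \<subseteq> lin_span R M Y"
      by (auto simp: fg_submodule_def)
    define G where "G = Y \<union> (\<lambda>c. c \<odot>\<^bsub>M\<^esub> x \<oplus>\<^bsub>M\<^esub> w c) ` C"
    have GS: "G \<subseteq> S" using Y(2) w by (auto simp: G_def)
    define T where "T = lin_span R M G"
    have T: "right_submodule R M T"
      unfolding T_def using GS sub_carrier[OF S] by (intro lin_span_submodule) auto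
    have TS: "T \<subseteq> S" unfolding T_def using S GS by (rule lin_span_least)
    have GT: "G \<subseteq> T" by (simp add: T_def lin_span_superset)
    have SLT: "S \<inter> L \<subseteq> T" using Y(3) lin_span_mono[of Y G R M] by (auto simp: T_def G_def)
    have "C \<subseteq> J T" using C(2) w GT unfolding J_def G_def by blast
    then have JST: "J S \<subseteq> J T" using C(3) lin_span_least[OF J[OF T]] by blast
    have "S \<subseteq> T"
    proof
      fix s assume s: "s \<in> S"
      then obtain c y where cy: "c \<in> carrier R" "y \<in> L" "s = c \<odot>\<^bsub>M\<^esub> x \<oplus>\<^bsub>M\<^esub> y" using span by blast
      then have "c \<in> J T" using JST s by (auto simp: J_def)
      then obtain z where z: "z \<in> L" "c \<odot>\<^bsub>M\<^esub> x \<oplus>\<^bsub>M\<^esub> z \<in> T" by (auto simp: J_def)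
      define t where "t = c \<odot>\<^bsub>M\<^esub> x \<oplus>\<^bsub>M\<^esub> z"
      have tT: "t \<in> T" "t \<in> S" using z TS by (auto simp: t_def)
      have tc: "t \<in> carrier M" "s \<in> carrier M" using sub_carrier[OF S] tT s by auto
      have "s \<ominus>\<^bsub>M\<^esub> t = y \<ominus>\<^bsub>M\<^esub> z"
      proof -
        have "s = (y \<ominus>\<^bsub>M\<^esub> z) \<oplus>\<^bsub>M\<^esub> t"
          using comb[OF cy(1)] Lc[OF cy(2)] Lc[OF z(1)]
          by (simp add: cy t_def a_minus_def M.a_ac M.r_neg1 M.r_neg2 M.l_neg M.r_neg)
        then have "s \<ominus>\<^bsub>M\<^esub> t = (y \<ominus>\<^bsub>M\<^esub> z) \<oplus>\<^bsub>M\<^esub> (t \<ominus>\<^bsub>M\<^esub> t)"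
          using tc Lc[OF cy(2)] Lc[OF z(1)] by (simp add: a_minus_def M.a_assoc)
        then show ?thesis using tc Lc[OF cy(2)] Lc[OF z(1)] by (simp add: diff_self)
      qed
      then have "s \<ominus>\<^bsub>M\<^esub> t \<in> S \<inter> L"
        using sub_diff[OF S s tT(2)] sub_diff[OF L cy(2) z(1)] by simp
      then have "(s \<ominus>\<^bsub>M\<^esub> t) \<oplus>\<^bsub>M\<^esub> t \<in> T" using SLT tT sub_add[OF T] by auto
      then show "s \<in> T" using tc by (simp add: diff_add_cancel)
    qed
    then show ?case
      unfolding fg_submodule_def using GS Y(1) C(1) by (intro exI[of _ G]) (auto simp: G_def T_def)
  qed
  obtain X where X: "finite X" "X \<subseteq> carrier M" "carrier M \<subseteq> lin_span R M X"
    using fg by (auto simp: fg_submodule_def)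
  show ?thesis
    unfolding noetherian_module_def
  proof (intro allI impI)
    fix S assume S: "right_submodule R M S"
    then have "S \<subseteq> lin_span R M X" using sub_carrier[OF S] X(3) by blast
    then show "fg_submodule R M S" using fin[OF X(1,2) S] by simp
  qed
qed

context artinian_cring
begin

abbreviation (input) "K \<equiv> regular_module k"

lemma K_module: "right_module k K"
  by (rule right_module_regular) (rule ring_axioms)

lemma ideal_of_submodule:
  assumes S: "right_submodule k K S"
  shows "ideal S k"
proof (rule idealI[OF ring_axioms])
  show "subgroup S (add_monoid k)"
  proof (rule subgroup.intro)
    fix x assume x: "x \<in> S"
    have "\<ominus>\<^bsub>k\<^esub> x = \<ominus> \<one> \<otimes> x" using sub_carrier[OF S x] by (simp add: l_minus)
    then have "\<ominus>\<^bsub>k\<^esub> x \<in> S"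
      using sub_act[OF S, of "\<ominus> \<one>" x] x sub_carrier[OF S x] by (simp add: m_comm)
    then show "inv\<^bsub>add_monoid k\<^esub> x \<in> S" by (simp add: a_inv_def)
  qed (use sub_carrier[OF S] sub_zero[OF S] sub_add[OF S] in auto)
  fix a x assume *: "a \<in> S" "x \<in> carrier k"
  then show "a \<otimes> x \<in> S" using sub_act[OF S, of x a] by simp
  then show "x \<otimes> a \<in> S" using * sub_carrier[OF S *(1)] by (simp add: m_comm)
qed

lemma minimal_submodule:
  assumes "S \<in> \<S>" and sub: "\<And>I. I \<in> \<S> \<Longrightarrow> right_submodule k K I"
  obtains I where "I \<in> \<S>" "\<And>J. \<lbrakk>J \<in> \<S>; J \<subseteq> I\<rbrakk> \<Longrightarrow> J = I"
proof (rule ccontr)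
  note found = that
  assume "\<not> thesis"
  then have step: "\<exists>J. J \<in> \<S> \<and> J \<subset> I" if I: "I \<in> \<S>" for I
    using \<open>\<not> thesis\<close> I found by blast
  obtain f where f: "f n \<in> \<S>" "f (Suc n) \<subset> f n" for n :: nat
    using dependent_nat_choice[of "\<lambda>_ I. I \<in> \<S>" "\<lambda>_ I J. J \<subset> I"] assms(1) step by metis
  have "\<exists>n. \<forall>m\<ge>n. f m = f n"
    using f ideal_of_submodule[OF sub] by (intro descending_chain) auto
  then obtain n where "f (Suc n) = f n" by (metis le_SucI order_refl)
  then show False using f(2)[of n] by auto
qed

lemma mult_hom: assumes "c \<in> carrier k" shows "(\<lambda>x. c \<otimes> x) \<in> mod_hom k K K"
  using assms by (intro mod_homI) (auto simp: r_distr m_assoc)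

text \<open>Suppose that some ideal is not finitely generated, and let \<open>I\<close> be minimal among these.
  For each scalar \<open>c\<close> the ideals \<open>c I\<close> and \<open>{x \<in> I. c x = 0}\<close> cannot both be proper in \<open>I\<close>,
  since \<open>I\<close> is an extension of the first by the second. So each \<open>c\<close> acts on \<open>I\<close>
  surjectively or by zero. By the descending chain condition the scalars of the first kind even act
  invertibly, so that \<open>I\<close> is a vector space over a residue field of the ring. A
  complement of a nonzero vector is proper in \<open>I\<close>, hence finitely generated, and then so is
  \<open>I\<close>.\<close>

lemma artinian_imp_noetherian: "noetherian_module k K"
  unfolding noetherian_module_def
proof (intro allI impI, rule ccontr)
  fix S assume S: "right_submodule k K S" "\<not> fg_submodule k K S"
  obtain I where I: "right_submodule k K I" "\<not> fg_submodule k K I"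
    and I_min: "\<And>J. \<lbrakk>right_submodule k K J; \<not> fg_submodule k K J; J \<subseteq> I\<rbrakk> \<Longrightarrow> J = I"
  proof (rule minimal_submodule[of S "{I. right_submodule k K I \<and> \<not> fg_submodule k K I}"])
    fix I assume "I \<in> {I. right_submodule k K I \<and> \<not> fg_submodule k K I}"
      and "\<And>J. \<lbrakk>J \<in> {I. right_submodule k K I \<and> \<not> fg_submodule k K I}; J \<subseteq> I\<rbrakk> \<Longrightarrow> J = I"
    then show thesis by (intro that[of I]) auto
  qed (use S in auto)
  note Ic = sub_carrier[OF I(1), simplified]
  have act: "r \<otimes> x \<in> I" if "r \<in> carrier k" "x \<in> I" for r x
    using sub_act[OF I(1) that] Ic that by (simp add: m_comm)
  have dich: "(\<lambda>x. c \<otimes> x) ` I = I \<or> (\<forall>x\<in>I. c \<otimes> x = \<zero>)" if c: "c \<in> carrier k" for c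
  proof (rule ccontr)
    assume neg: "\<not> ?thesis"
    have "fg_submodule k K ((\<lambda>x. c \<otimes> x) ` I)"
      using sub_image[OF mult_hom[OF c] K_module K_module I(1)] act[OF c] neg I_min by blast
    moreover have "right_submodule k K {x \<in> I. c \<otimes> x \<in> {\<zero>}}"
      by (rule sub_vimage[OF mult_hom[OF c] K_module K_module _ I(1)])
        (auto intro!: right_submoduleI)
    then have "fg_submodule k K {x \<in> I. c \<otimes> x = \<zero>}"
      using neg I_min by auto
    ultimately show False
      using fg_extension[OF mult_hom[OF c] K_module K_module I(1)] I(2) by simp
  qed
  define p where "p = {c \<in> carrier k. \<forall>x\<in>I. c \<otimes> x = \<zero>}"
  have unit: "(\<lambda>x. c \<otimes> x) ` I = I" if "c \<in> carrier k" "c \<notin> p" for c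
    using dich[of c] that by (auto simp: p_def)
  obtain x0 where x0: "x0 \<in> I" "x0 \<noteq> \<zero>"
  proof -
    have "fg_submodule k K {\<zero>}"
      unfolding fg_submodule_def by (intro exI[of _ "{\<zero>}"]) (auto simp: lin_span_superset)
    then show thesis using I sub_zero[OF I(1)] that by (metis (no_types, lifting) regular_module_simps(2) singletonI subset_antisym subset_iff singletonD)
  qed
  have inv: "\<exists>r\<in>carrier k. \<forall>x\<in>I. (r \<otimes> c) \<otimes> x = x" if c: "c \<in> carrier k" "c \<notin> p" for c
  proof -
    \<comment> \<open>if the principal ideal of \<open>d\<close> is minimal among those of elements outside the annihilator,
      then \<open>d\<close> is a multiple of \<open>d c\<close>, and \<open>d\<close> can be cancelled because \<open>d I = I\<close>\<close>
    let ?P = "\<lambda>d. (\<lambda>r. d \<otimes> r) ` carrier k"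
    have P: "right_submodule k K (?P d)" if "d \<in> carrier k" for d
      using sub_image[OF mult_hom[OF that] K_module K_module right_module.carrier_submodule[OF K_module]]
      by simp
    obtain D where D: "D \<in> ?P ` (carrier k - p)"
      and D_min: "\<And>J. \<lbrakk>J \<in> ?P ` (carrier k - p); J \<subseteq> D\<rbrakk> \<Longrightarrow> J = D"
      using minimal_submodule[of "?P c" "?P ` (carrier k - p)"] P c by blast
    then obtain d where d: "d \<in> carrier k" "d \<notin> p" "D = ?P d" by auto
    have "(\<lambda>x. (d \<otimes> c) \<otimes> x) ` I = (\<lambda>x. d \<otimes> x) ` ((\<lambda>x. c \<otimes> x) ` I)"
      using c d Ic by (force simp: m_assoc image_image intro!: image_cong)
    then have dcI: "(\<lambda>x. (d \<otimes> c) \<otimes> x) ` I = I" using unit c d by simp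
    have "d \<otimes> c \<notin> p"
    proof
      assume "d \<otimes> c \<in> p"
      then have "(\<lambda>x. (d \<otimes> c) \<otimes> x) ` I \<subseteq> {\<zero>}" by (auto simp: p_def)
      then show False using dcI x0 by auto
    qed
    moreover have "?P (d \<otimes> c) \<subseteq> D" using c d by (auto simp: m_assoc)
    ultimately have "?P (d \<otimes> c) = D" using D_min c d by auto
    moreover have "d \<in> D" using d by (auto intro!: image_eqI[of _ _ \<one>])
    ultimately obtain r where r: "r \<in> carrier k" "d = (d \<otimes> c) \<otimes> r" by auto
    have "(r \<otimes> c) \<otimes> x = x" if x: "x \<in> I" for x
    proof -
      obtain y where y: "y \<in> I" "x = d \<otimes> y" using unit[OF d(1,2)] x by auto
      have "(r \<otimes> c) \<otimes> x = ((d \<otimes> c) \<otimes> r) \<otimes> y"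
        using y(1) c(1) d(1) r(1) Ic[OF y(1)] unfolding y(2) by (simp add: m_ac)
      then show ?thesis using y(2) r(2) by simp
    qed
    then show ?thesis using r by auto
  qed
  \<comment> \<open>a complement of the line through \<open>x0\<close>\<close>
  define \<N> where "\<N> = {N. right_submodule k K N \<and> N \<subseteq> I \<and> x0 \<notin> N}"
  have "\<exists>N\<in>\<N>. \<forall>X\<in>\<N>. N \<subseteq> X \<longrightarrow> X = N"
  proof (rule subset_Zorn_nonempty)
    have "{\<zero>} \<in> \<N>" using x0 sub_zero[OF I(1)] by (auto simp: \<N>_def intro!: right_submoduleI)
    then show "\<N> \<noteq> {}" by auto
    fix \<C> assume C: "\<C> \<noteq> {}" "subset.chain \<N> \<C>"
    then have CN: "\<And>N. N \<in> \<C> \<Longrightarrow> N \<in> \<N>" by (auto simp: subset_chain_def)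
    have "right_submodule k K (\<Union>\<C>)"
    proof (rule right_submoduleI)
      fix x y assume "x \<in> \<Union>\<C>" "y \<in> \<Union>\<C>"
      then obtain N where "N \<in> \<C>" "x \<in> N" "y \<in> N"
        using C(2) by (auto simp: subset_chain_def) (metis subsetD)
      then show "x \<oplus>\<^bsub>K\<^esub> y \<in> \<Union>\<C>" using CN sub_add[of k K N x y] by (auto simp: \<N>_def)
    next
      show "\<Union>\<C> \<subseteq> carrier K" using CN Ic by (auto simp: \<N>_def)
      show "\<zero>\<^bsub>K\<^esub> \<in> \<Union>\<C>" using C(1) CN sub_zero[of k K] by (force simp: \<N>_def)
    next
      fix a x assume "a \<in> carrier k" "x \<in> \<Union>\<C>"
      then show "a \<odot>\<^bsub>K\<^esub> x \<in> \<Union>\<C>" using CN sub_act[of k K _ a x] by (fastforce simp: \<N>_def)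
    qed
    then show "\<Union>\<C> \<in> \<N>" using CN by (auto simp: \<N>_def)
  qed
  then obtain N where N: "right_submodule k K N" "N \<subseteq> I" "x0 \<notin> N"
    and N_max: "\<And>X. \<lbrakk>right_submodule k K X; X \<subseteq> I; x0 \<notin> X; N \<subseteq> X\<rbrakk> \<Longrightarrow> X = N"
    by (auto simp: \<N>_def)
  have "fg_submodule k K N" using I_min[OF N(1) _ N(2)] N(3) x0 by auto
  then obtain X where X: "finite X" "X \<subseteq> N" "N \<subseteq> lin_span k K X" by (auto simp: fg_submodule_def)
  have Xc: "insert x0 X \<subseteq> carrier K" using X(2) N(2) x0 Ic by auto
  define L where "L = lin_span k K (insert x0 X)"
  have L: "right_submodule k K L"
    unfolding L_def by (rule right_module.lin_span_submodule[OF K_module Xc])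
  have NL: "N \<subseteq> L" using X(3) lin_span_mono[of X "insert x0 X" k K] by (auto simp: L_def)
  have x0L: "x0 \<in> L" using lin_span_superset[of "insert x0 X" k K] by (auto simp: L_def)
  have "I \<subseteq> L"
  proof
    fix y assume y: "y \<in> I"
    show "y \<in> L"
    proof (cases "y \<in> N")
      case False
      define W where "W = {n \<oplus> y \<otimes> c |n c. n \<in> N \<and> c \<in> carrier k}"
      have Nc: "n \<in> carrier k" if "n \<in> N" for n using that N(2) Ic by auto
      have yc: "y \<in> carrier k" using y Ic by auto
      have W: "right_submodule k K W"
      proof (rule right_submoduleI)
        show "W \<subseteq> carrier K" using Nc yc by (auto simp: W_def)
        have "\<zero> = \<zero> \<oplus> y \<otimes> \<zero>" using yc by simp
        then show "\<zero>\<^bsub>K\<^esub> \<in> W" using sub_zero[OF N(1)] unfolding W_def by auto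
        fix u v assume "u \<in> W" "v \<in> W"
        then obtain n c m d where *: "n \<in> N" "m \<in> N" "c \<in> carrier k" "d \<in> carrier k"
          "u = n \<oplus> y \<otimes> c" "v = m \<oplus> y \<otimes> d" by (auto simp: W_def)
        have "u \<oplus> v = (n \<oplus> m) \<oplus> y \<otimes> (c \<oplus> d)" using * Nc yc by (simp add: r_distr a_ac)
        then show "u \<oplus>\<^bsub>K\<^esub> v \<in> W" unfolding W_def using * sub_add[OF N(1) *(1,2)] by auto
      next
        fix a u assume a: "a \<in> carrier k" and "u \<in> W"
        then obtain n c where *: "n \<in> N" "c \<in> carrier k" "u = n \<oplus> y \<otimes> c" by (auto simp: W_def)
        have "u \<otimes> a = n \<otimes> a \<oplus> y \<otimes> (c \<otimes> a)" using * Nc yc a by (simp add: l_distr m_assoc)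
        then show "a \<odot>\<^bsub>K\<^esub> u \<in> W" unfolding W_def using * a sub_act[OF N(1) a *(1)] by auto
      qed
      have WI: "W \<subseteq> I"
      proof
        fix u assume "u \<in> W"
        then obtain n c where *: "n \<in> N" "c \<in> carrier k" "u = n \<oplus> y \<otimes> c" by (auto simp: W_def)
        then show "u \<in> I" using sub_add[OF I(1), of n "y \<otimes> c"] sub_act[OF I(1), of c y] y N(2) by auto
      qed
      have NW: "N \<subseteq> W"
      proof
        fix n assume n: "n \<in> N"
        have "n = n \<oplus> y \<otimes> \<zero>" using Nc[OF n] yc by simp
        then show "n \<in> W" unfolding W_def using n by blast
      qed
      have "y = \<zero> \<oplus> y \<otimes> \<one>" using yc by simp
      then have yW: "y \<in> W" unfolding W_def using sub_zero[OF N(1)] by auto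
      have "x0 \<in> W" using N_max[OF W WI _ NW] yW False by auto
      then obtain n c where nc: "n \<in> N" "c \<in> carrier k" "x0 = n \<oplus> y \<otimes> c" by (auto simp: W_def)
      have "c \<notin> p"
      proof
        assume "c \<in> p"
        then have "y \<otimes> c = \<zero>" using y yc nc by (auto simp: p_def m_comm)
        then show False using nc N(3) Nc by simp
      qed
      then obtain r where r: "r \<in> carrier k" "\<And>x. x \<in> I \<Longrightarrow> (r \<otimes> c) \<otimes> x = x" using inv nc by metis
      have "y \<otimes> c \<in> L"
      proof (rule submodule_add_right_mem[OF K_module L])
        show "y \<otimes> c \<in> carrier K" using yc nc by simp
        show "n \<in> L" using nc NL by auto
        show "y \<otimes> c \<oplus>\<^bsub>K\<^esub> n \<in> L" using x0L nc yc Nc by (simp add: a_comm)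
      qed
      then have "(y \<otimes> c) \<otimes> r \<in> L" using sub_act[OF L r(1)] by simp
      moreover have "(y \<otimes> c) \<otimes> r = (r \<otimes> c) \<otimes> y" using yc nc r by (simp add: m_ac)
      ultimately show "y \<in> L" using r y by simp
    qed (use NL in auto)
  qed
  then have "fg_submodule k K I"
    unfolding fg_submodule_def using X x0 N(2) by (intro exI[of _ "insert x0 X"]) (auto simp: L_def)
  then show False using I(2) by simp
qed

end

definition restrict_scalars :: "('k \<Rightarrow> 'a) \<Rightarrow> ('a, 'm) module \<Rightarrow> ('k, 'm) module" where
  "restrict_scalars \<phi> M = \<lparr>carrier = carrier M, mult = mult M, one = one M, zero = zero M,
    add = add M, smult = (\<lambda>c x. \<phi> c \<odot>\<^bsub>M\<^esub> x)\<rparr>"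

lemma restrict_scalars_simps [simp]:
  "carrier (restrict_scalars \<phi> M) = carrier M" "zero (restrict_scalars \<phi> M) = zero M"
  "add (restrict_scalars \<phi> M) = add M" "smult (restrict_scalars \<phi> M) c x = \<phi> c \<odot>\<^bsub>M\<^esub> x"
  by (simp_all add: restrict_scalars_def)

lemma right_module_restrict_scalars:
  assumes k: "ring k" and f: "\<phi> \<in> ring_hom k R" and M: "right_module R M"
  shows "right_module k (restrict_scalars \<phi> M)"
proof -
  interpret right_module R M by (rule M)
  have "abelian_group (restrict_scalars \<phi> M)"
  proof (rule abelian_groupI)
    fix x assume "x \<in> carrier (restrict_scalars \<phi> M)"
    then show "\<exists>y\<in>carrier (restrict_scalars \<phi> M).
        y \<oplus>\<^bsub>restrict_scalars \<phi> M\<^esub> x = \<zero>\<^bsub>restrict_scalars \<phi> M\<^esub>"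
      by (auto intro!: bexI[of _ "\<ominus>\<^bsub>M\<^esub> x"] simp: M.l_neg)
  qed (auto simp: M.a_ac)
  then show ?thesis
    by (intro right_module.intro right_module_axioms.intro k)
      (auto simp: act_closed act_scalar_distr act_vector_distr act_assoc act_one
        ring_hom_closed[OF f] ring_hom_add[OF f] ring_hom_mult[OF f] ring_hom_one[OF f])
qed

lemma submodule_restrict_scalars:
  assumes "\<phi> \<in> ring_hom k R" "right_submodule R M S"
  shows "right_submodule k (restrict_scalars \<phi> M) S"
  using assms(2) ring_hom_closed[OF assms(1)] by (auto simp: right_submodule_def)

text \<open>Finite sums are products in the additive monoid, whose record type depends on the ring or
  module that it comes from, so this does not hold by definition.\<close>

lemma finsum_eq_if_same_addition:
  assumes G: "abelian_group G" and H: "abelian_group H"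
    and same: "carrier H = carrier G" "zero H = zero G" "add H = add G"
    and X: "finite X" "g \<in> X \<rightarrow> carrier G"
  shows "finsum G g X = finsum H g X"
proof -
  interpret G: abelian_group G by (rule G)
  interpret H: abelian_group H by (rule H)
  show ?thesis
    using X
  proof (induction X rule: finite_induct)
    case (insert x X)
    then show ?case
      by (subst G.finsum_insert) (auto simp: same Pi_iff H.finsum_insert)
  qed (simp add: same)
qed

text \<open>A right ideal is a \<open>k\<close>-submodule of a finitely generated module over the noetherian
  ring \<open>k\<close>, and generators over \<open>k\<close> are generators over the algebra.\<close>

lemma artin_algebra_noetherian:
  assumes "artin_algebra k \<phi> \<Lambda>"
  shows "noetherian_module \<Lambda> (regular_module \<Lambda>)"
proof -
  interpret artin_algebra k \<phi> \<Lambda> by (rule assms)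
  let ?N = "restrict_scalars \<phi> (regular_module \<Lambda>)"
  have N: "right_module k ?N"
    by (rule right_module_restrict_scalars[OF k.ring_axioms structure_hom right_module_regular[OF \<Lambda>.ring_axioms]])
  have "finitely_generated k ?N"
  proof -
    obtain X where X: "finite X" "X \<subseteq> carrier \<Lambda>"
      and gen: "\<forall>y\<in>carrier \<Lambda>. \<exists>c\<in>X \<rightarrow> carrier k. y = (\<Oplus>\<^bsub>\<Lambda>\<^esub>x\<in>X. \<phi> (c x) \<otimes>\<^bsub>\<Lambda>\<^esub> x)"
      using finite_over_base by blast
    have eq: "(\<Oplus>\<^bsub>\<Lambda>\<^esub>x\<in>X. \<phi> (c x) \<otimes>\<^bsub>\<Lambda>\<^esub> x) = (\<Oplus>\<^bsub>?N\<^esub>x\<in>X. c x \<odot>\<^bsub>?N\<^esub> x)" if c: "c \<in> X \<rightarrow> carrier k" for c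
    proof -
      have "(\<Oplus>\<^bsub>\<Lambda>\<^esub>x\<in>X. \<phi> (c x) \<otimes>\<^bsub>\<Lambda>\<^esub> x) = (\<Oplus>\<^bsub>\<Lambda>\<^esub>x\<in>X. x \<otimes>\<^bsub>\<Lambda>\<^esub> \<phi> (c x))"
        using c X(2) ring_hom_closed[OF structure_hom]
        by (intro \<Lambda>.finsum_cong') (auto intro!: structure_central)
      also have "\<dots> = (\<Oplus>\<^bsub>?N\<^esub>x\<in>X. c x \<odot>\<^bsub>?N\<^esub> x)"
        using X c ring_hom_closed[OF structure_hom]
        by (subst finsum_eq_if_same_addition[OF \<Lambda>.abelian_group_axioms right_module_group[OF N], symmetric])
          (auto intro!: \<Lambda>.m_closed)
      finally show ?thesis .
    qed
    show ?thesis
      unfolding finitely_generated_def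
    proof (intro exI[of _ X] conjI ballI)
      fix y assume "y \<in> carrier ?N"
      then obtain c where c: "c \<in> X \<rightarrow> carrier k" "y = (\<Oplus>\<^bsub>\<Lambda>\<^esub>x\<in>X. \<phi> (c x) \<otimes>\<^bsub>\<Lambda>\<^esub> x)"
        using gen by auto
      then show "\<exists>c\<in>X \<rightarrow> carrier k. y = (\<Oplus>\<^bsub>?N\<^esub>x\<in>X. c x \<odot>\<^bsub>?N\<^esub> x)"
        using eq[OF c(1)] by (intro bexI[OF _ c(1)]) simp
    qed (use X in auto)
  qed
  then have noeth: "noetherian_module k ?N"
    using finitely_generated_iff[OF N] noetherian_if_fg[OF k.artinian_imp_noetherian N] by simp
  show ?thesis
    unfolding noetherian_module_def
  proof (intro allI impI)
    fix S assume S: "right_submodule \<Lambda> (regular_module \<Lambda>) S"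
    then have "fg_submodule k ?N S"
      using noeth submodule_restrict_scalars[OF structure_hom S] by (simp add: noetherian_module_def)
    then obtain X where X: "finite X" "X \<subseteq> S" "S \<subseteq> lin_span k ?N X" by (auto simp: fg_submodule_def)
    have "lin_span k ?N X \<subseteq> lin_span \<Lambda> (regular_module \<Lambda>) X"
      using submodule_restrict_scalars[OF structure_hom] unfolding lin_span_def by blast
    then show "fg_submodule \<Lambda> (regular_module \<Lambda>) S" using X by (auto simp: fg_submodule_def)
  qed
qed

section \<open>Quotients, sums and pullbacks\<close>

definition dsum :: "('a, 'm) module \<Rightarrow> ('a, 'n) module \<Rightarrow> ('a, 'm \<times> 'n) module" where
  "dsum M N = \<lparr>carrier = carrier M \<times> carrier N, mult = (\<lambda>x y. x), one = (\<zero>\<^bsub>M\<^esub>, \<zero>\<^bsub>N\<^esub>),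
    zero = (\<zero>\<^bsub>M\<^esub>, \<zero>\<^bsub>N\<^esub>), add = (\<lambda>x y. (fst x \<oplus>\<^bsub>M\<^esub> fst y, snd x \<oplus>\<^bsub>N\<^esub> snd y)),
    smult = (\<lambda>a x. (a \<odot>\<^bsub>M\<^esub> fst x, a \<odot>\<^bsub>N\<^esub> snd x))\<rparr>"

lemma dsum_simps [simp]:
  "carrier (dsum M N) = carrier M \<times> carrier N" "zero (dsum M N) = (\<zero>\<^bsub>M\<^esub>, \<zero>\<^bsub>N\<^esub>)"
  "add (dsum M N) x y = (fst x \<oplus>\<^bsub>M\<^esub> fst y, snd x \<oplus>\<^bsub>N\<^esub> snd y)"
  "smult (dsum M N) a x = (a \<odot>\<^bsub>M\<^esub> fst x, a \<odot>\<^bsub>N\<^esub> snd x)"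
  by (simp_all add: dsum_def)

lemma right_module_dsum:
  assumes M: "right_module R M" and N: "right_module R N"
  shows "right_module R (dsum M N)"
proof -
  interpret M: right_module R M by (rule M)
  interpret N: right_module R N by (rule N)
  have "abelian_group (dsum M N)"
  proof (rule abelian_groupI)
    fix x assume "x \<in> carrier (dsum M N)"
    then show "\<exists>y\<in>carrier (dsum M N). y \<oplus>\<^bsub>dsum M N\<^esub> x = \<zero>\<^bsub>dsum M N\<^esub>"
      by (intro bexI[of _ "(\<ominus>\<^bsub>M\<^esub> fst x, \<ominus>\<^bsub>N\<^esub> snd x)"]) (auto simp: M.M.l_neg N.M.l_neg)
  qed (auto simp: M.M.a_ac N.M.a_ac)
  then show ?thesis
    by (intro right_module.intro right_module_axioms.intro M.R.ring_axioms)
      (auto simp: M.act_closed M.act_scalar_distr M.act_vector_distr M.act_assoc M.act_one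
        N.act_closed N.act_scalar_distr N.act_vector_distr N.act_assoc N.act_one)
qed

lemma fst_hom: "fst \<in> mod_hom R (dsum M N) M" and snd_hom: "snd \<in> mod_hom R (dsum M N) N"
  by (auto intro!: mod_homI)

lemma inl_hom:
  assumes N: "right_module R N"
  shows "(\<lambda>x. (x, \<zero>\<^bsub>N\<^esub>)) \<in> mod_hom R M (dsum M N)"
proof -
  interpret N: right_module R N by (rule N)
  show ?thesis by (auto intro!: mod_homI simp: N.act_zero)
qed

lemma inr_hom:
  assumes M: "right_module R M"
  shows "(\<lambda>y. (\<zero>\<^bsub>M\<^esub>, y)) \<in> mod_hom R N (dsum M N)"
proof -
  interpret M: right_module R M by (rule M)
  show ?thesis by (auto intro!: mod_homI simp: M.act_zero)
qed

lemma pair_hom: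
  assumes "f \<in> mod_hom R L M" and "g \<in> mod_hom R L N"
  shows "(\<lambda>x. (f x, g x)) \<in> mod_hom R L (dsum M N)"
  using assms by (auto intro!: mod_homI simp: hom_closed hom_add hom_act)

lemma fg_mod_extension:
  assumes E: "right_module R E" and p: "p \<in> mod_hom R E A" and i: "i \<in> mod_hom R D E"
    and A: "A \<in> fg_mod R" and D: "D \<in> fg_mod R" and surj: "p ` carrier E = carrier A"
    and ker: "i ` carrier D = {x \<in> carrier E. p x = \<zero>\<^bsub>A\<^esub>}"
  shows "E \<in> fg_mod R"
proof -
  have "fg_submodule R E (i ` carrier D)"
    using D by (intro fg_image[OF i _ E]) (auto simp: fg_mod_iff)
  then show ?thesis
    using fg_extension[OF p E fg_modD[OF A] right_module.carrier_submodule[OF E]] A E surj ker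
    by (simp add: fg_mod_iff)
qed

lemma fg_mod_dsum:
  assumes "M \<in> fg_mod R" and "N \<in> fg_mod R"
  shows "dsum M N \<in> fg_mod R"
proof -
  interpret M: right_module R M using assms(1) by (rule fg_modD)
  interpret N: right_module R N using assms(2) by (rule fg_modD)
  show ?thesis
    by (rule fg_mod_extension[OF right_module_dsum fst_hom inr_hom assms])
      (auto intro: M.right_module_axioms N.right_module_axioms image_eqI[of _ fst "(_, \<zero>\<^bsub>N\<^esub>)"])
qed

lemma fg_mod_epi_image:
  assumes M: "M \<in> fg_mod R" and N: "right_module R N" and f: "f \<in> mod_hom R M N"
    and surj: "f ` carrier M = carrier N"
  shows "N \<in> fg_mod R"
  using fg_image[OF f fg_modD[OF M] N subset_refl] M N surj by (simp add: fg_mod_iff)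

text \<open>A quotient of \<open>M\<close> can be formed on a set of representatives, so that its elements
  have the type of those of \<open>M\<close>.\<close>

lemma quotient_module_exists:
  fixes M :: "('a, 'm) module"
  assumes M: "right_module R M" and S: "right_submodule R M S"
  obtains Q :: "('a, 'm) module" and q where "right_module R Q" "q \<in> mod_hom R M Q"
    "q ` carrier M = carrier Q" "\<And>x. x \<in> carrier M \<Longrightarrow> q x = \<zero>\<^bsub>Q\<^esub> \<longleftrightarrow> x \<in> S"
proof -
  interpret right_module R M by (rule M)
  note Sc = sub_carrier[OF S]
  define q where "q x = (SOME y. y \<in> carrier M \<and> x \<ominus>\<^bsub>M\<^esub> y \<in> S)" for x
  have q: "q x \<in> carrier M" "x \<ominus>\<^bsub>M\<^esub> q x \<in> S" if "x \<in> carrier M" for x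
  proof -
    have "\<exists>y. y \<in> carrier M \<and> x \<ominus>\<^bsub>M\<^esub> y \<in> S"
      using that sub_zero[OF S] by (intro exI[of _ x]) (simp add: diff_self)
    then have "q x \<in> carrier M \<and> x \<ominus>\<^bsub>M\<^esub> q x \<in> S" unfolding q_def by (rule someI_ex)
    then show "q x \<in> carrier M" "x \<ominus>\<^bsub>M\<^esub> q x \<in> S" by auto
  qed
  have trans: "x \<ominus>\<^bsub>M\<^esub> z \<in> S"
    if "x \<ominus>\<^bsub>M\<^esub> y \<in> S" "y \<ominus>\<^bsub>M\<^esub> z \<in> S" "x \<in> carrier M" "y \<in> carrier M" "z \<in> carrier M" for x y z
  proof -
    have "(x \<ominus>\<^bsub>M\<^esub> y) \<oplus>\<^bsub>M\<^esub> (y \<ominus>\<^bsub>M\<^esub> z) = x \<ominus>\<^bsub>M\<^esub> z"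
      using that by (simp add: a_minus_def M.a_assoc M.r_neg1)
    then show ?thesis using sub_add[OF S that(1,2)] by simp
  qed
  have sym: "y \<ominus>\<^bsub>M\<^esub> x \<in> S" if "x \<ominus>\<^bsub>M\<^esub> y \<in> S" "x \<in> carrier M" "y \<in> carrier M" for x y
  proof -
    have "\<ominus>\<^bsub>M\<^esub> (x \<ominus>\<^bsub>M\<^esub> y) = y \<ominus>\<^bsub>M\<^esub> x"
      using that by (simp add: a_minus_def M.minus_add M.a_comm)
    then show ?thesis using sub_minus[OF S that(1)] by simp
  qed
  have cong: "q x = q y" if "x \<ominus>\<^bsub>M\<^esub> y \<in> S" "x \<in> carrier M" "y \<in> carrier M" for x y
  proof -
    have "(z \<in> carrier M \<and> x \<ominus>\<^bsub>M\<^esub> z \<in> S) = (z \<in> carrier M \<and> y \<ominus>\<^bsub>M\<^esub> z \<in> S)" for z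
      using trans sym that by blast
    then show ?thesis by (simp add: q_def)
  qed
  have add: "q (q x \<oplus>\<^bsub>M\<^esub> q y) = q (x \<oplus>\<^bsub>M\<^esub> y)" if "x \<in> carrier M" "y \<in> carrier M" for x y
  proof (rule cong[symmetric])
    have "(x \<oplus>\<^bsub>M\<^esub> y) \<ominus>\<^bsub>M\<^esub> (q x \<oplus>\<^bsub>M\<^esub> q y) = (x \<ominus>\<^bsub>M\<^esub> q x) \<oplus>\<^bsub>M\<^esub> (y \<ominus>\<^bsub>M\<^esub> q y)"
      using that q by (simp add: a_minus_def M.minus_add M.a_ac)
    then show "(x \<oplus>\<^bsub>M\<^esub> y) \<ominus>\<^bsub>M\<^esub> (q x \<oplus>\<^bsub>M\<^esub> q y) \<in> S" using sub_add[OF S] q that by simp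
  qed (use that q in auto)
  have act: "q (a \<odot>\<^bsub>M\<^esub> q x) = q (a \<odot>\<^bsub>M\<^esub> x)" if "a \<in> carrier R" "x \<in> carrier M" for a x
  proof (rule cong[symmetric])
    have "a \<odot>\<^bsub>M\<^esub> x \<ominus>\<^bsub>M\<^esub> a \<odot>\<^bsub>M\<^esub> q x = a \<odot>\<^bsub>M\<^esub> (x \<ominus>\<^bsub>M\<^esub> q x)"
      using that q by (simp add: a_minus_def act_vector_distr act_minus)
    then show "a \<odot>\<^bsub>M\<^esub> x \<ominus>\<^bsub>M\<^esub> a \<odot>\<^bsub>M\<^esub> q x \<in> S" using sub_act[OF S] q that by simp
  qed (use that q in \<open>auto intro: act_closed\<close>)
  define Q :: "('a, 'm) module" where
    "Q = \<lparr>carrier = q ` carrier M, mult = (\<lambda>x y. x), one = q \<zero>\<^bsub>M\<^esub>, zero = q \<zero>\<^bsub>M\<^esub>,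
          add = (\<lambda>x y. q (x \<oplus>\<^bsub>M\<^esub> y)), smult = (\<lambda>a x. q (a \<odot>\<^bsub>M\<^esub> x))\<rparr>"
  have Q: "carrier Q = q ` carrier M" "\<zero>\<^bsub>Q\<^esub> = q \<zero>\<^bsub>M\<^esub>"
    and Qadd: "\<And>x y. \<lbrakk>x \<in> carrier M; y \<in> carrier M\<rbrakk> \<Longrightarrow> q x \<oplus>\<^bsub>Q\<^esub> q y = q (x \<oplus>\<^bsub>M\<^esub> y)"
    and Qact: "\<And>a x. \<lbrakk>a \<in> carrier R; x \<in> carrier M\<rbrakk> \<Longrightarrow> a \<odot>\<^bsub>Q\<^esub> q x = q (a \<odot>\<^bsub>M\<^esub> x)"
    by (simp_all add: Q_def add act)
  have Qg: "abelian_group Q"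
  proof (rule abelian_groupI)
    fix x assume "x \<in> carrier Q"
    then obtain x' where "x' \<in> carrier M" "x = q x'" by (auto simp: Q)
    then show "\<exists>y\<in>carrier Q. y \<oplus>\<^bsub>Q\<^esub> x = \<zero>\<^bsub>Q\<^esub>"
      by (intro bexI[of _ "q (\<ominus>\<^bsub>M\<^esub> x')"]) (auto simp: Qadd Q M.l_neg)
  qed (auto simp: Q Qadd M.a_ac)
  have Qm: "right_module R Q"
    by (intro right_module.intro right_module_axioms.intro R.ring_axioms Qg)
      (auto simp: Q Qadd Qact act_closed act_scalar_distr act_vector_distr act_assoc act_one)
  show thesis
  proof (rule that[OF Qm])
    show "q \<in> mod_hom R M Q" by (intro mod_homI) (auto simp: Q Qadd Qact)
    show "q ` carrier M = carrier Q" by (simp add: Q)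
    fix x assume x: "x \<in> carrier M"
    have x0: "x \<ominus>\<^bsub>M\<^esub> \<zero>\<^bsub>M\<^esub> = x" using x by (simp add: a_minus_def)
    have q0: "\<zero>\<^bsub>M\<^esub> \<ominus>\<^bsub>M\<^esub> q \<zero>\<^bsub>M\<^esub> \<in> S" using q by simp
    show "q x = \<zero>\<^bsub>Q\<^esub> \<longleftrightarrow> x \<in> S"
    proof
      assume "q x = \<zero>\<^bsub>Q\<^esub>"
      then have "x \<ominus>\<^bsub>M\<^esub> q \<zero>\<^bsub>M\<^esub> \<in> S" using q(2)[OF x] by (simp add: Q)
      then have "x \<ominus>\<^bsub>M\<^esub> \<zero>\<^bsub>M\<^esub> \<in> S" using trans[OF _ sym[OF q0]] x q by simp
      then show "x \<in> S" by (simp add: x0)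
    next
      assume "x \<in> S"
      then show "q x = \<zero>\<^bsub>Q\<^esub>" using cong[of x "\<zero>\<^bsub>M\<^esub>"] x x0 by (simp add: Q)
    qed
  qed
qed

lemma short_exact_seqD:
  assumes "short_exact_seq R D i E p A"
  shows "i \<in> mod_hom R D E" "p \<in> mod_hom R E A" "inj_on i (carrier D)"
    "p ` carrier E = carrier A" "i ` carrier D = {x \<in> carrier E. p x = \<zero>\<^bsub>A\<^esub>}"
  using assms by (auto simp: short_exact_seq_def right_exact_seq_def exact_at_def)

lemma short_exact_seqI:
  assumes "i \<in> mod_hom R D E" "p \<in> mod_hom R E A" "inj_on i (carrier D)"
    "p ` carrier E = carrier A" "i ` carrier D = {x \<in> carrier E. p x = \<zero>\<^bsub>A\<^esub>}"
  shows "short_exact_seq R D i E p A"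
  using assms by (auto simp: short_exact_seq_def right_exact_seq_def exact_at_def)

lemma ses_comp_zero:
  assumes "short_exact_seq R D i E p A" and "x \<in> carrier D"
  shows "p (i x) = \<zero>\<^bsub>A\<^esub>"
  using short_exact_seqD(5)[OF assms(1)] assms(2) by blast

lemma hom_injI:
  assumes f: "f \<in> mod_hom R M N" and M: "right_module R M" and N: "right_module R N"
    and ker: "\<And>x. \<lbrakk>x \<in> carrier M; f x = \<zero>\<^bsub>N\<^esub>\<rbrakk> \<Longrightarrow> x = \<zero>\<^bsub>M\<^esub>"
  shows "inj_on f (carrier M)"
proof (rule inj_onI)
  interpret M: right_module R M by (rule M)
  fix x y assume *: "x \<in> carrier M" "y \<in> carrier M" "f x = f y"
  then have "x \<ominus>\<^bsub>M\<^esub> y = \<zero>\<^bsub>M\<^esub>" using hom_eq_zeroI[OF f M N *] by (intro ker) auto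
  then show "x = y" using M.diff_zero_eq * by simp
qed

text \<open>The five lemma for extensions with the same ends.\<close>

lemma extension_morphism_bij:
  assumes e: "short_exact_seq R D i E p A" and e': "short_exact_seq R D i' E' p' A"
    and D: "right_module R D" and E: "right_module R E" and E': "right_module R E'"
    and A: "right_module R A"
    and h: "h \<in> mod_hom R E E'" and hi: "\<And>x. x \<in> carrier D \<Longrightarrow> h (i x) = i' x"
    and ph: "\<And>y. y \<in> carrier E \<Longrightarrow> p' (h y) = p y"
  shows "bij_betw h (carrier E) (carrier E')"
proof -
  interpret E: right_module R E by (rule E)
  interpret E': right_module R E' by (rule E')
  interpret D: right_module R D by (rule D)
  note s = short_exact_seqD[OF e] and s' = short_exact_seqD[OF e']
  have "inj_on h (carrier E)"
  proof (rule hom_injI[OF h E E'])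
    fix y assume y: "y \<in> carrier E" "h y = \<zero>\<^bsub>E'\<^esub>"
    then have "p y = \<zero>\<^bsub>A\<^esub>" using ph hom_zero[OF s'(2) E' A] by metis
    then obtain x where x: "x \<in> carrier D" "y = i x" using s(5) y by blast
    then have "i' x = i' \<zero>\<^bsub>D\<^esub>" using y hi hom_zero[OF s'(1) D E'] by simp
    then have "x = \<zero>\<^bsub>D\<^esub>" using s'(3) x by (auto dest: inj_onD)
    then show "y = \<zero>\<^bsub>E\<^esub>" using x hom_zero[OF s(1) D E] by simp
  qed
  moreover have "carrier E' \<subseteq> h ` carrier E"
  proof
    fix z assume z: "z \<in> carrier E'"
    then have "p' z \<in> p ` carrier E" using s(4) hom_closed[OF s'(2)] by auto
    then obtain y where y: "y \<in> carrier E" "p y = p' z" by auto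
    note hy = hom_closed[OF h y(1)]
    have "p' (z \<ominus>\<^bsub>E'\<^esub> h y) = \<zero>\<^bsub>A\<^esub>"
      using z y hy ph[OF y(1)] by (intro hom_eq_zeroI[OF s'(2) E' A]) auto
    then obtain d where d: "d \<in> carrier D" "z \<ominus>\<^bsub>E'\<^esub> h y = i' d" using s'(5) z hy by blast
    have "h (y \<oplus>\<^bsub>E\<^esub> i d) = h y \<oplus>\<^bsub>E'\<^esub> (z \<ominus>\<^bsub>E'\<^esub> h y)"
      using y d hi hom_closed[OF s(1)] by (simp add: hom_add[OF h])
    then have "h (y \<oplus>\<^bsub>E\<^esub> i d) = z" using E'.add_diff_cancel[OF z hy] by simp
    then show "z \<in> h ` carrier E" using y d hom_closed[OF s(1)] by blast
  qed
  ultimately show ?thesis using hom_closed[OF h] by (auto simp: bij_betw_def)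
qed

section \<open>The category of finitely generated modules\<close>

text \<open>The element type \<open>'m\<close> is large enough to host a copy of each finitely generated module;
  constructions can be made on any type and then be moved to \<open>'m\<close>.\<close>

locale mod_category = ring R for R :: "('a, 'r) ring_scheme" (structure) +
  fixes host :: "'m itself"
  assumes infinite_host: "infinite (UNIV :: 'm set)"
    and host_large: "carrier R \<lesssim> (UNIV :: 'm set)"
    and noetherian: "noetherian_module R (regular_module R)"
begin

lemma host_copy:
  fixes M :: "('a, 'n) module"
  assumes M: "M \<in> fg_mod R"
  obtains N :: "('a, 'm) module" and \<theta> \<theta>' where "N \<in> fg_mod R"
    "\<theta> \<in> mod_hom R M N" "\<theta>' \<in> mod_hom R N M"
    "\<And>x. x \<in> carrier M \<Longrightarrow> \<theta>' (\<theta> x) = x" "\<And>y. y \<in> carrier N \<Longrightarrow> \<theta> (\<theta>' y) = y"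
proof -
  obtain N :: "('a, 'm) module" where N: "N \<in> fg_mod R" "mod_iso R M N"
    using fg_mod_universal[OF infinite_host host_large M] .
  then obtain \<theta> where t: "\<theta> \<in> mod_hom R M N" "bij_betw \<theta> (carrier M) (carrier N)"
    by (auto simp: mod_iso_def)
  note Mm = fg_modD[OF M] and Nm = fg_modD[OF N(1)]
  have surj: "\<theta> ` carrier M = carrier N" and inj: "inj_on \<theta> (carrier M)"
    using t(2) by (auto simp: bij_betw_def)
  interpret M: right_module R M by (rule Mm)
  obtain \<theta>' where t': "\<theta>' \<in> mod_hom R N M" "\<And>x. x \<in> carrier M \<Longrightarrow> \<theta>' (\<theta> x) = x"
  proof (rule factor_through_epi[OF t(1) surj hom_id Mm Nm Mm])
    fix x assume "x \<in> carrier M" "\<theta> x = \<zero>\<^bsub>N\<^esub>"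
    then show "x = \<zero>\<^bsub>M\<^esub>" using hom_zero[OF t(1) Mm Nm] inj_onD[OF inj, of x "\<zero>\<^bsub>M\<^esub>"] by simp
  qed auto
  show thesis
  proof (rule that[OF N(1) t(1) t'])
    fix y assume "y \<in> carrier N"
    then obtain x where "x \<in> carrier M" "y = \<theta> x" using surj by auto
    then show "\<theta> (\<theta>' y) = y" using t'(2) by simp
  qed
qed

lemma quotient_exists:
  fixes M :: "('a, 'n) module"
  assumes M: "M \<in> fg_mod R" and S: "right_submodule R M S"
  obtains Q :: "('a, 'm) module" and q where "Q \<in> fg_mod R" "q \<in> mod_hom R M Q"
    "q ` carrier M = carrier Q" "\<And>x. x \<in> carrier M \<Longrightarrow> q x = \<zero>\<^bsub>Q\<^esub> \<longleftrightarrow> x \<in> S"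
proof -
  obtain Q0 :: "('a, 'n) module" and q0 where Q0: "right_module R Q0" "q0 \<in> mod_hom R M Q0"
    "q0 ` carrier M = carrier Q0" "\<And>x. x \<in> carrier M \<Longrightarrow> q0 x = \<zero>\<^bsub>Q0\<^esub> \<longleftrightarrow> x \<in> S"
    using quotient_module_exists[OF fg_modD[OF M] S] by metis
  have Q0fg: "Q0 \<in> fg_mod R" by (rule fg_mod_epi_image[OF M Q0(1-3)])
  obtain Q :: "('a, 'm) module" and \<theta> \<theta>' where Q: "Q \<in> fg_mod R"
    "\<theta> \<in> mod_hom R Q0 Q" "\<theta>' \<in> mod_hom R Q Q0"
    "\<And>x. x \<in> carrier Q0 \<Longrightarrow> \<theta>' (\<theta> x) = x" "\<And>y. y \<in> carrier Q \<Longrightarrow> \<theta> (\<theta>' y) = y"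
    by (rule host_copy[OF Q0fg]) (blast intro: that)
  have Qm: "right_module R Q" by (rule fg_modD[OF Q(1)])
  show thesis
  proof (rule that[OF Q(1) hom_comp[OF Q0(2) Q(2)]])
    have "\<theta> ` carrier Q0 = carrier Q"
      using hom_closed[OF Q(2)] hom_closed[OF Q(3)] Q(5) by (force intro: image_eqI[symmetric])
    then show "(\<lambda>x. \<theta> (q0 x)) ` carrier M = carrier Q" using Q0(3) by (metis image_image)
    fix x assume x: "x \<in> carrier M"
    show "\<theta> (q0 x) = \<zero>\<^bsub>Q\<^esub> \<longleftrightarrow> x \<in> S"
      using Q0(4)[OF x] Q(4)[OF hom_closed[OF Q0(2) x]] hom_zero[OF Q(2) Q0(1) Qm]
        hom_zero[OF Q(3) Qm Q0(1)] by metis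
  qed
qed

lemma fg_sub_module:
  fixes M :: "('a, 'n) module"
  assumes M: "M \<in> fg_mod R" and S: "right_submodule R M S"
  shows "M\<lparr>carrier := S\<rparr> \<in> fg_mod R"
proof -
  have "noetherian_module R M"
    using M by (intro noetherian_if_fg[OF noetherian]) (auto simp: fg_mod_iff)
  then show ?thesis
    using S fg_restrict[OF fg_modD[OF M] S] right_module.sub_module[OF fg_modD[OF M] S]
    by (simp add: fg_mod_iff noetherian_module_def)
qed

text \<open>Projectivity is tested against modules on the type \<open>'m\<close> only; the copy of a free module
  has the lifting property because the free module itself has it for all types.\<close>

lemma free_cover:
  fixes M :: "('a, 'm) module"
  assumes M: "M \<in> fg_mod R"
  obtains P :: "('a, 'm) module" and \<pi> where "projective R P" "\<pi> \<in> mod_hom R P M"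
    "\<pi> ` carrier P = carrier M"
proof -
  obtain X where X: "finite X" "X \<subseteq> carrier M"
    and gen: "\<forall>y\<in>carrier M. \<exists>c\<in>X \<rightarrow> carrier R. y = (\<Oplus>\<^bsub>M\<^esub>x\<in>X. c x \<odot>\<^bsub>M\<^esub> x)"
    using M by (auto simp: fg_mod_def finitely_generated_def)
  let ?F = "free_module R X"
  note Ffg = free_module_fg[OF ring_axioms X(1)] and Fm = right_module_free[OF ring_axioms, of X]
  obtain P :: "('a, 'm) module" and \<theta> \<theta>' where P: "P \<in> fg_mod R"
    "\<theta> \<in> mod_hom R ?F P" "\<theta>' \<in> mod_hom R P ?F"
    "\<And>x. x \<in> carrier ?F \<Longrightarrow> \<theta>' (\<theta> x) = x" "\<And>y. y \<in> carrier P \<Longrightarrow> \<theta> (\<theta>' y) = y"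
    by (rule host_copy[OF Ffg]) (blast intro: that)
  interpret M: right_module R M using M by (rule fg_modD)
  have comb: "lin_comb M X (\<lambda>x. x) \<in> mod_hom R ?F M"
    using X by (intro lin_comb_hom[OF M.right_module_axioms]) auto
  have surj: "\<exists>x\<in>carrier P. lin_comb M X (\<lambda>x. x) (\<theta>' x) = y" if y: "y \<in> carrier M" for y
  proof -
    obtain c where c: "c \<in> X \<rightarrow> carrier R" "y = (\<Oplus>\<^bsub>M\<^esub>x\<in>X. c x \<odot>\<^bsub>M\<^esub> x)" using gen y by blast
    have r: "restrict c X \<in> carrier ?F" using c by auto
    have "lin_comb M X (\<lambda>x. x) (restrict c X) = y"
      unfolding lin_comb_def c(2) using c(1) X(2)
      by (intro M.M.finsum_cong') (auto intro!: M.act_closed)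
    then show ?thesis using P(4)[OF r] hom_closed[OF P(2) r] by metis
  qed
  have "projective R P"
    unfolding projective_def
  proof (intro conjI P(1) ballI impI)
    fix M' N' :: "('a, 'm) module" and g f
    assume M': "M' \<in> fg_mod R" and N': "N' \<in> fg_mod R" and g: "g \<in> mod_hom R M' N'"
      and f: "f \<in> mod_hom R P N'" and gs: "g ` carrier M' = carrier N'"
    let ?e = "unit_vector R X"
    have "\<exists>z\<in>carrier M'. g z = f (\<theta> (?e x))" for x
      using hom_closed[OF f hom_closed[OF P(2) unit_vector_closed[OF ring_axioms]]] gs
      by (metis imageE)
    then obtain y where y: "\<And>x. y x \<in> carrier M'" "\<And>x. g (y x) = f (\<theta> (?e x))" by metis
    have h: "lin_comb M' X y \<in> mod_hom R ?F M'"
      using y by (intro lin_comb_hom[OF fg_modD[OF M'] X(1)]) auto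
    have eq: "g (lin_comb M' X y c) = f (\<theta> c)" if c: "c \<in> carrier ?F" for c
    proof (rule free_module_hom_eq[OF ring_axioms X(1) fg_modD[OF N'] hom_comp[OF h g]
          hom_comp[OF P(2) f] _ c])
      fix x assume "x \<in> X"
      then show "g (lin_comb M' X y (?e x)) = f (\<theta> (?e x))"
        using y by (subst lin_comb_unit_vector[OF fg_modD[OF M'] X(1)]) auto
    qed
    show "\<exists>h\<in>mod_hom R P M'. \<forall>x\<in>carrier P. g (h x) = f x"
      using eq hom_closed[OF P(3)] P(5) by (intro bexI[OF _ hom_comp[OF P(3) h]]) auto
  qed
  moreover have "(\<lambda>x. lin_comb M X (\<lambda>x. x) (\<theta>' x)) ` carrier P = carrier M"
    using surj hom_closed[OF comb hom_closed[OF P(3)]] by fastforce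
  ultimately show thesis using that hom_comp[OF P(3) comb] by blast
qed

text \<open>The fibre product of \<open>A\<close> and \<open>Z\<close> over \<open>B\<close> is finitely generated since it is an extension
  of \<open>A\<close> by \<open>D\<close>.\<close>

lemma pullback_extension:
  fixes A D Z B :: "('a, 'm) module"
  assumes e: "short_exact_seq R D i Z p B" and u: "u \<in> mod_hom R A B"
    and A: "A \<in> fg_mod R" and D: "D \<in> fg_mod R" and Z: "Z \<in> fg_mod R" and B: "right_module R B"
  obtains Y :: "('a, 'm) module" and j q w where "Y \<in> fg_mod R" "short_exact_seq R D j Y q A"
    "w \<in> mod_hom R Y Z" "\<And>y. y \<in> carrier Y \<Longrightarrow> p (w y) = u (q y)"
proof -
  note s = short_exact_seqD[OF e]
  note Am = fg_modD[OF A] and Dm = fg_modD[OF D] and Zm = fg_modD[OF Z]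
  interpret A: right_module R A by (rule Am)
  interpret D: right_module R D by (rule Dm)
  interpret Z: right_module R Z by (rule Zm)
  note AZ = right_module_dsum[OF Am Zm]
  let ?S = "{x \<in> carrier (dsum A Z). u (fst x) \<ominus>\<^bsub>B\<^esub> p (snd x) = \<zero>\<^bsub>B\<^esub>}"
  have S: "right_submodule R (dsum A Z) ?S"
    by (rule sub_kernel[OF hom_difference[OF hom_comp[OF fst_hom u] hom_comp[OF snd_hom s(2)] B] AZ B])
  have Siff: "(a, z) \<in> ?S \<longleftrightarrow> a \<in> carrier A \<and> z \<in> carrier Z \<and> u a = p z" for a z
    using right_module.diff_zero_eq[OF B] right_module.diff_self[OF B]
      hom_closed[OF u] hom_closed[OF s(2)] by auto
  define Y0 where "Y0 = (dsum A Z)\<lparr>carrier := ?S\<rparr>"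
  have Y0m: "right_module R Y0" unfolding Y0_def by (rule right_module.sub_module[OF AZ S])
  have fst: "fst \<in> mod_hom R Y0 A" and snd: "snd \<in> mod_hom R Y0 Z"
    by (auto intro!: mod_homI simp: Y0_def)
  have carr: "(a, z) \<in> carrier Y0 \<longleftrightarrow> a \<in> carrier A \<and> z \<in> carrier Z \<and> u a = p z" for a z
    unfolding Y0_def using Siff by simp
  have u0: "u \<zero>\<^bsub>A\<^esub> = \<zero>\<^bsub>B\<^esub>" by (rule hom_zero[OF u Am B])
  have inj0: "(\<lambda>d. (\<zero>\<^bsub>A\<^esub>, i d)) \<in> mod_hom R D Y0"
  proof (rule mod_homI)
    fix x assume "x \<in> carrier D"
    then show "(\<zero>\<^bsub>A\<^esub>, i x) \<in> carrier Y0"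
      using hom_closed[OF s(1)] ses_comp_zero[OF e] u0 by (simp add: carr)
  qed (auto simp: Y0_def hom_add[OF s(1)] hom_act[OF s(1)] A.act_zero)
  have fst_surj: "fst ` carrier Y0 = carrier A"
  proof
    show "fst ` carrier Y0 \<subseteq> carrier A" using hom_closed[OF fst] by auto
    show "carrier A \<subseteq> fst ` carrier Y0"
    proof
      fix a assume a: "a \<in> carrier A"
      then have "u a \<in> p ` carrier Z" using hom_closed[OF u] s(4) by auto
      then obtain z where "z \<in> carrier Z" "u a = p z" by auto
      then have "(a, z) \<in> carrier Y0" using a carr by auto
      then show "a \<in> fst ` carrier Y0" by (metis fst_conv imageI)
    qed
  qed
  have ker: "(\<lambda>d. (\<zero>\<^bsub>A\<^esub>, i d)) ` carrier D = {y \<in> carrier Y0. fst y = \<zero>\<^bsub>A\<^esub>}"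
  proof
    show "(\<lambda>d. (\<zero>\<^bsub>A\<^esub>, i d)) ` carrier D \<subseteq> {y \<in> carrier Y0. fst y = \<zero>\<^bsub>A\<^esub>}"
      using hom_closed[OF inj0] by auto
    show "{y \<in> carrier Y0. fst y = \<zero>\<^bsub>A\<^esub>} \<subseteq> (\<lambda>d. (\<zero>\<^bsub>A\<^esub>, i d)) ` carrier D"
    proof clarify
      fix a z assume "(a, z) \<in> carrier Y0" "fst (a, z) = \<zero>\<^bsub>A\<^esub>"
      then have "a = \<zero>\<^bsub>A\<^esub>" "z \<in> carrier Z" "p z = \<zero>\<^bsub>B\<^esub>" using carr u0 by auto
      then show "(a, z) \<in> (\<lambda>d. (\<zero>\<^bsub>A\<^esub>, i d)) ` carrier D" using s(5) by blast
    qed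
  qed
  have Y0: "Y0 \<in> fg_mod R" by (rule fg_mod_extension[OF Y0m fst inj0 A D fst_surj ker])
  obtain Y :: "('a, 'm) module" and \<theta> \<theta>' where Y: "Y \<in> fg_mod R"
    "\<theta> \<in> mod_hom R Y0 Y" "\<theta>' \<in> mod_hom R Y Y0"
    "\<And>x. x \<in> carrier Y0 \<Longrightarrow> \<theta>' (\<theta> x) = x" "\<And>y. y \<in> carrier Y \<Longrightarrow> \<theta> (\<theta>' y) = y"
    by (rule host_copy[OF Y0]) (blast intro: that)
  show thesis
  proof (rule that[OF Y(1) _ hom_comp[OF Y(3) snd]])
    show "short_exact_seq R D (\<lambda>d. \<theta> (\<zero>\<^bsub>A\<^esub>, i d)) Y (\<lambda>y. fst (\<theta>' y)) A"
    proof (rule short_exact_seqI[OF hom_comp[OF inj0 Y(2)] hom_comp[OF Y(3) fst]])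
      show "inj_on (\<lambda>d. \<theta> (\<zero>\<^bsub>A\<^esub>, i d)) (carrier D)"
      proof (rule inj_onI)
        fix x y assume xy: "x \<in> carrier D" "y \<in> carrier D" "\<theta> (\<zero>\<^bsub>A\<^esub>, i x) = \<theta> (\<zero>\<^bsub>A\<^esub>, i y)"
        then have "(\<zero>\<^bsub>A\<^esub>, i x) = (\<zero>\<^bsub>A\<^esub>, i y)"
          using Y(4) hom_closed[OF inj0 xy(1)] hom_closed[OF inj0 xy(2)] by metis
        then show "x = y" using s(3) xy by (auto dest: inj_onD)
      qed
      show "(\<lambda>y. fst (\<theta>' y)) ` carrier Y = carrier A"
      proof -
        have "\<theta>' ` carrier Y = carrier Y0"
          using hom_closed[OF Y(2)] hom_closed[OF Y(3)] Y(4) by (force intro: image_eqI[symmetric])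
        then show ?thesis using fst_surj by (metis image_image)
      qed
      show "(\<lambda>d. \<theta> (\<zero>\<^bsub>A\<^esub>, i d)) ` carrier D = {y \<in> carrier Y. fst (\<theta>' y) = \<zero>\<^bsub>A\<^esub>}" (is "?l = ?r")
      proof
        show "?l \<subseteq> ?r" using hom_closed[OF inj0] hom_closed[OF Y(2)] Y(4) by auto
        show "?r \<subseteq> ?l"
        proof clarify
          fix y assume y: "y \<in> carrier Y" "fst (\<theta>' y) = \<zero>\<^bsub>A\<^esub>"
          then have "\<theta>' y \<in> (\<lambda>d. (\<zero>\<^bsub>A\<^esub>, i d)) ` carrier D" using ker hom_closed[OF Y(3)] by auto
          then obtain d where d: "d \<in> carrier D" "\<theta>' y = (\<zero>\<^bsub>A\<^esub>, i d)" by auto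
          then have "y = \<theta> (\<zero>\<^bsub>A\<^esub>, i d)" using Y(5)[OF y(1)] by simp
          then show "y \<in> ?l" using d by auto
        qed
      qed
    qed
    fix y assume "y \<in> carrier Y"
    from hom_closed[OF Y(3) this] show "p (snd (\<theta>' y)) = u (fst (\<theta>' y))"
      using carr[of "fst (\<theta>' y)" "snd (\<theta>' y)"] by simp
  qed
qed

lemma split_extension_exists:
  fixes A D :: "('a, 'm) module"
  assumes A: "A \<in> fg_mod R" and D: "D \<in> fg_mod R"
  obtains E :: "('a, 'm) module" and i p where "E \<in> fg_mod R" "short_exact_seq R D i E p A"
proof -
  \<comment> \<open>pull back \<open>0 \<rightarrow> D \<rightarrow> D \<rightarrow> 0 \<rightarrow> 0\<close>\<close>
  interpret D: right_module R D using D by (rule fg_modD)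
  let ?O = "D\<lparr>carrier := {\<zero>\<^bsub>D\<^esub>}\<rparr>"
  have "right_submodule R D {\<zero>\<^bsub>D\<^esub>}" by (rule right_submoduleI) (auto simp: D.act_zero)
  then have O: "right_module R ?O" by (rule D.sub_module)
  have "short_exact_seq R D (\<lambda>x. x) D (\<lambda>_. \<zero>\<^bsub>D\<^esub>) ?O"
    by (intro short_exact_seqI hom_id) (auto intro!: mod_homI simp: D.act_zero)
  moreover have "(\<lambda>_. \<zero>\<^bsub>D\<^esub>) \<in> mod_hom R A ?O"
    by (auto intro!: mod_homI simp: D.act_zero)
  ultimately show thesis using pullback_extension[OF _ _ A D D O] that by metis
qed

lemma split_retraction:
  fixes A D E :: "('a, 'm) module"
  assumes e: "short_exact_seq R D i E p A"
    and s: "s \<in> mod_hom R A E" "\<And>x. x \<in> carrier A \<Longrightarrow> p (s x) = x"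
    and A: "right_module R A" and D: "right_module R D" and E: "right_module R E"
  obtains r where "r \<in> mod_hom R E D" "\<And>y. y \<in> carrier E \<Longrightarrow> i (r y) = y \<ominus>\<^bsub>E\<^esub> s (p y)"
    "\<And>d. d \<in> carrier D \<Longrightarrow> r (i d) = d"
proof -
  interpret E: right_module R E by (rule E)
  note x = short_exact_seqD[OF e]
  note sp = hom_comp[OF x(2) s(1)]
  obtain r where r: "r \<in> mod_hom R E D" "\<And>y. y \<in> carrier E \<Longrightarrow> i (r y) = y \<ominus>\<^bsub>E\<^esub> s (p y)"
  proof (rule factor_through_mono[OF x(1,3) hom_difference[OF hom_id sp E] D E])
    fix y assume y: "y \<in> carrier E"
    have "p (y \<ominus>\<^bsub>E\<^esub> s (p y)) = \<zero>\<^bsub>A\<^esub>"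
      using y hom_closed[OF sp y] s(2)[OF hom_closed[OF x(2) y]]
      by (intro hom_eq_zeroI[OF x(2) E A]) auto
    then show "y \<ominus>\<^bsub>E\<^esub> s (p y) \<in> i ` carrier D" using x(5) y hom_closed[OF sp y] by auto
  qed auto
  have "r (i d) = d" if d: "d \<in> carrier D" for d
  proof (rule inj_onD[OF x(3)])
    show "i (r (i d)) = i d"
      using r(2)[OF hom_closed[OF x(1) d]] ses_comp_zero[OF e d] hom_zero[OF s(1) A E]
        hom_closed[OF x(1) d] by (simp add: a_minus_def)
  qed (use d hom_closed[OF r(1) hom_closed[OF x(1) d]] in auto)
  with r show thesis by (rule that)
qed

lemma ext_rel_refl: "e \<in> extensions R A D \<Longrightarrow> (e, e) \<in> ext_rel R A D"
  by (cases e) (auto simp: ext_rel_def intro!: bexI[OF _ hom_id] bij_betw_id[unfolded id_def])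

text \<open>A section of the first extension gives a retraction onto \<open>D\<close>; together with a section of
  the second one it defines a morphism between them.\<close>

lemma split_extensions_equivalent:
  fixes A D :: "('a, 'm) module"
  assumes A: "A \<in> fg_mod R" and D: "D \<in> fg_mod R"
    and e: "(E, i, p) \<in> Ext1_zero R A D" and e': "(E', i', p') \<in> Ext1_zero R A D"
  shows "((E, i, p), (E', i', p')) \<in> ext_rel R A D"
proof -
  have E: "E \<in> fg_mod R" "short_exact_seq R D i E p A"
    and E': "E' \<in> fg_mod R" "short_exact_seq R D i' E' p' A"
    using e e' by (auto simp: Ext1_zero_def extensions_def)
  obtain s s' where s: "s \<in> mod_hom R A E" "\<And>x. x \<in> carrier A \<Longrightarrow> p (s x) = x"
    and s': "s' \<in> mod_hom R A E'" "\<And>x. x \<in> carrier A \<Longrightarrow> p' (s' x) = x"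
    using e e' by (auto simp: Ext1_zero_def)
  note Am = fg_modD[OF A] and Dm = fg_modD[OF D] and Em = fg_modD[OF E(1)] and Em' = fg_modD[OF E'(1)]
  interpret E: right_module R E by (rule Em)
  interpret E': right_module R E' by (rule Em')
  interpret A: right_module R A by (rule Am)
  note x = short_exact_seqD[OF E(2)] and x' = short_exact_seqD[OF E'(2)]
  obtain r where r: "r \<in> mod_hom R E D" and ri: "\<And>d. d \<in> carrier D \<Longrightarrow> r (i d) = d"
    using split_retraction[OF E(2) s Am Dm Em] by metis
  define h where "h y = i' (r y) \<oplus>\<^bsub>E'\<^esub> s' (p y)" for y
  have h: "h \<in> mod_hom R E E'"
    unfolding h_def by (rule hom_sum[OF hom_comp[OF r(1) x'(1)] hom_comp[OF x(2) s'(1)] Em'])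
  have hi: "h (i d) = i' d" if d: "d \<in> carrier D" for d
    using d ri ses_comp_zero[OF E(2) d] hom_zero[OF s'(1) Am Em'] hom_closed[OF x'(1) d]
    by (simp add: h_def)
  have ph: "p' (h y) = p y" if y: "y \<in> carrier E" for y
    using hom_closed[OF r(1) y] ses_comp_zero[OF E'(2)] s'(2) hom_closed[OF x(2) y]
      hom_closed[OF x'(1)] hom_closed[OF s'(1)]
    by (simp add: h_def hom_add[OF x'(2)])
  have "bij_betw h (carrier E) (carrier E')"
    by (rule extension_morphism_bij[OF E(2) E'(2) Dm Em Em' Am h hi ph])
  then show ?thesis
    using E E' h hi ph by (auto simp: ext_rel_def extensions_def)
qed

text \<open>Vanishing of the set of equivalence classes also says that it is nonempty, which the direct
  sum takes care of.\<close>

lemma Ext1_vanishes_iff: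
  fixes A D :: "('a, 'm) module"
  assumes A: "A \<in> fg_mod R" and D: "D \<in> fg_mod R"
  shows "Ext1_vanishes R A D \<longleftrightarrow> extensions R A D \<subseteq> Ext1_zero R A D"
proof
  assume v: "Ext1_vanishes R A D"
  show "extensions R A D \<subseteq> Ext1_zero R A D"
  proof
    fix e assume e: "e \<in> extensions R A D"
    then have "ext_rel R A D `` {e} = Ext1_zero R A D"
      using v quotientI[OF e, of "ext_rel R A D"] by (simp add: Ext1_vanishes_def Ext1_def)
    then show "e \<in> Ext1_zero R A D" using ext_rel_refl[OF e] by blast
  qed
next
  assume sub: "extensions R A D \<subseteq> Ext1_zero R A D"
  then have eq: "Ext1_zero R A D = extensions R A D" by (auto simp: Ext1_zero_def)
  have "ext_rel R A D `` {e} = extensions R A D" if e: "e \<in> extensions R A D" for e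
  proof
    show "ext_rel R A D `` {e} \<subseteq> extensions R A D" by (auto simp: ext_rel_def)
    show "extensions R A D \<subseteq> ext_rel R A D `` {e}"
      using split_extensions_equivalent[OF A D] e eq by (cases e) auto
  qed
  moreover obtain E i p where "(E, i, p) \<in> extensions R A D"
    by (rule split_extension_exists[OF A D]) (simp add: extensions_def that)
  ultimately show "Ext1_vanishes R A D"
    unfolding Ext1_vanishes_def Ext1_def eq quotient_def by blast
qed

lemma Ext1_vanishes_section:
  fixes A D E :: "('a, 'm) module"
  assumes "Ext1_vanishes R A D" "A \<in> fg_mod R" "D \<in> fg_mod R" "E \<in> fg_mod R"
    "short_exact_seq R D i E p A"
  obtains s where "s \<in> mod_hom R A E" "\<And>x. x \<in> carrier A \<Longrightarrow> p (s x) = x"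
proof -
  have "(E, i, p) \<in> Ext1_zero R A D"
    using assms Ext1_vanishes_iff[OF assms(2,3)] by (auto simp: extensions_def)
  then show thesis using that by (auto simp: Ext1_zero_def)
qed

lemma Ext1_vanishesI:
  fixes A D :: "('a, 'm) module"
  assumes "A \<in> fg_mod R" "D \<in> fg_mod R"
    and "\<And>E i p. \<lbrakk>E \<in> fg_mod R; short_exact_seq R D i E p A\<rbrakk>
      \<Longrightarrow> \<exists>s\<in>mod_hom R A E. \<forall>x\<in>carrier A. p (s x) = x"
  shows "Ext1_vanishes R A D"
  using assms(3) unfolding Ext1_vanishes_iff[OF assms(1,2)] by (auto simp: extensions_def Ext1_zero_def)

text \<open>The part of the long exact sequence that is used below: when \<open>Ext\<^sup>1(A, D)\<close> vanishes,
  a section of the pulled back extension is a lift of \<open>u\<close>.\<close>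

lemma Ext1_vanishes_lift:
  fixes A D Z B :: "('a, 'm) module"
  assumes v: "Ext1_vanishes R A D" and e: "short_exact_seq R D i Z p B" and u: "u \<in> mod_hom R A B"
    and A: "A \<in> fg_mod R" and D: "D \<in> fg_mod R" and Z: "Z \<in> fg_mod R" and B: "B \<in> fg_mod R"
  obtains l where "l \<in> mod_hom R A Z" "\<And>x. x \<in> carrier A \<Longrightarrow> p (l x) = u x"
proof -
  obtain Y :: "('a, 'm) module" and j q w where Y: "Y \<in> fg_mod R" "short_exact_seq R D j Y q A"
    "w \<in> mod_hom R Y Z" "\<And>y. y \<in> carrier Y \<Longrightarrow> p (w y) = u (q y)"
    using pullback_extension[OF e u A D Z fg_modD[OF B]] by metis
  obtain s where s: "s \<in> mod_hom R A Y" "\<And>x. x \<in> carrier A \<Longrightarrow> q (s x) = x"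
    using Ext1_vanishes_section[OF v A D Y(1,2)] by metis
  show thesis
    using that[OF hom_comp[OF s(1) Y(3)]] Y(4)[OF hom_closed[OF s(1)]] s(2) by metis
qed

end

section \<open>Torsion classes\<close>

lemma subcategory_fg: "\<lbrakk>subcategory R \<X>; M \<in> \<X>\<rbrakk> \<Longrightarrow> M \<in> fg_mod R"
  unfolding subcategory_def by (elim conjE) (rule subsetD)

lemma subcategory_iso:
  assumes "subcategory R \<X>" "M \<in> \<X>" "N \<in> fg_mod R" "mod_iso R M N"
  shows "N \<in> \<X>"
proof -
  have "\<forall>M\<in>\<X>. \<forall>N\<in>fg_mod R. mod_iso R M N \<longrightarrow> N \<in> \<X>"
    using assms(1) unfolding subcategory_def by (elim conjE)
  then show ?thesis using assms(2-4) by blast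
qed

lemma subcategory_summand:
  assumes "subcategory R \<X>" "X \<in> \<X>" "A \<in> fg_mod R" "B \<in> fg_mod R" "biproduct R A B X"
  shows "A \<in> \<X>"
proof -
  have "\<forall>X\<in>\<X>. \<forall>A\<in>fg_mod R. \<forall>B\<in>fg_mod R. biproduct R A B X \<longrightarrow> A \<in> \<X>"
    using assms(1) unfolding subcategory_def by (elim conjE)
  then show ?thesis using assms(2-5) by blast
qed

lemma projective_lift:
  fixes P M N :: "('a, 'm) module"
  assumes "projective R P" "M \<in> fg_mod R" "N \<in> fg_mod R" "g \<in> mod_hom R M N"
    "g ` carrier M = carrier N" "f \<in> mod_hom R P N"
  obtains h where "h \<in> mod_hom R P M" "\<And>x. x \<in> carrier P \<Longrightarrow> g (h x) = f x"
proof -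
  have "\<exists>h\<in>mod_hom R P M. \<forall>x\<in>carrier P. g (h x) = f x"
    using assms(1)[unfolded projective_def, THEN conjunct2, rule_format, OF assms(2,3,4,6,5)] .
  then show thesis using that by blast
qed

context mod_category
begin

text \<open>The projection to the torsion-free part vanishes, so the torsion part is everything.\<close>

lemma torsionI:
  fixes A :: "('a, 'm) module" and \<T> \<F> :: "('a, 'm) module set"
  assumes tp: "torsion_pair R \<T> \<F>" and T: "subcategory R \<T>"
    and A: "A \<in> fg_mod R"
    and zero: "\<And>F g x. \<lbrakk>F \<in> \<F>; g \<in> mod_hom R A F; x \<in> carrier A\<rbrakk> \<Longrightarrow> g x = \<zero>\<^bsub>F\<^esub>"
  shows "A \<in> \<T>"
proof -
  obtain tA fA i p where *: "tA \<in> \<T>" "fA \<in> \<F>" "short_exact_seq R tA i A p fA"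
    using tp A by (auto simp: torsion_pair_def)
  note s = short_exact_seqD[OF *(3)]
  have "i ` carrier tA = carrier A" using s(5) zero[OF *(2) s(2)] by auto
  then have "mod_iso R tA A" using s(1,3) by (auto simp: mod_iso_def bij_betw_def)
  then show ?thesis by (rule subcategory_iso[OF T *(1) A])
qed

lemma torsion_quotient:
  fixes X Q :: "('a, 'm) module" and \<T> \<F> :: "('a, 'm) module set"
  assumes tp: "torsion_pair R \<T> \<F>" and T: "subcategory R \<T>"
    and X: "X \<in> \<T>" and Q: "Q \<in> fg_mod R" and f: "f \<in> mod_hom R X Q"
    and surj: "f ` carrier X = carrier Q"
  shows "Q \<in> \<T>"
proof (rule torsionI[OF tp T Q])
  fix F g y assume F: "F \<in> \<F>" and g: "g \<in> mod_hom R Q F" and "y \<in> carrier Q"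
  then obtain x where "x \<in> carrier X" "y = f x" using surj by auto
  then show "g y = \<zero>\<^bsub>F\<^esub>" using tp X F hom_comp[OF f g] by (auto simp: torsion_pair_def)
qed

text \<open>A map to a torsion-free module vanishes on the submodule, hence factors through the quotient,
  and vanishes there as well.\<close>

lemma torsion_extension:
  fixes X Y E :: "('a, 'm) module" and \<T> \<F> :: "('a, 'm) module set"
  assumes tp: "torsion_pair R \<T> \<F>" and T: "subcategory R \<T>" and F: "subcategory R \<F>"
    and X: "X \<in> \<T>" and Y: "Y \<in> \<T>" and E: "E \<in> fg_mod R" and e: "short_exact_seq R X i E p Y"
  shows "E \<in> \<T>"
proof (rule torsionI[OF tp T E])
  fix W g z assume W: "W \<in> \<F>" and g: "g \<in> mod_hom R E W" and z: "z \<in> carrier E"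
  note s = short_exact_seqD[OF e]
  have Ym: "right_module R Y" and Wm: "right_module R W"
    using fg_modD[OF subcategory_fg[OF T Y]] fg_modD[OF subcategory_fg[OF F W]] .
  have gi: "g (i x) = \<zero>\<^bsub>W\<^esub>" if "x \<in> carrier X" for x
    using tp X W hom_comp[OF s(1) g] that by (auto simp: torsion_pair_def)
  obtain h where h: "h \<in> mod_hom R Y W" "\<And>y. y \<in> carrier E \<Longrightarrow> h (p y) = g y"
  proof (rule factor_through_epi[OF s(2,4) g fg_modD[OF E] Ym Wm])
    fix y assume "y \<in> carrier E" "p y = \<zero>\<^bsub>Y\<^esub>"
    then have "y \<in> i ` carrier X" using s(5) by simp
    then show "g y = \<zero>\<^bsub>W\<^esub>" using gi by auto
  qed auto
  have "h (p z) = \<zero>\<^bsub>W\<^esub>"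
    using tp Y W h(1) hom_closed[OF s(2) z] by (auto simp: torsion_pair_def)
  then show "g z = \<zero>\<^bsub>W\<^esub>" using h(2) z by simp
qed

section \<open>From approximations of projectives to approximations of all modules\<close>

text \<open>With \<open>\<pi> : P \<rightarrow> M\<close> a surjection from a projective module and \<open>K\<close> its kernel, push the
  approximation \<open>f : P \<rightarrow> D\<^sub>0\<close> out along \<open>\<pi>\<close>. The pushout \<open>D\<^sub>0 / f K\<close> is a quotient of a torsion
  module, and the cokernel does not change.\<close>

lemma left_approx_of_projective_descends:
  fixes M :: "('a, 'm) module" and \<C> \<T> \<F> :: "('a, 'm) module set"
  assumes tp: "torsion_pair R \<T> \<F>" and T: "subcategory R \<T>" and C: "subcategory R \<C>"
    and proj: "\<And>P. projective R P \<Longrightarrow>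
      \<exists>D\<in>\<C> \<inter> \<T>. \<exists>C\<in>\<C>. \<exists>f g. right_exact_seq R P f D g C \<and> left_approx R \<T> P f D"
    and M: "M \<in> fg_mod R"
  shows "\<exists>D\<in>\<T>. \<exists>C\<in>\<C>. \<exists>f g. right_exact_seq R M f D g C \<and> left_approx R \<T> M f D"
proof -
  obtain P :: "('a, 'm) module" and \<pi> where P: "projective R P" "\<pi> \<in> mod_hom R P M"
    "\<pi> ` carrier P = carrier M" using free_cover[OF M] .
  obtain D0 C0 f g where D0: "D0 \<in> \<T>" and C0: "C0 \<in> \<C>"
    and ex: "right_exact_seq R P f D0 g C0" and ap: "left_approx R \<T> P f D0"
    using proj[OF P(1)] by auto
  have Pm: "right_module R P" using P(1) by (intro fg_modD) (simp add: projective_def)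
  have D0fg: "D0 \<in> fg_mod R" and C0m: "right_module R C0"
    using subcategory_fg[OF T D0] fg_modD[OF subcategory_fg[OF C C0]] .
  note D0m = fg_modD[OF D0fg] and Mm = fg_modD[OF M]
  have f: "f \<in> mod_hom R P D0" and g: "g \<in> mod_hom R D0 C0" and gs: "g ` carrier D0 = carrier C0"
    and fg: "f ` carrier P = {x \<in> carrier D0. g x = \<zero>\<^bsub>C0\<^esub>}"
    using ex by (auto simp: right_exact_seq_def exact_at_def)
  define K where "K = {x \<in> carrier P. \<pi> x = \<zero>\<^bsub>M\<^esub>}"
  have K: "right_submodule R P K" unfolding K_def by (rule sub_kernel[OF P(2) Pm Mm])
  obtain D :: "('a, 'm) module" and q where D: "D \<in> fg_mod R" "q \<in> mod_hom R D0 D"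
    "q ` carrier D0 = carrier D" "\<And>x. x \<in> carrier D0 \<Longrightarrow> q x = \<zero>\<^bsub>D\<^esub> \<longleftrightarrow> x \<in> f ` K"
    by (rule quotient_exists[OF D0fg sub_image[OF f Pm D0m K]]) (blast intro: that)
  note Dm = fg_modD[OF D(1)]
  have DT: "D \<in> \<T>" by (rule torsion_quotient[OF tp T D0 D(1-3)])
  obtain f' where f': "f' \<in> mod_hom R M D" "\<And>x. x \<in> carrier P \<Longrightarrow> f' (\<pi> x) = q (f x)"
  proof (rule factor_through_epi[OF P(2,3) hom_comp[OF f D(2)] Pm Mm Dm])
    fix x assume "x \<in> carrier P" "\<pi> x = \<zero>\<^bsub>M\<^esub>"
    then show "q (f x) = \<zero>\<^bsub>D\<^esub>" using D(4) hom_closed[OF f] by (auto simp: K_def)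
  qed auto
  obtain g' where g': "g' \<in> mod_hom R D C0" "\<And>y. y \<in> carrier D0 \<Longrightarrow> g' (q y) = g y"
  proof (rule factor_through_epi[OF D(2,3) g D0m Dm C0m])
    fix y assume "y \<in> carrier D0" "q y = \<zero>\<^bsub>D\<^esub>"
    then have "y \<in> f ` carrier P" using D(4) by (auto simp: K_def)
    then show "g y = \<zero>\<^bsub>C0\<^esub>" using fg by auto
  qed auto
  have "exact_at M f' D g' C0"
    unfolding exact_at_def
  proof
    show "f' ` carrier M \<subseteq> {z \<in> carrier D. g' z = \<zero>\<^bsub>C0\<^esub>}"
    proof clarify
      fix m assume m: "m \<in> carrier M"
      then obtain x where x: "x \<in> carrier P" "m = \<pi> x" using P(3) by auto
      have "g (f x) = \<zero>\<^bsub>C0\<^esub>" using fg x by auto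
      then show "f' m \<in> carrier D \<and> g' (f' m) = \<zero>\<^bsub>C0\<^esub>"
        using x f'(2) g'(2) hom_closed[OF f] hom_closed[OF f'(1) m] by simp
    qed
    show "{z \<in> carrier D. g' z = \<zero>\<^bsub>C0\<^esub>} \<subseteq> f' ` carrier M"
    proof clarify
      fix z assume z: "z \<in> carrier D" "g' z = \<zero>\<^bsub>C0\<^esub>"
      then obtain y where y: "y \<in> carrier D0" "z = q y" using D(3) by auto
      then have "y \<in> f ` carrier P" using fg g'(2) z by auto
      then obtain x where x: "x \<in> carrier P" "y = f x" by auto
      then have "z = f' (\<pi> x)" using f'(2) y by simp
      then show "z \<in> f' ` carrier M" using hom_closed[OF P(2)] x by auto
    qed
  qed
  moreover have "g' ` carrier D = carrier C0"
    using gs D(3) g'(2) by (metis (no_types, lifting) image_cong image_image)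
  ultimately have "right_exact_seq R M f' D g' C0"
    using f'(1) g'(1) by (simp add: right_exact_seq_def)
  moreover have "left_approx R \<T> M f' D"
    unfolding left_approx_def
  proof (intro conjI DT f'(1) ballI)
    fix X u assume X: "X \<in> \<T>" and u: "u \<in> mod_hom R M X"
    have Xm: "right_module R X" by (rule fg_modD[OF subcategory_fg[OF T X]])
    obtain h0 where h0: "h0 \<in> mod_hom R D0 X" "\<And>x. x \<in> carrier P \<Longrightarrow> u (\<pi> x) = h0 (f x)"
      using ap X hom_comp[OF P(2) u] by (auto simp: left_approx_def) metis
    obtain h where h: "h \<in> mod_hom R D X" "\<And>y. y \<in> carrier D0 \<Longrightarrow> h (q y) = h0 y"
    proof (rule factor_through_epi[OF D(2,3) h0(1) D0m Dm Xm])
      fix y assume "y \<in> carrier D0" "q y = \<zero>\<^bsub>D\<^esub>"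
      then obtain x where "x \<in> carrier P" "\<pi> x = \<zero>\<^bsub>M\<^esub>" "y = f x" using D(4) by (auto simp: K_def)
      then show "h0 y = \<zero>\<^bsub>X\<^esub>" using h0(2)[of x] hom_zero[OF u Mm Xm] by simp
    qed auto
    have "u m = h (f' m)" if m: "m \<in> carrier M" for m
    proof -
      obtain x where x: "x \<in> carrier P" "m = \<pi> x" using P(3) m by auto
      then show ?thesis using h0(2) h(2) f'(2) hom_closed[OF f] by simp
    qed
    then show "\<exists>h\<in>mod_hom R D X. \<forall>m\<in>carrier M. u m = h (f' m)" using h(1) by auto
  qed
  ultimately show ?thesis using DT C0 by blast
qed

text \<open>Let \<open>P \<rightarrow> M\<close> be a surjection from a projective module and let \<open>\<delta> : Q \<rightarrow> P\<close> map a
  projective module onto its kernel; the kernel is finitely generated by noetherianity. Let \<open>f : Q \<rightarrow> D\<^sub>0\<close>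
  be the given approximation and \<open>E\<close> the pushout of \<open>\<delta>\<close> and \<open>f\<close>. The kernel of \<open>E \<rightarrow> M\<close> is the
  image of \<open>D\<^sub>0\<close>, so it is torsion. To split an extension \<open>0 \<rightarrow> X \<rightarrow> Z \<rightarrow> E \<rightarrow> 0\<close> with \<open>X\<close>
  torsion, lift the two maps \<open>P \<rightarrow> E\<close> and \<open>D\<^sub>0 \<rightarrow> E\<close> to \<open>Z\<close>. The two lifts need not agree on \<open>Q\<close>, but
  they differ by a map \<open>Q \<rightarrow> X\<close>, which extends along \<open>f\<close> to \<open>D\<^sub>0\<close>. Once the second lift is
  corrected by that extension, they induce a section on \<open>E\<close>. A surjection onto \<open>M\<close> with torsion
  kernel and source orthogonal to torsion modules is an approximation by lifting.\<close>

lemma right_approx_from_projectives: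
  fixes M :: "('a, 'm) module" and \<T> \<F> :: "('a, 'm) module set"
  assumes tp: "torsion_pair R \<T> \<F>" and T: "subcategory R \<T>"
    and proj: "\<And>P. projective R P \<Longrightarrow>
      \<exists>D\<in>left_Ext1_perp R \<T> \<inter> \<T>. \<exists>f. left_approx R \<T> P f D"
    and M: "M \<in> fg_mod R"
  shows "\<exists>D\<in>\<T>. \<exists>C\<in>left_Ext1_perp R \<T>. \<exists>i g.
    short_exact_seq R D i C g M \<and> right_approx R (left_Ext1_perp R \<T>) C g M"
proof -
  note Mm = fg_modD[OF M]
  obtain P :: "('a, 'm) module" and \<pi> where P: "projective R P" "\<pi> \<in> mod_hom R P M"
    "\<pi> ` carrier P = carrier M" using free_cover[OF M] .
  have Pfg: "P \<in> fg_mod R" using P(1) by (auto simp: projective_def)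
  note Pm = fg_modD[OF Pfg]
  interpret P: right_module R P by (rule Pm)
  let ?K = "{x \<in> carrier P. \<pi> x = \<zero>\<^bsub>M\<^esub>}"
  let ?KM = "P\<lparr>carrier := ?K\<rparr>"
  have KM: "?KM \<in> fg_mod R" by (rule fg_sub_module[OF Pfg sub_kernel[OF P(2) Pm Mm]])
  obtain Q :: "('a, 'm) module" and \<delta>0 where Q: "projective R Q" "\<delta>0 \<in> mod_hom R Q ?KM"
    "\<delta>0 ` carrier Q = carrier ?KM" using free_cover[OF KM] .
  have Qm: "right_module R Q" using Q(1) by (intro fg_modD) (simp add: projective_def)
  interpret Q: right_module R Q by (rule Qm)
  have \<delta>: "\<delta>0 \<in> mod_hom R Q P" "\<delta>0 ` carrier Q = ?K"
    using Q(2,3) by (auto simp: mod_hom_def)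
  obtain D0 f where D0: "D0 \<in> left_Ext1_perp R \<T>" "D0 \<in> \<T>" and ap: "left_approx R \<T> Q f D0"
    using proj[OF Q(1)] by auto
  have D0fg: "D0 \<in> fg_mod R" using D0(1) by (simp add: left_Ext1_perp_def)
  note D0m = fg_modD[OF D0fg]
  interpret D0: right_module R D0 by (rule D0m)
  have f: "f \<in> mod_hom R Q D0" using ap by (simp add: left_approx_def)
  let ?S = "dsum P D0"
  let ?n = "\<lambda>y. (\<delta>0 y, \<ominus>\<^bsub>D0\<^esub> f y)"
  have n: "?n \<in> mod_hom R Q ?S" by (rule pair_hom[OF \<delta>(1) hom_neg[OF f D0m]])
  note Sm = right_module_dsum[OF Pm D0m]
  obtain E :: "('a, 'm) module" and e where E: "E \<in> fg_mod R" "e \<in> mod_hom R ?S E"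
    "e ` carrier ?S = carrier E" "\<And>w. w \<in> carrier ?S \<Longrightarrow> e w = \<zero>\<^bsub>E\<^esub> \<longleftrightarrow> w \<in> ?n ` carrier Q"
    by (rule quotient_exists[OF fg_mod_dsum[OF Pfg D0fg] sub_image[OF n Qm Sm Q.carrier_submodule]])
      (blast intro: that)
  note Em = fg_modD[OF E(1)]
  interpret E: right_module R E by (rule Em)
  have e_add: "e (x, d) = e (x, \<zero>\<^bsub>D0\<^esub>) \<oplus>\<^bsub>E\<^esub> e (\<zero>\<^bsub>P\<^esub>, d)" if "x \<in> carrier P" "d \<in> carrier D0" for x d
    using hom_add[OF E(2), of "(x, \<zero>\<^bsub>D0\<^esub>)" "(\<zero>\<^bsub>P\<^esub>, d)"] that by simp
  have en: "e (?n y) = \<zero>\<^bsub>E\<^esub>" if "y \<in> carrier Q" for y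
    using E(4)[OF hom_closed[OF n that]] that by blast
  obtain g where g: "g \<in> mod_hom R E M" "\<And>w. w \<in> carrier ?S \<Longrightarrow> g (e w) = \<pi> (fst w)"
  proof (rule factor_through_epi[OF E(2,3) hom_comp[OF fst_hom P(2)] Sm Em Mm])
    fix w assume "w \<in> carrier ?S" "e w = \<zero>\<^bsub>E\<^esub>"
    then obtain y where "y \<in> carrier Q" "w = ?n y" using E(4) by auto
    then show "\<pi> (fst w) = \<zero>\<^bsub>M\<^esub>" using \<delta>(2) by auto
  qed (blast intro: that)
  have gs: "g ` carrier E = carrier M"
  proof
    show "g ` carrier E \<subseteq> carrier M" using hom_closed[OF g(1)] by auto
    show "carrier M \<subseteq> g ` carrier E"
    proof
      fix m assume "m \<in> carrier M"
      then obtain x where x: "x \<in> carrier P" "m = \<pi> x" using P(3) by auto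
      then have "g (e (x, \<zero>\<^bsub>D0\<^esub>)) = m" "e (x, \<zero>\<^bsub>D0\<^esub>) \<in> carrier E"
        using g(2)[of "(x, \<zero>\<^bsub>D0\<^esub>)"] hom_closed[OF E(2)] by auto
      then show "m \<in> g ` carrier E" by blast
    qed
  qed
  let ?L = "{z \<in> carrier E. g z = \<zero>\<^bsub>M\<^esub>}"
  let ?D = "E\<lparr>carrier := ?L\<rparr>"
  have D: "?D \<in> fg_mod R" by (rule fg_sub_module[OF E(1) sub_kernel[OF g(1) Em Mm]])
  have ses: "short_exact_seq R ?D (\<lambda>z. z) E g M"
    by (rule short_exact_seqI) (auto intro!: mod_homI simp: g(1) gs)
  have DT: "?D \<in> \<T>"
  proof (rule torsion_quotient[OF tp T D0(2) D])
    have L: "e (\<zero>\<^bsub>P\<^esub>, d) \<in> ?L" if "d \<in> carrier D0" for d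
      using that hom_closed[OF E(2)] g(2)[of "(\<zero>\<^bsub>P\<^esub>, d)"] hom_zero[OF P(2) Pm Mm] by simp
    show "(\<lambda>d. e (\<zero>\<^bsub>P\<^esub>, d)) \<in> mod_hom R D0 ?D"
      using hom_comp[OF inr_hom[OF Pm] E(2)] L by (auto simp: mod_hom_def)
    show "(\<lambda>d. e (\<zero>\<^bsub>P\<^esub>, d)) ` carrier D0 = carrier ?D"
    proof
      show "(\<lambda>d. e (\<zero>\<^bsub>P\<^esub>, d)) ` carrier D0 \<subseteq> carrier ?D" using L by auto
      show "carrier ?D \<subseteq> (\<lambda>d. e (\<zero>\<^bsub>P\<^esub>, d)) ` carrier D0"
      proof
        fix z assume "z \<in> carrier ?D"
        then have z: "z \<in> carrier E" "g z = \<zero>\<^bsub>M\<^esub>" by auto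
        from z(1) obtain x d where xd: "x \<in> carrier P" "d \<in> carrier D0" "z = e (x, d)"
          unfolding E(3)[symmetric] by auto
        then have "x \<in> ?K" using z g(2)[of "(x, d)"] by simp
        then obtain y where y: "y \<in> carrier Q" "x = \<delta>0 y" using \<delta>(2) by blast
        note fy = hom_closed[OF f y(1)]
        have "(x, d) = ?n y \<oplus>\<^bsub>?S\<^esub> (\<zero>\<^bsub>P\<^esub>, f y \<oplus>\<^bsub>D0\<^esub> d)"
          using xd y fy by (simp add: D0.M.r_neg1)
        then have "z = e (?n y) \<oplus>\<^bsub>E\<^esub> e (\<zero>\<^bsub>P\<^esub>, f y \<oplus>\<^bsub>D0\<^esub> d)"
          using xd y fy hom_closed[OF n y(1)]
          by (simp only: xd(3)) (rule hom_add[OF E(2)], auto)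
        also have "\<dots> = e (\<zero>\<^bsub>P\<^esub>, f y \<oplus>\<^bsub>D0\<^esub> d)"
          using en[OF y(1)] hom_closed[OF E(2), of "(\<zero>\<^bsub>P\<^esub>, f y \<oplus>\<^bsub>D0\<^esub> d)"] xd fy by simp
        finally show "z \<in> (\<lambda>d. e (\<zero>\<^bsub>P\<^esub>, d)) ` carrier D0" using fy xd by auto
      qed
    qed
  qed
  have perp: "E \<in> left_Ext1_perp R \<T>"
    unfolding left_Ext1_perp_def
  proof (intro CollectI conjI E(1) ballI)
    fix X assume X: "X \<in> \<T>"
    then have Xfg: "X \<in> fg_mod R" by (rule subcategory_fg[OF T])
    note Xm = fg_modD[OF Xfg]
    interpret X: right_module R X by (rule Xm)
    have vD0: "Ext1_vanishes R D0 X" using D0(1) X by (simp add: left_Ext1_perp_def)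
    show "Ext1_vanishes R E X"
    proof (rule Ext1_vanishesI[OF E(1) Xfg])
      fix Z :: "('a, 'm) module" and i p
      assume Z: "Z \<in> fg_mod R" and ex: "short_exact_seq R X i Z p E"
      note Zm = fg_modD[OF Z]
      interpret Z: right_module R Z by (rule Zm)
      note s = short_exact_seqD[OF ex]
      obtain u1 where u1: "u1 \<in> mod_hom R P Z" "\<And>x. x \<in> carrier P \<Longrightarrow> p (u1 x) = e (x, \<zero>\<^bsub>D0\<^esub>)"
        by (rule projective_lift[OF P(1) Z E(1) s(2,4) hom_comp[OF inl_hom[OF D0m] E(2)]])
          (blast intro: that)
      obtain u2 where u2: "u2 \<in> mod_hom R D0 Z" "\<And>d. d \<in> carrier D0 \<Longrightarrow> p (u2 d) = e (\<zero>\<^bsub>P\<^esub>, d)"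
        using Ext1_vanishes_lift[OF vD0 ex hom_comp[OF inr_hom[OF Pm] E(2)] D0fg Xfg Z E(1)] by metis
      \<comment> \<open>the disagreement of the two lifts on \<open>Q\<close>\<close>
      let ?w = "\<lambda>y. u1 (\<delta>0 y) \<oplus>\<^bsub>Z\<^esub> u2 (\<ominus>\<^bsub>D0\<^esub> f y)"
      have w: "?w \<in> mod_hom R Q Z"
        by (rule hom_sum[OF hom_comp[OF \<delta>(1) u1(1)] hom_comp[OF hom_neg[OF f D0m] u2(1)] Zm])
      obtain v where v: "v \<in> mod_hom R Q X" "\<And>y. y \<in> carrier Q \<Longrightarrow> i (v y) = ?w y"
      proof (rule factor_through_mono[OF s(1,3) w Xm Qm])
        fix y assume y: "y \<in> carrier Q"
        have "p (?w y) = e (?n y)"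
          using y hom_closed[OF \<delta>(1) y] hom_closed[OF f y] hom_closed[OF u1(1)] hom_closed[OF u2(1)]
          by (simp add: hom_add[OF s(2)] u1(2) u2(2) e_add[of "\<delta>0 y" "\<ominus>\<^bsub>D0\<^esub> f y"])
        then show "?w y \<in> i ` carrier X" using s(5) en[OF y] hom_closed[OF w y] by simp
      qed (blast intro: that)
      obtain h where h: "h \<in> mod_hom R D0 X" "\<And>y. y \<in> carrier Q \<Longrightarrow> v y = h (f y)"
        using ap X v(1) by (auto simp: left_approx_def) metis
      \<comment> \<open>the corrected lift vanishes on the relations of the pushout\<close>
      let ?u = "\<lambda>t. u1 (fst t) \<oplus>\<^bsub>Z\<^esub> (u2 (snd t) \<oplus>\<^bsub>Z\<^esub> i (h (snd t)))"
      have u: "?u \<in> mod_hom R ?S Z"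
        by (rule hom_sum[OF hom_comp[OF fst_hom u1(1)] hom_sum[OF hom_comp[OF snd_hom u2(1)]
                hom_comp[OF snd_hom hom_comp[OF h(1) s(1)]] Zm] Zm])
      obtain l where l: "l \<in> mod_hom R E Z" "\<And>t. t \<in> carrier ?S \<Longrightarrow> l (e t) = ?u t"
      proof (rule factor_through_epi[OF E(2,3) u Sm Em Zm])
        fix t assume "t \<in> carrier ?S" "e t = \<zero>\<^bsub>E\<^esub>"
        then obtain y where y: "y \<in> carrier Q" "t = ?n y" using E(4) by auto
        note fy = hom_closed[OF f y(1)] and hfy = hom_closed[OF h(1) hom_closed[OF f y(1)]]
        have "i (h (\<ominus>\<^bsub>D0\<^esub> f y)) = \<ominus>\<^bsub>Z\<^esub> i (v y)"
          using fy hfy h(2)[OF y(1)] by (simp add: hom_minus[OF h(1) D0m Xm] hom_minus[OF s(1) Xm Zm])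
        then have "?u t = ?w y \<oplus>\<^bsub>Z\<^esub> \<ominus>\<^bsub>Z\<^esub> i (v y)"
          using y fy hom_closed[OF u1(1) hom_closed[OF \<delta>(1) y(1)]] hom_closed[OF u2(1)]
            hom_closed[OF s(1) hom_closed[OF v(1) y(1)]] by (simp add: Z.M.a_assoc)
        then show "?u t = \<zero>\<^bsub>Z\<^esub>" using v(2)[OF y(1)] hom_closed[OF w y(1)] by (simp add: Z.M.r_neg)
      qed (blast intro: that)
      have "p (l z) = z" if z: "z \<in> carrier E" for z
      proof -
        obtain x d where xd: "x \<in> carrier P" "d \<in> carrier D0" "z = e (x, d)"
          using z unfolding E(3)[symmetric] by auto
        note hd = hom_closed[OF h(1) xd(2)]
        note cl = hom_closed[OF u1(1) xd(1)] hom_closed[OF u2(1) xd(2)] hom_closed[OF s(1) hd]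
        have "p (l z) = p (u1 x) \<oplus>\<^bsub>E\<^esub> (p (u2 d) \<oplus>\<^bsub>E\<^esub> p (i (h d)))"
          using l(2)[of "(x, d)"] xd cl by (simp add: hom_add[OF s(2)])
        also have "\<dots> = z"
          using xd u1(2) u2(2) ses_comp_zero[OF ex hd] e_add[OF xd(1,2)] hom_closed[OF E(2)] by simp
        finally show ?thesis .
      qed
      then show "\<exists>l\<in>mod_hom R E Z. \<forall>x\<in>carrier E. p (l x) = x" using l(1) by auto
    qed
  qed
  have "right_approx R (left_Ext1_perp R \<T>) E g M"
    unfolding right_approx_def
  proof (intro conjI perp g(1) ballI)
    fix X u assume X: "X \<in> left_Ext1_perp R \<T>" and u: "u \<in> mod_hom R X M"
    then have "X \<in> fg_mod R" "Ext1_vanishes R X ?D" using DT by (auto simp: left_Ext1_perp_def)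
    then show "\<exists>h\<in>mod_hom R X E. \<forall>x\<in>carrier X. u x = g (h x)"
      using Ext1_vanishes_lift[OF _ ses u _ D E(1) M] by metis
  qed
  then show ?thesis using DT perp ses by blast
qed

section \<open>Consequences of the weak cotorsion property\<close>

text \<open>A module orthogonal to the torsion modules splits off from its approximation.\<close>

lemma left_perp_of_weak_cotorsion:
  fixes \<C> \<T> :: "('a, 'm) module set"
  assumes C: "subcategory R \<C>" and T: "subcategory R \<T>"
    and wc: "left_weak_cotorsion_pair R \<C> \<T>"
  shows "\<C> = left_Ext1_perp R \<T>"
proof
  show "\<C> \<subseteq> left_Ext1_perp R \<T>"
    using subcategory_fg[OF C] wc by (auto simp: left_weak_cotorsion_pair_def left_Ext1_perp_def)
  show "left_Ext1_perp R \<T> \<subseteq> \<C>"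
  proof
    fix A assume "A \<in> left_Ext1_perp R \<T>"
    then have A: "A \<in> fg_mod R" "\<And>D. D \<in> \<T> \<Longrightarrow> Ext1_vanishes R A D"
      by (auto simp: left_Ext1_perp_def)
    obtain D E i g where D: "D \<in> \<T>" and E: "E \<in> \<C>" and ex: "short_exact_seq R D i E g A"
      using wc A(1) by (auto simp: left_weak_cotorsion_pair_def)
    have Dfg: "D \<in> fg_mod R" and Efg: "E \<in> fg_mod R" using subcategory_fg[OF T D] subcategory_fg[OF C E] .
    note Am = fg_modD[OF A(1)] and Dm = fg_modD[OF Dfg] and Em = fg_modD[OF Efg]
    interpret E: right_module R E by (rule Em)
    interpret D: right_module R D by (rule Dm)
    note x = short_exact_seqD[OF ex]
    obtain s where s: "s \<in> mod_hom R A E" "\<And>x. x \<in> carrier A \<Longrightarrow> g (s x) = x"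
      using Ext1_vanishes_section[OF A(2)[OF D] A(1) Dfg Efg ex] by metis
    obtain r where r: "r \<in> mod_hom R E D" "\<And>y. y \<in> carrier E \<Longrightarrow> i (r y) = y \<ominus>\<^bsub>E\<^esub> s (g y)"
      "\<And>d. d \<in> carrier D \<Longrightarrow> r (i d) = d"
      using split_retraction[OF ex s Am Dm Em] by metis
    have rs: "r (s a) = \<zero>\<^bsub>D\<^esub>" if a: "a \<in> carrier A" for a
    proof (rule inj_onD[OF x(3)])
      show "i (r (s a)) = i \<zero>\<^bsub>D\<^esub>"
        using r(2) s hom_closed[OF s(1) a] a E.diff_self hom_zero[OF x(1) Dm Em] by simp
    qed (use hom_closed[OF r(1) hom_closed[OF s(1) a]] in auto)
    have "s (g y) \<oplus>\<^bsub>E\<^esub> i (r y) = y" if y: "y \<in> carrier E" for y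
      using r(2)[OF y] E.add_diff_cancel[OF y hom_closed[OF s(1) hom_closed[OF x(2) y]]] by simp
    then have "biproduct R A D E"
      unfolding biproduct_def using s x(1,2) r rs ses_comp_zero[OF ex]
      by (intro bexI[OF _ s(1)] bexI[OF _ x(1)] bexI[OF _ x(2)] bexI[OF _ r(1)]) auto
    then show "A \<in> \<C>" by (rule subcategory_summand[OF C E A(1) Dfg])
  qed
qed

text \<open>Let \<open>p : Z \<rightarrow> D\<close> be an extension with torsion kernel. Then \<open>Z\<close> is torsion, so a lift of
  \<open>f : P \<rightarrow> D\<close> to \<open>Z\<close> has the form \<open>h f\<close> with \<open>h : D \<rightarrow> Z\<close>. The map \<open>1 - p h\<close> kills the image
  of \<open>f\<close>, so it factors through \<open>C\<close>, and from \<open>C\<close> it lifts to \<open>Z\<close>. The sum of \<open>h\<close> and this lift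
  is a section of \<open>p\<close>.\<close>

lemma projective_approx_in_left_perp:
  fixes \<C> \<T> \<F> :: "('a, 'm) module set"
  assumes tp: "torsion_pair R \<T> \<F>" and T: "subcategory R \<T>" and F: "subcategory R \<F>"
    and C: "C \<in> left_Ext1_perp R \<T>" and P: "projective R P"
    and ex: "right_exact_seq R P f D g C" and ap: "left_approx R \<T> P f D"
  shows "D \<in> left_Ext1_perp R \<T>"
proof -
  have DT: "D \<in> \<T>" and f: "f \<in> mod_hom R P D" using ap by (auto simp: left_approx_def)
  then have Dfg: "D \<in> fg_mod R" by (intro subcategory_fg[OF T])
  have Cfg: "C \<in> fg_mod R" and vC: "\<And>X. X \<in> \<T> \<Longrightarrow> Ext1_vanishes R C X"
    using C by (auto simp: left_Ext1_perp_def)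
  note Dm = fg_modD[OF Dfg] and Cm = fg_modD[OF Cfg]
  interpret D: right_module R D by (rule Dm)
  have g: "g \<in> mod_hom R D C" "g ` carrier D = carrier C"
    and fg: "f ` carrier P = {x \<in> carrier D. g x = \<zero>\<^bsub>C\<^esub>}"
    using ex by (auto simp: right_exact_seq_def exact_at_def)
  show ?thesis
    unfolding left_Ext1_perp_def
  proof (intro CollectI conjI Dfg ballI)
    fix X assume X: "X \<in> \<T>"
    then have Xfg: "X \<in> fg_mod R" by (rule subcategory_fg[OF T])
    show "Ext1_vanishes R D X"
    proof (rule Ext1_vanishesI[OF Dfg Xfg])
      fix Z :: "('a, 'm) module" and i p
      assume Z: "Z \<in> fg_mod R" and e: "short_exact_seq R X i Z p D"
      note s = short_exact_seqD[OF e] and Zm = fg_modD[OF Z]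
      interpret Z: right_module R Z by (rule Zm)
      have ZT: "Z \<in> \<T>" by (rule torsion_extension[OF tp T F X DT Z e])
      obtain f' where f': "f' \<in> mod_hom R P Z" "\<And>x. x \<in> carrier P \<Longrightarrow> p (f' x) = f x"
        by (rule projective_lift[OF P Z Dfg s(2,4) f]) (blast intro: that)
      obtain h where h: "h \<in> mod_hom R D Z" "\<And>x. x \<in> carrier P \<Longrightarrow> f' x = h (f x)"
        using ap ZT f'(1) by (auto simp: left_approx_def) metis
      let ?c = "\<lambda>y. y \<ominus>\<^bsub>D\<^esub> p (h y)"
      have c: "?c \<in> mod_hom R D D" by (rule hom_difference[OF hom_id hom_comp[OF h(1) s(2)] Dm])
      obtain c where c: "c \<in> mod_hom R C D" "\<And>y. y \<in> carrier D \<Longrightarrow> c (g y) = ?c y"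
      proof (rule factor_through_epi[OF g c Dm Cm Dm])
        fix y assume "y \<in> carrier D" "g y = \<zero>\<^bsub>C\<^esub>"
        then have "y \<in> f ` carrier P" using fg by simp
        then obtain x where x: "x \<in> carrier P" "y = f x" by auto
        then have "p (h y) = y" using h(2) f'(2) by metis
        then show "?c y = \<zero>\<^bsub>D\<^esub>" using D.diff_self hom_closed[OF f] x by simp
      qed (blast intro: that)
      obtain c' where c': "c' \<in> mod_hom R C Z" "\<And>y. y \<in> carrier C \<Longrightarrow> p (c' y) = c y"
        using Ext1_vanishes_lift[OF vC[OF X] e c(1) Cfg Xfg Z Dfg] by metis
      have "p (h y \<oplus>\<^bsub>Z\<^esub> c' (g y)) = y" if y: "y \<in> carrier D" for y
        using y hom_closed[OF h(1) y] hom_closed[OF g(1) y] hom_closed[OF c'(1)] c'(2) c(2)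
          D.add_diff_cancel hom_closed[OF s(2)] by (simp add: hom_add[OF s(2)])
      then show "\<exists>s\<in>mod_hom R D Z. \<forall>x\<in>carrier D. p (s x) = x"
        by (intro bexI[OF _ hom_sum[OF h(1) hom_comp[OF g(1) c'(1)] Zm]]) auto
    qed
  qed
qed

text \<open>Maps from torsion modules to \<open>A\<close> land in the torsion part, and the approximation of the torsion
  part is itself torsion, being an extension of torsion modules.\<close>

lemma weak_cotorsion_torsion_contravariantly_finite:
  fixes \<C> \<T> \<F> :: "('a, 'm) module set"
  assumes tp: "torsion_pair R \<T> \<F>" and C: "subcategory R \<C>" and T: "subcategory R \<T>"
    and F: "subcategory R \<F>" and wc: "left_weak_cotorsion_pair R \<C> \<T>"
  shows "contravariantly_finite R (\<C> \<inter> \<T>)"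
  unfolding contravariantly_finite_def
proof
  fix A :: "('a, 'm) module" assume "A \<in> fg_mod R"
  then obtain tA fA i p where tA: "tA \<in> \<T>" "fA \<in> \<F>" "short_exact_seq R tA i A p fA"
    using tp by (auto simp: torsion_pair_def)
  note s = short_exact_seqD[OF tA(3)]
  have tAfg: "tA \<in> fg_mod R" by (rule subcategory_fg[OF T tA(1)])
  obtain D E j g where D: "D \<in> \<T>" and E: "E \<in> \<C>" and ex: "short_exact_seq R D j E g tA"
    and ap: "right_approx R \<C> E g tA"
    using wc tAfg by (auto simp: left_weak_cotorsion_pair_def)
  have "E \<in> fg_mod R" by (rule subcategory_fg[OF C E])
  then have ET: "E \<in> \<T>" using torsion_extension[OF tp T F D tA(1) _ ex] by simp
  have g: "g \<in> mod_hom R E tA" by (rule short_exact_seqD[OF ex])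
  have "right_approx R (\<C> \<inter> \<T>) E (\<lambda>x. i (g x)) A"
    unfolding right_approx_def
  proof (intro conjI IntI E ET hom_comp[OF g s(1)] ballI)
    fix X u assume X: "X \<in> \<C> \<inter> \<T>" and u: "u \<in> mod_hom R X A"
    then have Xm: "right_module R X" using fg_modD[OF subcategory_fg[OF C]] by blast
    obtain v where v: "v \<in> mod_hom R X tA" "\<And>x. x \<in> carrier X \<Longrightarrow> i (v x) = u x"
    proof (rule factor_through_mono[OF s(1,3) u fg_modD[OF tAfg] Xm])
      fix x assume x: "x \<in> carrier X"
      have "p (u x) = \<zero>\<^bsub>fA\<^esub>"
        using tp X tA(2) hom_comp[OF u s(2)] x by (auto simp: torsion_pair_def)
      then show "u x \<in> i ` carrier tA" using s(5) hom_closed[OF u x] by simp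
    qed auto
    then obtain h where "h \<in> mod_hom R X E" "\<And>x. x \<in> carrier X \<Longrightarrow> v x = g (h x)"
      using ap X by (auto simp: right_approx_def) metis
    then show "\<exists>h\<in>mod_hom R X E. \<forall>x\<in>carrier X. u x = i (g (h x))" using v(2) by metis
  qed
  then show "\<exists>X f. right_approx R (\<C> \<inter> \<T>) X f A" by blast
qed

section \<open>The equivalence\<close>

lemma tau_cotorsion_iff_left_weak_cotorsion:
  fixes \<C> \<T> \<F> :: "('a, 'm) module set"
  assumes C: "subcategory R \<C>" and T: "subcategory R \<T>" and F: "subcategory R \<F>"
    and tp: "torsion_pair R \<T> \<F>"
  shows "tau_cotorsion_pair R \<C> \<T> \<longleftrightarrow> left_weak_cotorsion_pair R \<C> \<T>"
proof
  assume tau: "tau_cotorsion_pair R \<C> \<T>"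
  then have perp: "\<C> = left_Ext1_perp R \<T>"
    and proj: "\<And>P. projective R P \<Longrightarrow>
      \<exists>D\<in>\<C> \<inter> \<T>. \<exists>C\<in>\<C>. \<exists>f g. right_exact_seq R P f D g C \<and> left_approx R \<T> P f D"
    by (auto simp: tau_cotorsion_pair_def)
  have "\<forall>C\<in>\<C>. \<forall>D\<in>\<T>. Ext1_vanishes R C D" unfolding perp by (auto simp: left_Ext1_perp_def)
  moreover have "\<exists>D\<in>\<T>. \<exists>C\<in>\<C>. \<exists>f g. right_exact_seq R M f D g C \<and> left_approx R \<T> M f D"
    if "M \<in> fg_mod R" for M
    by (rule left_approx_of_projective_descends[OF tp T C proj that])
  moreover have "\<exists>D\<in>\<T>. \<exists>C\<in>\<C>. \<exists>i g. short_exact_seq R D i C g M \<and> right_approx R \<C> C g M"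
    if "M \<in> fg_mod R" for M
    unfolding perp using proj by (intro right_approx_from_projectives[OF tp T _ that]) (metis perp)
  ultimately show "left_weak_cotorsion_pair R \<C> \<T>"
    by (simp add: left_weak_cotorsion_pair_def)
next
  assume wc: "left_weak_cotorsion_pair R \<C> \<T>"
  have perp: "\<C> = left_Ext1_perp R \<T>" by (rule left_perp_of_weak_cotorsion[OF C T wc])
  have "\<exists>D\<in>\<C> \<inter> \<T>. \<exists>C\<in>\<C>. \<exists>f g. right_exact_seq R P f D g C \<and> left_approx R \<T> P f D"
    if P: "projective R P" for P
  proof -
    have "P \<in> fg_mod R" using P by (simp add: projective_def)
    then obtain D C f g where *: "D \<in> \<T>" "C \<in> \<C>" "right_exact_seq R P f D g C" "left_approx R \<T> P f D"
      using wc by (auto simp: left_weak_cotorsion_pair_def)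
    then have "D \<in> \<C>" using projective_approx_in_left_perp[OF tp T F _ P] perp by blast
    then show ?thesis using * by blast
  qed
  then show "tau_cotorsion_pair R \<C> \<T>"
    using perp weak_cotorsion_torsion_contravariantly_finite[OF tp C T F wc]
    by (simp add: tau_cotorsion_pair_def)
qed

end

theorem theorem4p10:
  fixes k :: "('k, 'c) ring_scheme" and \<phi> :: "'k \<Rightarrow> 'a" and \<Lambda> :: "('a, 'r) ring_scheme"
    and \<C> \<T> \<F> :: "('a, 'm) module set"
  assumes "artin_algebra k \<phi> \<Lambda>"
    and "infinite (UNIV :: 'm set)" and "carrier \<Lambda> \<lesssim> (UNIV :: 'm set)"
    and "subcategory \<Lambda> \<C>" and "subcategory \<Lambda> \<T>" and "subcategory \<Lambda> \<F>"
  shows "tau_cotorsion_torsion_triple \<Lambda> \<C> \<T> \<F> \<longleftrightarrow>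
    left_weak_cotorsion_torsion_triple \<Lambda> \<C> \<T> \<F>"
proof -
  interpret artin_algebra k \<phi> \<Lambda> by (rule assms(1))
  interpret mod_category \<Lambda> "TYPE('m)"
    using assms(2,3) artin_algebra_noetherian[OF assms(1)]
    by (intro mod_category.intro mod_category_axioms.intro \<Lambda>.ring_axioms)
  show ?thesis
    using tau_cotorsion_iff_left_weak_cotorsion[OF assms(4-6)]
    by (auto simp: tau_cotorsion_torsion_triple_def left_weak_cotorsion_torsion_triple_def)
qed

end
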